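(* Let $d\ge 2$ and $2<p\le\infty$. There is a constant $C=C(p,d)>0$ such that for all integers $m\ge 3$ $$ d_m(\mathbf H^{1/2}_p,L_\infty)\le C\,m^{-1/2}(\log m)^{d-1/2}(\log\log m)^{3/2}, $$ where $\log$ is the natural logarithm.
   Context: All functions are $2\pi$-periodic in each of $d$ variables, i.e. defined on $\mathbb T^d$; $L_p=L_p(\mathbb T^d)$ with norm $\|\cdot\|_p$ (normalized Lebesgue measure). Kolmogorov widths: for a subset $\mathbf F$ of a Banach space $X$ and $m\ge1$, $$d_m(\mathbf F,X):=\inf_{\{u_i\}_{i=1}^m\subset X}\ \sup_{f\in\mathbf F}\ \inf_{c_1,\dots,c_m}\Big\|f-\sum_{i=1}^m c_iu_i\Big\|_X ,$$ where the $c_i$ are scalars. The class $\mathbf H^r_p$ (used here with $r=1/2$): for $\mathbf t=(t_1,\dots,t_d)$ let $\Delta^l_{t_j,j}$ denote the $l$-th difference operator with step $t_j$ in the variable $x_j$, and for $e\subset\{1,\dots,d\}$ let $\Delta^l_{\mathbf t}(e):=\prod_{j\in e}\Delta^l_{t_j,j}$, with $\Delta^l_{\mathbf t}(\varnothing)=I$ the identity. Fix $l=[r]+1$, where $[\cdot]$ is the integer part. Then $\mathbf H^r_p$ is the set of $f\in L_p$ such that for every $e\subset\{1,\dots,d\}$ and every $\mathbf t$ $$\|\Delta^l_{\mathbf t}(e)f\|_p\le\prod_{j\in e}|t_j|^r$$ (the empty product being $1$). *)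

theory Defs
  imports "HOL-Analysis.Analysis" "HOL-Probability.Essential_Supremum"
begin

text \<open>Functions on the \<open>d\<close>-dimensional torus are complex-valued functions on \<open>real ^ 'd\<close>,
  with \<open>d = CARD('d)\<close>, that are \<open>2 * pi\<close>-periodic in every coordinate. They are not
  quotiented by equality almost everywhere, so the \<open>L\<^sub>p\<close> norms below are seminorms.\<close>

definition torus_periodic :: "(real ^ 'd \<Rightarrow> complex) \<Rightarrow> bool" where
  "torus_periodic f \<longleftrightarrow> (\<forall>x j. f (x + axis j (2 * pi)) = f x)"

definition torus_measure :: "(real ^ 'd) measure" where
  "torus_measure = uniform_measure lebesgue (cbox 0 (\<chi> j. 2 * pi))"

text \<open>The norm takes values in \<^typ>\<open>ennreal\<close>, so that it is \<open>\<infinity>\<close>, and not a junk real number,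
  outside \<open>L\<^sub>p\<close>.\<close>

definition Lp_norm :: "ennreal \<Rightarrow> (real ^ 'd \<Rightarrow> complex) \<Rightarrow> ennreal" where
  "Lp_norm p f =
     (if p = \<infinity> then esssup torus_measure (\<lambda>x. ennreal (cmod (f x)))
      else let I = (\<integral>\<^sup>+ x. ennreal (cmod (f x) powr enn2real p) \<partial>torus_measure)
           in if I = \<infinity> then \<infinity> else ennreal (enn2real I powr (1 / enn2real p)))"

definition Lp_space :: "ennreal \<Rightarrow> (real ^ 'd \<Rightarrow> complex) set" where
  "Lp_space p = {f. f \<in> borel_measurable lebesgue \<and> torus_periodic f \<and> Lp_norm p f < \<infinity>}"

definition kolmogorov_width ::
    "nat \<Rightarrow> ('a \<Rightarrow> complex) set \<Rightarrow> ('a \<Rightarrow> complex) set \<Rightarrow> (('a \<Rightarrow> complex) \<Rightarrow> ennreal) \<Rightarrow> ennreal" where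
  "kolmogorov_width m F X N =
     (INF u \<in> {1..m} \<rightarrow> X. SUP f \<in> F. INF c :: nat \<Rightarrow> complex. N (\<lambda>x. f x - (\<Sum>i = 1..m. c i * u i x)))"

definition coord_diff :: "'d \<Rightarrow> real \<Rightarrow> (real ^ 'd \<Rightarrow> complex) \<Rightarrow> real ^ 'd \<Rightarrow> complex" where
  "coord_diff j h f = (\<lambda>x. f (x + axis j h) - f x)"

text \<open>The operators in different coordinates commute (shown below), so the product over \<open>e\<close>,
  in the sense of composition, can be taken with \<^const>\<open>Finite_Set.fold\<close>.\<close>

definition mixed_diff :: "nat \<Rightarrow> real ^ 'd \<Rightarrow> 'd set \<Rightarrow> (real ^ 'd \<Rightarrow> complex) \<Rightarrow> real ^ 'd \<Rightarrow> complex" where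
  "mixed_diff l t e f = Finite_Set.fold (\<lambda>j. coord_diff j (t $ j) ^^ l) f e"

definition mixed_Hoelder_class :: "real \<Rightarrow> ennreal \<Rightarrow> (real ^ 'd \<Rightarrow> complex) set" where
  "mixed_Hoelder_class r p =
     {f \<in> Lp_space p. \<forall>e t. Lp_norm p (mixed_diff (nat \<lfloor>r\<rfloor> + 1) t e f)
                              \<le> ennreal (\<Prod>j\<in>e. \<bar>t $ j\<bar> powr r)}"

lemma coord_diff_commute:
  "coord_diff i a (coord_diff j b f) = coord_diff j b (coord_diff i a f)"
  by (simp add: coord_diff_def fun_eq_iff add_ac)

lemma funpow_commute:
  assumes "A \<circ> B = B \<circ> A"
  shows "(A ^^ k) \<circ> (B ^^ l) = (B ^^ l) \<circ> (A ^^ k)"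
proof -
  have *: "A \<circ> (B ^^ n) = (B ^^ n) \<circ> A" for n
  proof (induction n)
    case (Suc n)
    have "A \<circ> (B ^^ Suc n) = (A \<circ> B) \<circ> (B ^^ n)"
      by (simp only: funpow.simps o_assoc)
    also have "\<dots> = B \<circ> (A \<circ> (B ^^ n))"
      by (simp only: assms o_assoc)
    also have "\<dots> = (B ^^ Suc n) \<circ> A"
      by (simp only: Suc.IH funpow.simps o_assoc)
    finally show ?case .
  qed simp
  show ?thesis
  proof (induction k)
    case (Suc k)
    have "(A ^^ Suc k) \<circ> (B ^^ l) = A \<circ> ((A ^^ k) \<circ> (B ^^ l))"
      by (simp only: funpow.simps o_assoc)
    also have "\<dots> = (A \<circ> (B ^^ l)) \<circ> (A ^^ k)"
      by (simp only: Suc.IH o_assoc)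
    also have "\<dots> = (B ^^ l) \<circ> (A ^^ Suc k)"
      unfolding * by (simp only: funpow.simps o_assoc)
    finally show ?case .
  qed simp
qed

lemma comp_fun_commute_coord_diff:
  "comp_fun_commute (\<lambda>j::'d::finite. coord_diff j (t $ j) ^^ l)"
proof
  fix i j :: 'd
  have "coord_diff j (t $ j) \<circ> coord_diff i (t $ i) = coord_diff i (t $ i) \<circ> coord_diff j (t $ j)"
    by (rule ext) (simp only: comp_apply, rule coord_diff_commute)
  then show "(coord_diff j (t $ j) ^^ l) \<circ> (coord_diff i (t $ i) ^^ l)
      = (coord_diff i (t $ i) ^^ l) \<circ> (coord_diff j (t $ j) ^^ l)"
    by (rule funpow_commute)
qed

lemma mixed_diff_empty [simp]: "mixed_diff l t {} f = f"
  by (simp add: mixed_diff_def)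

lemma mixed_diff_insert:
  fixes e :: "('d::finite) set"
  assumes "j \<notin> e"
  shows "mixed_diff l t (insert j e) f = (coord_diff j (t $ j) ^^ l) (mixed_diff l t e f)"
proof -
  interpret comp_fun_commute "\<lambda>j. coord_diff j (t $ j) ^^ l"
    by (rule comp_fun_commute_coord_diff)
  show ?thesis
    unfolding mixed_diff_def by (rule fold_insert) (use assms in auto)
qed

end

theory Submission
  imports Defs "HOL-Probability.Probability_Measure"
begin

text \<open>The approximating subspaces consist of step functions. In the product Haar system, a function of
  the class has block coefficients \<open>c s k\<close> that are controlled in \<open>\<ell>\<^sub>q\<close> for some \<open>q > 2\<close>, because
  a Haar coefficient is the mean of a mixed first difference over a dyadic box. Let \<open>N\<close> be the integer part of
  \<open>log 2 m\<close> and write \<open>level s\<close> for the sum of the components of \<open>s\<close>.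
  Blocks with \<open>level s < N - O(log N)\<close> are reproduced exactly, and blocks with \<open>level s \<ge> R * (N + 1)\<close>
  are dropped. In between, coefficients of levels \<open>\<ge> N\<close> are cut at a height that makes the lower part small in
  the maximum norm, while the upper part decays geometrically in mean square since \<open>q > 2\<close>. What remains lies in
  an ellipsoid, and all of it is approximated at once by \<open>m div 2\<close> random sign combinations of Haar functions.

  The width of this ellipsoid in the maximum norm is dual to a Gelfand width: one has to bound the
  Euclidean norm of the points of a symmetric convex hull of \<open>M\<close> vectors that lie in the kernel of a random
  sign matrix. Maurey's method replaces such a point by an average of \<open>n\<close> of the vectors, and there are so few of
  these averages for \<open>n\<close> of order \<open>m / ln M\<close> that the matrix is nearly isometric on all of them.\<close>

section \<open>Random sign matrices\<close>

text \<open>Smoothness 1/2 is critical for the maximum norm. With Haar functions normalized there,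
  the squared coefficients of every block sum to O(1), whatever its level, so square summability
  alone gives no decay; this is why the cut and the surplus \<open>q > 2\<close> are needed above
  level \<open>N\<close>. The functions of level below \<open>N\<close> number about N^(d-1) 2^N,
  too many for dimension m, and lowering the level by O(log N) pays for the polynomial factor. The
  O(log log m) levels left open all weigh the same. Times the N^(d-1) blocks of a level they make up
  the weight \<open>W\<close>, and the ellipsoid bound, of order \<open>W * sqrt (N / m)\<close>, is
  the rate. The log log m thus arises with exponent 1 and is turned into 3/2 at the very end.

  Haar functions serve for two more reasons. Within a block the supports are disjoint, so the
  largest coefficient bounds the block. And functions of bounded level are constant on finitely many
  cells, so the maximum norm lives on a finite set. Only the logarithm of its size, which is O(N),
  enters, and the duality is finite-dimensional.\<close>

lemma cosh_le_exp_half_square: "cosh x \<le> exp (x\<^sup>2 / 2)" for x :: real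
proof -
  \<comment> \<open>Instead of comparing Taylor coefficients,
    \<open>cosh z * exp (- (z\<^sup>2 / 2))\<close> is shown to decrease for z >= 0: its derivative
    has the sign of \<open>sinh z - z * cosh z\<close>.\<close>
  have sinh_le: "sinh y \<le> y * cosh y" if "0 \<le> y" for y :: real
  proof -
    have "0 * cosh 0 - sinh 0 \<le> y * cosh y - sinh y"
    proof (rule DERIV_nonneg_imp_nondecreasing[OF that])
      fix z :: real assume "0 \<le> z"
      have "((\<lambda>z. z * cosh z - sinh z) has_real_derivative z * sinh z) (at z)"
        by (auto intro!: derivative_eq_intros)
      then show "\<exists>D. ((\<lambda>z. z * cosh z - sinh z) has_real_derivative D) (at z) \<and> 0 \<le> D"
        using \<open>0 \<le> z\<close> by (intro exI[of _ "z * sinh z"]) auto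
    qed
    then show ?thesis by simp
  qed
  have pos: "cosh y \<le> exp (y\<^sup>2 / 2)" if "0 \<le> y" for y :: real
  proof -
    have "- (cosh 0 * exp (- (0\<^sup>2 / 2))) \<le> - (cosh y * exp (- (y\<^sup>2 / 2)))"
    proof (rule DERIV_nonneg_imp_nondecreasing[OF that])
      fix z :: real assume "0 \<le> z"
      have "((\<lambda>z. - (cosh z * exp (- (z\<^sup>2 / 2)))) has_real_derivative
          (z * cosh z - sinh z) * exp (- (z\<^sup>2 / 2))) (at z)"
        by (auto intro!: derivative_eq_intros simp: algebra_simps)
      then show "\<exists>D. ((\<lambda>z. - (cosh z * exp (- (z\<^sup>2 / 2)))) has_real_derivative D) (at z) \<and> 0 \<le> D"
        using sinh_le[OF \<open>0 \<le> z\<close>] by (intro exI[of _ "(z * cosh z - sinh z) * exp (- (z\<^sup>2 / 2))"]) auto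
    qed
    then have "cosh y * exp (- (y\<^sup>2 / 2)) \<le> 1" by simp
    then show ?thesis by (simp add: exp_minus field_simps)
  qed
  show ?thesis
    using pos[of "\<bar>x\<bar>"] by (simp add: cosh_real_abs)
qed

abbreviation sign_vectors :: "'k set \<Rightarrow> ('k \<Rightarrow> real) set" where
  "sign_vectors S \<equiv> PiE S (\<lambda>_. {-1, 1})"

lemma sum_sign_vectors_insert:
  assumes "finite S" "x \<notin> S"
  shows "(\<Sum>\<epsilon>\<in>sign_vectors (insert x S). F \<epsilon>)
    = (\<Sum>\<epsilon>\<in>sign_vectors S. F (\<epsilon>(x := -1)) + (F (\<epsilon>(x := 1)) :: real))"
proof -
  have "(\<Sum>\<epsilon>\<in>sign_vectors (insert x S). F \<epsilon>)
      = (\<Sum>(y, g)\<in>{-1, 1} \<times> sign_vectors S. F (g(x := y)))"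
    unfolding PiE_insert_eq using inj_combinator[OF assms(2), of "\<lambda>_. {-1, 1::real}"]
    by (subst sum.reindex) (auto simp: case_prod_unfold o_def)
  also have "\<dots> = (\<Sum>y\<in>{-1, 1}. \<Sum>g\<in>sign_vectors S. F (g(x := y)))"
    by (rule sum.cartesian_product[symmetric])
  finally show ?thesis by (simp add: sum.distrib)
qed

text \<open>Negative \<open>s\<close> will give the lower tail of a squared sign sum, positive \<open>s\<close> the upper tail. The quantity
  \<open>s + 8 * s\<^sup>2 * V\<close> absorbs the quadratic term of \<open>cosh\<close> at each step.\<close>

lemma sum_sign_vectors_exp_square:
  fixes v :: "'k \<Rightarrow> real"
  assumes "finite S" "8 * \<bar>s\<bar> * (\<Sum>k\<in>S. (v k)\<^sup>2) \<le> 1"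
  shows "(\<Sum>\<epsilon>\<in>sign_vectors S. exp (s * (c + (\<Sum>k\<in>S. \<epsilon> k * v k))\<^sup>2))
    \<le> 2 ^ card S * exp ((s + 8 * s\<^sup>2 * (\<Sum>k\<in>S. (v k)\<^sup>2)) * (c\<^sup>2 + (\<Sum>k\<in>S. (v k)\<^sup>2)))"
  using assms
\<comment> \<open>The offset \<open>c\<close> stands for the part of the sum whose signs are already
  fixed; the induction step replaces it by \<open>c - v x\<close> and
  \<open>c + v x\<close>.\<close>
proof (induction S arbitrary: c rule: finite_induct)
  case empty
  then show ?case by simp
next
  case (insert x S)
  define V where "V = (\<Sum>k\<in>S. (v k)\<^sup>2)"
  define \<kappa> where "\<kappa> = s + 8 * s\<^sup>2 * V"
  define \<kappa>' where "\<kappa>' = s + 8 * s\<^sup>2 * (V + (v x)\<^sup>2)"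
  have V0: "0 \<le> V" unfolding V_def by (simp add: sum_nonneg)
  have prem: "8 * \<bar>s\<bar> * (V + (v x)\<^sup>2) \<le> 1"
    using insert.prems insert.hyps by (simp add: V_def add.commute)
  have hV: "8 * \<bar>s\<bar> * V \<le> 1"
  proof -
    have "8 * \<bar>s\<bar> * V \<le> 8 * \<bar>s\<bar> * (V + (v x)\<^sup>2)" by (intro mult_left_mono) auto
    then show ?thesis using prem by linarith
  qed
  have IH: "(\<Sum>\<epsilon>\<in>sign_vectors S. exp (s * (c' + (\<Sum>k\<in>S. \<epsilon> k * v k))\<^sup>2))
      \<le> 2 ^ card S * exp (\<kappa> * (c'\<^sup>2 + V))" for c'
    using insert.IH[of c'] hV by (simp add: V_def \<kappa>_def)
  have k1: "\<kappa> \<le> \<kappa>'" unfolding \<kappa>_def \<kappa>'_def by (simp add: algebra_simps)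
  have abs_k: "\<bar>\<kappa>\<bar> \<le> 2 * \<bar>s\<bar>"
  proof -
    have "\<bar>8 * s\<^sup>2 * V\<bar> = \<bar>s\<bar> * (8 * \<bar>s\<bar> * V)"
      using V0 by (simp add: abs_mult power2_eq_square)
    also have "\<dots> \<le> \<bar>s\<bar> * 1" by (rule mult_left_mono[OF hV]) simp
    finally show ?thesis unfolding \<kappa>_def by linarith
  qed
  \<comment> \<open>Origin of the 8: the \<open>cosh\<close> bound costs
    \<open>2 * \<kappa>\<^sup>2\<close>, and the smallness of \<open>s\<close> keeps
    \<open>\<kappa>\<close> within \<open>2 * \<bar>s\<bar>\<close>, which makes this at most
    \<open>8 * s\<^sup>2\<close>.\<close>
  have k2: "\<kappa> + 2 * \<kappa>\<^sup>2 * (v x)\<^sup>2 \<le> \<kappa>'"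
  proof -
    have "\<bar>\<kappa>\<bar>\<^sup>2 \<le> (2 * \<bar>s\<bar>)\<^sup>2" using abs_k by (intro power_mono) auto
    then have "\<kappa>\<^sup>2 \<le> 4 * s\<^sup>2" by (simp add: power_mult_distrib)
    then have "2 * \<kappa>\<^sup>2 * (v x)\<^sup>2 \<le> 2 * (4 * s\<^sup>2) * (v x)\<^sup>2"
      by (intro mult_right_mono) auto
    then show ?thesis unfolding \<kappa>_def \<kappa>'_def by (simp add: algebra_simps)
  qed
  have split: "(\<Sum>k\<in>insert x S. (\<epsilon>(x := y)) k * v k) = y * v x + (\<Sum>k\<in>S. \<epsilon> k * v k)" for \<epsilon> y
    using insert.hyps by (simp, intro sum.cong) auto
  have "(\<Sum>\<epsilon>\<in>sign_vectors (insert x S). exp (s * (c + (\<Sum>k\<in>insert x S. \<epsilon> k * v k))\<^sup>2))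
      = (\<Sum>\<epsilon>\<in>sign_vectors S. exp (s * ((c - v x) + (\<Sum>k\<in>S. \<epsilon> k * v k))\<^sup>2))
      + (\<Sum>\<epsilon>\<in>sign_vectors S. exp (s * ((c + v x) + (\<Sum>k\<in>S. \<epsilon> k * v k))\<^sup>2))"
    unfolding sum_sign_vectors_insert[OF insert.hyps] split sum.distrib
    by (simp add: algebra_simps)
  also have "\<dots> \<le> 2 ^ card S * exp (\<kappa> * ((c - v x)\<^sup>2 + V)) + 2 ^ card S * exp (\<kappa> * ((c + v x)\<^sup>2 + V))"
    by (intro add_mono IH)
  \<comment> \<open>Adding up the two signs of the new coordinate turns the cross term of
    \<open>(c - v x)\<^sup>2\<close> and \<open>(c + v x)\<^sup>2\<close> into a
    \<open>cosh\<close>.\<close>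
  also have "\<dots> = 2 ^ card S * (2 * (exp (\<kappa> * (c\<^sup>2 + (v x)\<^sup>2 + V)) * cosh (2 * \<kappa> * c * v x)))"
    by (simp add: cosh_field_def exp_add[symmetric] exp_diff[symmetric] algebra_simps power2_sum power2_diff)
  also have "\<dots> \<le> 2 ^ card S * (2 * (exp (\<kappa> * (c\<^sup>2 + (v x)\<^sup>2 + V)) * exp ((2 * \<kappa> * c * v x)\<^sup>2 / 2)))"
    using cosh_le_exp_half_square by (intro mult_left_mono) auto
  also have "\<dots> = 2 ^ card (insert x S) * exp ((\<kappa> + 2 * \<kappa>\<^sup>2 * (v x)\<^sup>2) * c\<^sup>2 + \<kappa> * ((v x)\<^sup>2 + V))"
    using insert.hyps by (simp add: exp_add[symmetric] algebra_simps power_mult_distrib)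
  also have "\<dots> \<le> 2 ^ card (insert x S) * exp (\<kappa>' * c\<^sup>2 + \<kappa>' * ((v x)\<^sup>2 + V))"
    using k1 k2 V0 by (intro mult_left_mono) (auto intro!: add_mono mult_right_mono)
  finally show ?case
    using insert.hyps by (simp add: V_def \<kappa>'_def algebra_simps)
qed

abbreviation sign_matrices :: "nat \<Rightarrow> 'k set \<Rightarrow> (nat \<Rightarrow> 'k \<Rightarrow> real) set" where
  "sign_matrices m S \<equiv> PiE {..<m} (\<lambda>_. sign_vectors S)"

text \<open>The rows are independent, so the sum over matrices is the m-th power of a sum over one
  row. Dividing the exponent by \<open>V\<close> makes the bound the same for all vectors, as a
  union bound requires.\<close>

lemma sum_sign_matrices_exp:
  fixes v :: "'k \<Rightarrow> real"
  assumes "finite S" "(\<Sum>k\<in>S. (v k)\<^sup>2) = V" "0 < V" "8 * \<bar>s\<bar> \<le> 1"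
  shows "(\<Sum>G\<in>sign_matrices m S. exp (s / V * (\<Sum>r<m. (\<Sum>k\<in>S. G r k * v k)\<^sup>2)))
    \<le> (2 ^ card S) ^ m * exp (real m * (s + 8 * s\<^sup>2))"
proof -
  have fin: "finite (sign_vectors S)" using assms by (intro finite_PiE) auto
  have "(\<Sum>\<epsilon>\<in>sign_vectors S. exp (s / V * (0 + (\<Sum>k\<in>S. \<epsilon> k * v k))\<^sup>2))
      \<le> 2 ^ card S * exp ((s / V + 8 * (s / V)\<^sup>2 * V) * (0\<^sup>2 + V))"
    using sum_sign_vectors_exp_square[of S "s / V" v 0] assms by (simp add: abs_divide)
  also have "(s / V + 8 * (s / V)\<^sup>2 * V) * (0\<^sup>2 + V) = s + 8 * s\<^sup>2"
    using assms by (simp add: field_simps power2_eq_square)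
  finally have one: "(\<Sum>\<epsilon>\<in>sign_vectors S. exp (s / V * (\<Sum>k\<in>S. \<epsilon> k * v k)\<^sup>2))
      \<le> 2 ^ card S * exp (s + 8 * s\<^sup>2)" by simp
  have "(\<Sum>G\<in>sign_matrices m S. exp (s / V * (\<Sum>r<m. (\<Sum>k\<in>S. G r k * v k)\<^sup>2)))
      = (\<Sum>G\<in>sign_matrices m S. \<Prod>r<m. exp (s / V * (\<Sum>k\<in>S. G r k * v k)\<^sup>2))"
    by (simp add: sum_distrib_left exp_sum)
  also have "\<dots> = (\<Prod>r<m. \<Sum>\<epsilon>\<in>sign_vectors S. exp (s / V * (\<Sum>k\<in>S. \<epsilon> k * v k)\<^sup>2))"
    using fin by (subst prod_sum_PiE) auto
  also have "\<dots> = (\<Sum>\<epsilon>\<in>sign_vectors S. exp (s / V * (\<Sum>k\<in>S. \<epsilon> k * v k)\<^sup>2)) ^ m" by simp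
  also have "\<dots> \<le> (2 ^ card S * exp (s + 8 * s\<^sup>2)) ^ m"
    by (intro power_mono one sum_nonneg) auto
  finally show ?thesis by (simp add: power_mult_distrib exp_of_nat_mult)
qed

text \<open>Union bound by exponential moments: both tails of all vectors of \<open>P\<close> are
  collected in one potential \<open>\<Psi>\<close>. Its mean over the matrices is below 1, and a
  matrix with potential below 1 satisfies every inequality at once.\<close>

lemma exists_near_isometric_sign_matrix:
  fixes P :: "('k \<Rightarrow> real) set"
  assumes "finite S" "finite P" "2 * real (card P) < exp (real m / 64)"
  shows "\<exists>G \<in> sign_matrices m S. \<forall>v\<in>P.
    real m / 4 * (\<Sum>k\<in>S. (v k)\<^sup>2) \<le> (\<Sum>r<m. (\<Sum>k\<in>S. G r k * v k)\<^sup>2) \<and>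
    (\<Sum>r<m. (\<Sum>k\<in>S. G r k * v k)\<^sup>2) \<le> 4 * real m * (\<Sum>k\<in>S. (v k)\<^sup>2)"
proof -
  define V where "V = (\<lambda>v :: 'k \<Rightarrow> real. \<Sum>k\<in>S. (v k)\<^sup>2)"
  define Z where "Z = (\<lambda>(G :: nat \<Rightarrow> 'k \<Rightarrow> real) v. \<Sum>r<m. (\<Sum>k\<in>S. G r k * v k)\<^sup>2)"
  define Q where "Q = {v\<in>P. 0 < V v}"
  define \<Omega> where "\<Omega> = sign_matrices m S"
  \<comment> \<open>For \<open>s = - 1/16\<close> and \<open>s = 1/8\<close>, the quantity
    \<open>s + 8 * s\<^sup>2\<close> is \<open>- 1/32\<close> and \<open>1/4\<close>. The other
    exponentials are fitted so that a summand below 1 means \<open>Z > m * V / 4\<close> and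
    \<open>Z < 4 * m * V\<close>; the two means are then at most \<open>exp (- m / 64)\<close> and
    \<open>exp (- m / 4)\<close>.\<close>
  define \<Psi> where "\<Psi> = (\<lambda>G. \<Sum>v\<in>Q. exp (- (1/16) / V v * Z G v) * exp (real m / 64) + exp (1/8 / V v * Z G v) * exp (- real m / 2))"
  have fin: "finite \<Omega>" unfolding \<Omega>_def using assms by (intro finite_PiE) auto
  have fQ: "finite Q" and QP: "card Q \<le> card P" unfolding Q_def using assms by (auto intro: card_mono)
  have card\<Omega>: "real (card \<Omega>) = (2 ^ card S) ^ m"
    unfolding \<Omega>_def using assms(1) by (simp add: card_PiE)
  have pos: "0 < real (card \<Omega>)" unfolding card\<Omega> by simp
  have "(\<Sum>G\<in>\<Omega>. \<Psi> G) = (\<Sum>v\<in>Q. (\<Sum>G\<in>\<Omega>. exp (- (1/16) / V v * Z G v)) * exp (real m / 64)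
      + (\<Sum>G\<in>\<Omega>. exp (1/8 / V v * Z G v)) * exp (- real m / 2))"
    unfolding \<Psi>_def
    by (subst sum.swap) (simp only: sum.distrib sum_distrib_right)
  also have "\<dots> \<le> (\<Sum>v\<in>Q. ((2 ^ card S) ^ m * exp (real m * (- (1/16) + 8 * (- (1/16))\<^sup>2))) * exp (real m / 64)
      + ((2 ^ card S) ^ m * exp (real m * (1/8 + 8 * (1/8)\<^sup>2))) * exp (- real m / 2))"
    unfolding \<Omega>_def Z_def
    by (intro sum_mono add_mono mult_right_mono sum_sign_matrices_exp assms) (auto simp: V_def Q_def)
  also have "\<dots> = (\<Sum>v\<in>Q. real (card \<Omega>) * (exp (- real m / 64) + exp (- real m / 4)))"
    by (simp add: card\<Omega> exp_add[symmetric] algebra_simps power2_eq_square)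
  also have "\<dots> \<le> (\<Sum>v\<in>Q. real (card \<Omega>) * (2 * exp (- real m / 64)))"
    by (intro sum_mono mult_left_mono) auto
  also have "\<dots> = real (card \<Omega>) * (2 * real (card Q) * exp (- real m / 64))" by simp
  also have "\<dots> < real (card \<Omega>) * 1"
  proof (rule mult_strict_left_mono[OF _ pos])
    have "2 * real (card Q) < exp (real m / 64)" using QP assms(3) by linarith
    then have "2 * real (card Q) * exp (- real m / 64) < exp (real m / 64) * exp (- real m / 64)"
      by (intro mult_strict_right_mono) auto
    then show "2 * real (card Q) * exp (- real m / 64) < 1" by (simp add: exp_add[symmetric])
  qed
  finally have "(\<Sum>G\<in>\<Omega>. \<Psi> G) < (\<Sum>G\<in>\<Omega>. 1)" by simp
  then obtain G where G: "G \<in> \<Omega>" "\<Psi> G < 1"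
    using sum_mono[of \<Omega> "\<lambda>_. 1" \<Psi>] by (meson not_le)
  show ?thesis
  proof (rule bexI[of _ G], intro ballI)
    fix v assume v: "v \<in> P"
    show "real m / 4 * (\<Sum>k\<in>S. (v k)\<^sup>2) \<le> (\<Sum>r<m. (\<Sum>k\<in>S. G r k * v k)\<^sup>2) \<and>
        (\<Sum>r<m. (\<Sum>k\<in>S. G r k * v k)\<^sup>2) \<le> 4 * real m * (\<Sum>k\<in>S. (v k)\<^sup>2)"
    proof (cases "0 < V v")
      case True
      then have "v \<in> Q" using v by (simp add: Q_def)
      then have "exp (- (1/16) / V v * Z G v) * exp (real m / 64) + exp (1/8 / V v * Z G v) * exp (- real m / 2) \<le> \<Psi> G"
        unfolding \<Psi>_def by (intro member_le_sum fQ) auto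
      then have "exp (- (1/16) / V v * Z G v + real m / 64) + exp (1/8 / V v * Z G v - real m / 2) \<le> \<Psi> G"
        by (simp only: exp_add[symmetric] diff_conv_add_uminus minus_divide_left)
      with G(2) have "exp (- (1/16) / V v * Z G v + real m / 64) < exp 0" "exp (1/8 / V v * Z G v - real m / 2) < exp 0"
        using exp_gt_zero[of "- (1/16) / V v * Z G v + real m / 64"] exp_gt_zero[of "1/8 / V v * Z G v - real m / 2"]
        unfolding exp_zero by linarith+
      then have "- (1/16) / V v * Z G v + real m / 64 < 0" "1/8 / V v * Z G v - real m / 2 < 0"
        by (simp_all only: exp_less_cancel_iff)
      then have "real m / 4 * V v \<le> Z G v \<and> Z G v \<le> 4 * real m * V v"
        using True by (auto simp: field_simps)
      then show ?thesis unfolding V_def Z_def .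
    next
      case False
      then have "(\<Sum>k\<in>S. (v k)\<^sup>2) = 0" unfolding V_def by (simp add: order.antisym sum_nonneg not_less)
      then have "\<forall>k\<in>S. v k = 0" using assms(1) by (simp add: sum_nonneg_eq_0_iff)
      then show ?thesis by simp
    qed
  qed (use G in \<open>simp add: \<Omega>_def\<close>)
qed

text \<open>Maurey's empirical method: averaged over a random atom \<open>\<sigma> * z i\<close> with mean
  \<open>a\<close>, the square of \<open>e + a - \<sigma> * z i\<close> grows by at most \<open>R\<close>.\<close>

lemma maurey_step:
  fixes z :: "'x \<Rightarrow> 't \<Rightarrow> real" and w :: "'x \<Rightarrow> real"
  assumes "finite T" "finite X" "X \<noteq> {}" "(\<Sum>i\<in>X. \<bar>w i\<bar>) \<le> 1"
    and R: "\<And>i. i \<in> X \<Longrightarrow> (\<Sum>t\<in>T. (z i t)\<^sup>2) \<le> R"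
    and a: "\<And>t. t \<in> T \<Longrightarrow> a t = (\<Sum>i\<in>X. w i * z i t)"
  shows "\<exists>\<sigma>\<in>{-1, 0, 1}. \<exists>i\<in>X. (\<Sum>t\<in>T. (e t + a t - \<sigma> * z i t)\<^sup>2) \<le> (\<Sum>t\<in>T. (e t)\<^sup>2) + R"
proof (rule ccontr)
  assume neg: "\<not> ?thesis"
  define \<Psi> where "\<Psi> = (\<lambda>\<sigma> i. \<Sum>t\<in>T. (e t + a t - \<sigma> * z i t)\<^sup>2)"
  define B where "B = (\<Sum>t\<in>T. (e t)\<^sup>2) + R"
  have big: "B < \<Psi> \<sigma> i" if "\<sigma> \<in> {-1, 0, 1}" "i \<in> X" for \<sigma> i
    using neg that unfolding \<Psi>_def B_def by (meson not_le)
  obtain i0 where i0: "i0 \<in> X" using assms(3) by blast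
  have R0: "0 \<le> R" using R[OF i0] by (meson sum_nonneg zero_le_power2 order_trans)
  have sg: "sgn y \<in> {-1, 0, 1}" for y :: real by (auto simp: sgn_if)
  \<comment> \<open>This is the expectation for the random atom that equals
    \<open>sgn (w i) * z i\<close> with probability \<open>\<bar>w i\<bar>\<close> and vanishes
    otherwise. The atom has mean \<open>a\<close>, so the cross term with \<open>e\<close> cancels
    and only its variance is added.\<close>
  have "(\<Sum>i\<in>X. \<bar>w i\<bar> * \<Psi> (sgn (w i)) i) + (1 - (\<Sum>i\<in>X. \<bar>w i\<bar>)) * \<Psi> 0 i0
      = (\<Sum>t\<in>T. (\<Sum>i\<in>X. \<bar>w i\<bar> * (e t + a t - sgn (w i) * z i t)\<^sup>2) + (1 - (\<Sum>i\<in>X. \<bar>w i\<bar>)) * (e t + a t)\<^sup>2)"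
    unfolding \<Psi>_def sum_distrib_left sum.distrib by (subst sum.swap) simp
  also have "\<dots> = (\<Sum>t\<in>T. (e t)\<^sup>2 - (a t)\<^sup>2 + (\<Sum>i\<in>X. \<bar>w i\<bar> * (z i t)\<^sup>2))"
  proof (intro sum.cong refl)
    fix t assume t: "t \<in> T"
    have expand: "\<bar>w i\<bar> * (e t + a t - sgn (w i) * z i t)\<^sup>2
        = \<bar>w i\<bar> * (e t + a t)\<^sup>2 - 2 * (e t + a t) * (w i * z i t) + \<bar>w i\<bar> * (z i t)\<^sup>2" for i
      by (cases "w i = 0") (auto simp: sgn_if abs_if power2_eq_square algebra_simps)
    have "(\<Sum>i\<in>X. \<bar>w i\<bar> * (e t + a t - sgn (w i) * z i t)\<^sup>2)
        = (\<Sum>i\<in>X. \<bar>w i\<bar>) * (e t + a t)\<^sup>2 - 2 * (e t + a t) * a t + (\<Sum>i\<in>X. \<bar>w i\<bar> * (z i t)\<^sup>2)"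
      unfolding expand sum.distrib sum_subtractf sum_distrib_left[symmetric] sum_distrib_right[symmetric]
      by (simp only: a[OF t])
    then show "(\<Sum>i\<in>X. \<bar>w i\<bar> * (e t + a t - sgn (w i) * z i t)\<^sup>2) + (1 - (\<Sum>i\<in>X. \<bar>w i\<bar>)) * (e t + a t)\<^sup>2
        = (e t)\<^sup>2 - (a t)\<^sup>2 + (\<Sum>i\<in>X. \<bar>w i\<bar> * (z i t)\<^sup>2)"
      by (simp add: algebra_simps power2_eq_square)
  qed
  also have "\<dots> \<le> (\<Sum>t\<in>T. (e t)\<^sup>2 + (\<Sum>i\<in>X. \<bar>w i\<bar> * (z i t)\<^sup>2))"
    by (intro sum_mono) auto
  also have "\<dots> = (\<Sum>t\<in>T. (e t)\<^sup>2) + (\<Sum>i\<in>X. \<bar>w i\<bar> * (\<Sum>t\<in>T. (z i t)\<^sup>2))"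
    unfolding sum.distrib sum_distrib_left by (subst sum.swap) simp
  also have "\<dots> \<le> (\<Sum>t\<in>T. (e t)\<^sup>2) + (\<Sum>i\<in>X. \<bar>w i\<bar> * R)"
    by (intro add_left_mono sum_mono mult_left_mono R) auto
  also have "\<dots> \<le> B"
    using mult_right_mono[OF assms(4) R0] by (simp add: B_def sum_distrib_right)
  finally have le: "(\<Sum>i\<in>X. \<bar>w i\<bar> * \<Psi> (sgn (w i)) i) + (1 - (\<Sum>i\<in>X. \<bar>w i\<bar>)) * \<Psi> 0 i0 \<le> B" .
  \<comment> \<open>Some weights may be 0, so the strict inequalities cannot be averaged term by
    term. The least of the finitely many outcomes is still above \<open>B\<close> and bounds the
    average from below.\<close>
  define b where "b = Min (insert (\<Psi> 0 i0) ((\<lambda>i. \<Psi> (sgn (w i)) i) ` X))"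
  have "b \<in> insert (\<Psi> 0 i0) ((\<lambda>i. \<Psi> (sgn (w i)) i) ` X)"
    unfolding b_def using assms by (intro Min_in) auto
  then have "B < b" using big sg i0 by auto
  have b0: "b \<le> \<Psi> 0 i0" and bi: "\<And>i. i \<in> X \<Longrightarrow> b \<le> \<Psi> (sgn (w i)) i"
    unfolding b_def using assms(2) by (auto simp del: Min_insert intro!: Min_le)
  have "b = (\<Sum>i\<in>X. \<bar>w i\<bar> * b) + (1 - (\<Sum>i\<in>X. \<bar>w i\<bar>)) * b"
    by (simp add: algebra_simps sum_distrib_left)
  also have "\<dots> \<le> (\<Sum>i\<in>X. \<bar>w i\<bar> * \<Psi> (sgn (w i)) i) + (1 - (\<Sum>i\<in>X. \<bar>w i\<bar>)) * \<Psi> 0 i0"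
    using assms(4) by (intro add_mono sum_mono mult_left_mono b0 bi) auto
  finally show False using le \<open>B < b\<close> by linarith
qed

text \<open>Each step adds at most \<open>R\<close> to the squared error of the unnormalized sum, so
  the average of \<open>n\<close> signed atoms has squared error at most \<open>R / n\<close>. What
  matters for the union bound is that there are only \<open>(3 * card X) ^ n\<close> choices of
  \<open>q\<close>.\<close>

lemma maurey:
  fixes z :: "'x \<Rightarrow> 't \<Rightarrow> real" and w :: "'x \<Rightarrow> real"
  assumes "finite T" "finite X" "X \<noteq> {}" "(\<Sum>i\<in>X. \<bar>w i\<bar>) \<le> 1"
    and R: "\<And>i. i \<in> X \<Longrightarrow> (\<Sum>t\<in>T. (z i t)\<^sup>2) \<le> R"
  shows "\<exists>q\<in>PiE {..<n} (\<lambda>_. {-1, 0, 1} \<times> X).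
    (\<Sum>t\<in>T. (real n * (\<Sum>i\<in>X. w i * z i t) - (\<Sum>l<n. fst (q l) * z (snd (q l)) t))\<^sup>2) \<le> real n * R"
proof (induction n)
  case 0
  show ?case by auto
next
  case (Suc n)
  then obtain q where q: "q \<in> PiE {..<n} (\<lambda>_. {-1, 0, 1} \<times> X)"
    and le: "(\<Sum>t\<in>T. (real n * (\<Sum>i\<in>X. w i * z i t) - (\<Sum>l<n. fst (q l) * z (snd (q l)) t))\<^sup>2) \<le> real n * R"
    by blast
  have "\<exists>\<sigma>\<in>{-1, 0, 1}. \<exists>i\<in>X. (\<Sum>t\<in>T. (real n * (\<Sum>i\<in>X. w i * z i t) - (\<Sum>l<n. fst (q l) * z (snd (q l)) t)
        + (\<Sum>i\<in>X. w i * z i t) - \<sigma> * z i t)\<^sup>2)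
      \<le> (\<Sum>t\<in>T. (real n * (\<Sum>i\<in>X. w i * z i t) - (\<Sum>l<n. fst (q l) * z (snd (q l)) t))\<^sup>2) + R"
    by (rule maurey_step[OF assms refl])
  then obtain \<sigma> i where si: "\<sigma> \<in> {-1, 0, 1}" "i \<in> X" and
    le2: "(\<Sum>t\<in>T. (real n * (\<Sum>i\<in>X. w i * z i t) - (\<Sum>l<n. fst (q l) * z (snd (q l)) t)
        + (\<Sum>i\<in>X. w i * z i t) - \<sigma> * z i t)\<^sup>2)
      \<le> (\<Sum>t\<in>T. (real n * (\<Sum>i\<in>X. w i * z i t) - (\<Sum>l<n. fst (q l) * z (snd (q l)) t))\<^sup>2) + R"
    by (elim bexE) (rule that)
  have "q(n := (\<sigma>, i)) \<in> PiE {..<Suc n} (\<lambda>_. {-1, 0, 1} \<times> X)"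
    using q si by (fastforce simp: PiE_iff less_Suc_eq extensional_def)
  moreover have "(\<Sum>l<Suc n. fst ((q(n := (\<sigma>, i))) l) * z (snd ((q(n := (\<sigma>, i))) l)) t)
      = (\<Sum>l<n. fst (q l) * z (snd (q l)) t) + \<sigma> * z i t" for t
    by simp
  then have "(\<Sum>t\<in>T. (real (Suc n) * (\<Sum>i\<in>X. w i * z i t)
        - (\<Sum>l<Suc n. fst ((q(n := (\<sigma>, i))) l) * z (snd ((q(n := (\<sigma>, i))) l)) t))\<^sup>2)
      \<le> real n * R + R"
    using le le2 by (simp add: algebra_simps)
  ultimately show ?case by (intro bexI[of _ "q(n := (\<sigma>, i))"]) (simp_all add: algebra_simps)
qed


section \<open>Gelfand widths of symmetric convex hulls\<close>

text \<open>Counts the vectors on which the random matrix is tested: \<open>M\<close> generators and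
  at most \<open>(3 * M) ^ n\<close> sums of atoms. Doubled by the union bound they are at most
  \<open>(6 * M) ^ n + (2 * M) ^ n\<close>, whence the 8.\<close>

lemma ln_atoms_bound:
  assumes "0 < M" "0 < n" "real n * ln (8 * real M) < real m / 64"
  shows "2 * (3 * real M) ^ n + 2 * real M < exp (real m / 64)"
proof -
  obtain n' where n': "n = Suc n'" using assms(2) by (cases n) auto
  have "2 * (3 * real M) ^ n \<le> (6 * real M) ^ n"
  proof -
    have "2 ^ 1 * (3 * real M) ^ n \<le> 2 ^ n * (3 * real M) ^ n"
      using assms(2) by (intro mult_right_mono power_increasing) auto
    also have "\<dots> = (6 * real M) ^ n"
      unfolding power_mult_distrib[symmetric] by simp
    finally show ?thesis by simp
  qed
  moreover have "2 * real M \<le> (2 * real M) ^ n"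
    using assms(1,2) by (intro self_le_power) auto
  moreover have "(6 * real M) ^ n + (2 * real M) ^ n \<le> (8 * real M) ^ n"
  proof -
    have "(6 * real M) * (6 * real M) ^ n' \<le> (6 * real M) * (8 * real M) ^ n'"
      "(2 * real M) * (2 * real M) ^ n' \<le> (2 * real M) * (8 * real M) ^ n'"
      by (intro mult_left_mono power_mono; simp)+
    then show ?thesis by (simp add: n')
  qed
  moreover have "(8 * real M) ^ n < exp (real m / 64)"
  proof -
    have "(8 * real M) ^ n = exp (real n * ln (8 * real M))"
      using assms(1) by (simp add: exp_of_nat_mult)
    then show ?thesis using assms(3) by simp
  qed
  ultimately show ?thesis by linarith
qed

text \<open>A point \<open>a\<close> of the hull in the kernel of \<open>G\<close> is close to
  \<open>b / n\<close> for a sum \<open>b\<close> of \<open>n\<close> atoms, and \<open>G\<close>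
  almost annihilates \<open>b\<close>. The lower isometry bound, valid for \<open>b\<close>, then
  makes \<open>b\<close> short, and \<open>a\<close> with it.\<close>

lemma gelfand_width_convex_hull:
  fixes x :: "'x \<Rightarrow> 'k \<Rightarrow> real"
  assumes "finite S" "finite X" "X \<noteq> {}" "0 < n" "real n * ln (8 * real (card X)) < real m / 64"
    and K: "\<And>i. i \<in> X \<Longrightarrow> (\<Sum>k\<in>S. (x i k)\<^sup>2) \<le> K"
  shows "\<exists>G :: nat \<Rightarrow> 'k \<Rightarrow> real. \<forall>w. (\<Sum>i\<in>X. \<bar>w i\<bar>) \<le> 1 \<longrightarrow>
    (\<forall>r<m. (\<Sum>i\<in>X. w i * (\<Sum>k\<in>S. G r k * x i k)) = 0) \<longrightarrow>
    (\<Sum>k\<in>S. (\<Sum>i\<in>X. w i * x i k)\<^sup>2) \<le> 50 * K / real n"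
proof -
  define Q where "Q = PiE {..<n} (\<lambda>_. {-1, 0, 1 :: real} \<times> X)"
  define atom where "atom = (\<lambda>(q :: nat \<Rightarrow> real \<times> 'x) k. \<Sum>l<n. fst (q l) * x (snd (q l)) k)"
  \<comment> \<open>The upper isometry bound is used on the generators, the lower one on the sums of
    atoms.\<close>
  define P where "P = x ` X \<union> atom ` Q"
  have M: "0 < card X" using assms by (simp add: card_gt_0_iff)
  have m: "0 < m"
    using assms(4,5) M by (intro Nat.gr0I) (auto simp: mult_less_0_iff)
  have fQ: "finite Q" unfolding Q_def using assms by (intro finite_PiE) auto
  have cQ: "card Q = (3 * card X) ^ n"
  proof -
    have "card ({-1, 0, 1 :: real} \<times> X) = 3 * card X" by (simp add: card_cartesian_product)
    then show ?thesis unfolding Q_def by (simp add: card_PiE)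
  qed
  have fP: "finite P" unfolding P_def using assms fQ by auto
  have "card P \<le> card X + (3 * card X) ^ n"
    unfolding P_def cQ[symmetric]
    using card_Un_le[of "x ` X" "atom ` Q"] card_image_le[OF assms(2), of x] card_image_le[OF fQ, of atom]
    by linarith
  then have "real (card P) \<le> real (card X + (3 * card X) ^ n)"
    by (rule of_nat_mono)
  then have "real (card P) \<le> real (card X) + (3 * real (card X)) ^ n" by simp
  then have "2 * real (card P) < exp (real m / 64)"
    using ln_atoms_bound[OF M assms(4,5)] by linarith
  from exists_near_isometric_sign_matrix[OF assms(1) fP this]
  obtain G :: "nat \<Rightarrow> 'k \<Rightarrow> real" where
    lo: "\<And>v. v \<in> P \<Longrightarrow> real m / 4 * (\<Sum>k\<in>S. (v k)\<^sup>2) \<le> (\<Sum>r<m. (\<Sum>k\<in>S. G r k * v k)\<^sup>2)" and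
    hi: "\<And>v. v \<in> P \<Longrightarrow> (\<Sum>r<m. (\<Sum>k\<in>S. G r k * v k)\<^sup>2) \<le> 4 * real m * (\<Sum>k\<in>S. (v k)\<^sup>2)"
    by blast
  show ?thesis
  proof (intro exI[of _ G] allI impI)
    fix w :: "'x \<Rightarrow> real"
    assume w1: "(\<Sum>i\<in>X. \<bar>w i\<bar>) \<le> 1"
      and ker: "\<forall>r<m. (\<Sum>i\<in>X. w i * (\<Sum>k\<in>S. G r k * x i k)) = 0"
    \<comment> \<open>Maurey's method is applied to the graph of \<open>G / sqrt m\<close>, so that the sparse approximant is
      close to the given point and at the same time almost in the kernel.\<close>
    define z where "z = (\<lambda>i. case_sum (\<lambda>k. x i k) (\<lambda>r. (\<Sum>k\<in>S. G r k * x i k) / sqrt (real m)))"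
    define T where "T = S <+> {..<m}"
    have sumT: "(\<Sum>t\<in>T. f t) = (\<Sum>k\<in>S. f (Inl k)) + (\<Sum>r<m. f (Inr r))" for f :: "'k + nat \<Rightarrow> real"
      unfolding T_def using assms(1) by (simp add: sum.Plus)
    have fT: "finite T" unfolding T_def using assms(1) by auto
    \<comment> \<open>\<open>K\<close> for the vector itself and \<open>4 * K\<close> for its image
      under \<open>G / sqrt m\<close>.\<close>
    have R: "(\<Sum>t\<in>T. (z i t)\<^sup>2) \<le> 5 * K" if "i \<in> X" for i
    proof -
      have "(\<Sum>r<m. (\<Sum>k\<in>S. G r k * x i k)\<^sup>2) / real m \<le> 4 * (\<Sum>k\<in>S. (x i k)\<^sup>2)"
        using hi[of "x i"] that m by (simp add: P_def field_simps)
      then show ?thesis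
        using K[OF that] by (simp add: sumT z_def power_divide sum_divide_distrib[symmetric])
    qed
    have "\<exists>q\<in>Q. (\<Sum>t\<in>T. (real n * (\<Sum>i\<in>X. w i * z i t) - (\<Sum>l<n. fst (q l) * z (snd (q l)) t))\<^sup>2) \<le> real n * (5 * K)"
      unfolding Q_def by (rule maurey[OF fT assms(2,3) w1 R])
    then obtain q where q: "q \<in> Q" and
      le: "(\<Sum>t\<in>T. (real n * (\<Sum>i\<in>X. w i * z i t) - (\<Sum>l<n. fst (q l) * z (snd (q l)) t))\<^sup>2) \<le> real n * (5 * K)"
      by blast
    define a where "a = (\<lambda>k. \<Sum>i\<in>X. w i * x i k)"
    define b where "b = atom q"
    have zker: "(\<Sum>i\<in>X. w i * z i (Inr r)) = 0" if "r < m" for r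
      using ker that by (simp add: z_def sum_divide_distrib[symmetric])
    have zb: "(\<Sum>l<n. fst (q l) * z (snd (q l)) (Inr r)) = (\<Sum>k\<in>S. G r k * b k) / sqrt (real m)" for r
      unfolding z_def b_def atom_def
      by (simp add: sum_divide_distrib[symmetric] sum_distrib_left, subst sum.swap, simp add: mult_ac)
    have le': "(\<Sum>k\<in>S. (real n * a k - b k)\<^sup>2) + (\<Sum>r<m. (\<Sum>k\<in>S. G r k * b k)\<^sup>2) / real m \<le> real n * (5 * K)"
    proof -
      have "(\<Sum>r<m. (real n * (\<Sum>i\<in>X. w i * z i (Inr r)) - (\<Sum>l<n. fst (q l) * z (snd (q l)) (Inr r)))\<^sup>2)
          = (\<Sum>r<m. (\<Sum>k\<in>S. G r k * b k)\<^sup>2) / real m"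
        unfolding zb sum_divide_distrib[of _ "{..<m}"] by (intro sum.cong refl) (simp add: zker power_divide)
      then show ?thesis
        using le unfolding sumT by (simp add: z_def a_def b_def atom_def)
    qed
    have "b \<in> P" using q by (auto simp: P_def b_def)
    from lo[OF this] m have "(\<Sum>k\<in>S. (b k)\<^sup>2) \<le> 4 * ((\<Sum>r<m. (\<Sum>k\<in>S. G r k * b k)\<^sup>2) / real m)"
      by (simp add: field_simps)
    then have "(\<Sum>k\<in>S. (real n * a k - b k)\<^sup>2) + (\<Sum>k\<in>S. (b k)\<^sup>2)
        \<le> 4 * ((\<Sum>k\<in>S. (real n * a k - b k)\<^sup>2) + (\<Sum>r<m. (\<Sum>k\<in>S. G r k * b k)\<^sup>2) / real m)"
      using sum_nonneg[of S "\<lambda>k. (real n * a k - b k)\<^sup>2"] by (simp add: distrib_left)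
    from order_trans[OF this mult_left_mono[OF le', of 4]]
    have sq: "(\<Sum>k\<in>S. (real n * a k - b k)\<^sup>2) + (\<Sum>k\<in>S. (b k)\<^sup>2) \<le> 4 * (real n * (5 * K))" by simp
    have "(real n)\<^sup>2 * (\<Sum>k\<in>S. (a k)\<^sup>2) = (\<Sum>k\<in>S. (real n * a k)\<^sup>2)"
      by (simp add: power_mult_distrib sum_distrib_left)
    also have "\<dots> \<le> (\<Sum>k\<in>S. 2 * (real n * a k - b k)\<^sup>2 + 2 * (b k)\<^sup>2)"
    proof (intro sum_mono)
      fix k
      have "0 \<le> (real n * a k - 2 * b k)\<^sup>2" by simp
      then show "(real n * a k)\<^sup>2 \<le> 2 * (real n * a k - b k)\<^sup>2 + 2 * (b k)\<^sup>2"
        by (simp add: power2_eq_square algebra_simps)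
    qed
    also have "\<dots> = 2 * ((\<Sum>k\<in>S. (real n * a k - b k)\<^sup>2) + (\<Sum>k\<in>S. (b k)\<^sup>2))"
      by (simp add: sum.distrib sum_distrib_left)
    also have "\<dots> \<le> 2 * (4 * (real n * (5 * K)))"
      by (intro mult_left_mono sq) auto
    also have "\<dots> = real n * (40 * K)" by simp
    finally have "real n * (real n * (\<Sum>k\<in>S. (a k)\<^sup>2)) \<le> real n * (40 * K)"
      by (simp add: power2_eq_square mult.assoc)
    then have "(\<Sum>k\<in>S. (a k)\<^sup>2) \<le> 40 * K / real n" using assms(4) by (simp add: field_simps)
    moreover have "0 \<le> K"
    proof -
      obtain i where "i \<in> X" using assms(3) by blast
      have "0 \<le> (\<Sum>k\<in>S. (x i k)\<^sup>2)" by (simp add: sum_nonneg)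
      then show ?thesis using K[OF \<open>i \<in> X\<close>] by linarith
    qed
    ultimately show "(\<Sum>k\<in>S. (\<Sum>i\<in>X. w i * x i k)\<^sup>2) \<le> 50 * K / real n"
      using divide_right_mono[of "40 * K" "50 * K" "real n"] by (simp add: a_def)
  qed
qed

section \<open>Duality for uniform approximation on a finite set\<close>

text \<open>The graph of a linear functional on a space of functions that is dominated by the
  maximum norm over \<open>X\<close>.\<close>

definition dominated_graph :: "'x set \<Rightarrow> (('x \<Rightarrow> real) \<times> real) set \<Rightarrow> bool" where
  "dominated_graph X W \<longleftrightarrow> W \<noteq> {} \<and> (\<forall>(h, v)\<in>W. v \<le> Max ((\<lambda>x. \<bar>h x\<bar>) ` X)) \<and>
    (\<forall>(h, v)\<in>W. \<forall>(h', v')\<in>W. \<forall>c. (\<lambda>x. h x + c * h' x, v + c * v') \<in> W)"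

lemma dominated_graph_zero:
  assumes "dominated_graph X W"
  shows "(\<lambda>x. 0, 0) \<in> W"
proof -
  from assms obtain h v where "(h, v) \<in> W" unfolding dominated_graph_def by auto
  then have "(\<lambda>x. h x + (-1) * h x, v + (-1) * v) \<in> W"
    using assms unfolding dominated_graph_def by fast
  then show ?thesis by simp
qed

lemma dominated_graph_add:
  assumes "dominated_graph X W" "(h, v) \<in> W" "(h', v') \<in> W"
  shows "(\<lambda>x. h x + c * h' x, v + c * v') \<in> W"
  using assms unfolding dominated_graph_def by fast

lemma dominated_graph_le:
  assumes "dominated_graph X W" "(h, v) \<in> W"
  shows "v \<le> Max ((\<lambda>x. \<bar>h x\<bar>) ` X)"
  using assms unfolding dominated_graph_def by fast

lemma dominated_graph_sum:
  assumes "dominated_graph X W" "finite A" "\<And>i. i \<in> A \<Longrightarrow> (h i, v i) \<in> W"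
  shows "(\<lambda>x. \<Sum>i\<in>A. c i * h i x, \<Sum>i\<in>A. c i * v i) \<in> W"
  using assms(2,3)
proof (induction A rule: finite_induct)
  case empty
  then show ?case using dominated_graph_zero[OF assms(1)] by simp
next
  case (insert i A)
  have "(\<lambda>x. (\<Sum>i\<in>A. c i * h i x) + c i * h i x, (\<Sum>i\<in>A. c i * v i) + c i * v i) \<in> W"
    using insert by (intro dominated_graph_add[OF assms(1)]) auto
  then show ?case using insert.hyps by (simp add: add.commute)
qed

text \<open>The one-dimensional step of the Hahn-Banach theorem. A value \<open>\<alpha>\<close> for
  \<open>g\<close> is admissible if it lies between all \<open>v - p (h - g)\<close> and all
  \<open>p (h + g) - v\<close>; the triangle inequality puts the former below the latter, and the
  supremum of the former is taken.\<close>

lemma dominated_graph_extend: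
  assumes fin: "finite X" "X \<noteq> {}" and W: "dominated_graph X W"
  shows "\<exists>W' \<alpha>. dominated_graph X W' \<and> W \<subseteq> W' \<and> (g, \<alpha>) \<in> W'"
proof -
  define p where "p = (\<lambda>h :: 'a \<Rightarrow> real. Max ((\<lambda>x. \<bar>h x\<bar>) ` X))"
  have p_le: "p h \<le> c \<longleftrightarrow> (\<forall>x\<in>X. \<bar>h x\<bar> \<le> c)" for h c
    unfolding p_def using fin by simp
  have p_ge: "\<bar>h x\<bar> \<le> p h" if "x \<in> X" for h x
    using that p_le[of h "p h"] by simp
  have p_add: "p (\<lambda>x. h x + h' x) \<le> p h + p h'" for h h'
    unfolding p_le using p_ge by (meson abs_triangle_ineq add_mono order_trans)
  have p_scale: "p (\<lambda>x. c * h x) \<le> c * p h" if "0 \<le> c" for c h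
    unfolding p_le using p_ge that by (simp add: abs_mult mult_left_mono)
  have W_le: "v \<le> p h" if "(h, v) \<in> W" for h v
    using dominated_graph_le[OF W that] by (simp add: p_def)
  define A where "A = (\<lambda>(h, v). v - p (\<lambda>x. h x - g x)) ` W"
  have key: "v - p (\<lambda>x. h x - g x) \<le> p (\<lambda>x. h' x + g x) - v'" if "(h, v) \<in> W" "(h', v') \<in> W" for h v h' v'
  proof -
    have "(\<lambda>x. h x + 1 * h' x, v + 1 * v') \<in> W" by (rule dominated_graph_add[OF W that])
    then have "v + v' \<le> p (\<lambda>x. h x + h' x)" using W_le by fastforce
    also have "\<dots> = p (\<lambda>x. (h x - g x) + (h' x + g x))" by simp
    also have "\<dots> \<le> p (\<lambda>x. h x - g x) + p (\<lambda>x. h' x + g x)" by (rule p_add)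
    finally show ?thesis by linarith
  qed
  have A0: "A \<noteq> {}" using dominated_graph_zero[OF W] unfolding A_def by blast
  have ub: "a \<le> p (\<lambda>x. h' x + g x) - v'" if "a \<in> A" "(h', v') \<in> W" for a h' v'
    using that key unfolding A_def by fastforce
  have bdd: "bdd_above A"
    using ub[OF _ dominated_graph_zero[OF W]] by (meson bdd_above.I)
  define \<alpha> where "\<alpha> = Sup A"
  have lo: "v - p (\<lambda>x. h x - g x) \<le> \<alpha>" if "(h, v) \<in> W" for h v
    unfolding \<alpha>_def using that by (intro cSup_upper bdd) (force simp: A_def)
  have hi: "\<alpha> \<le> p (\<lambda>x. h x + g x) - v" if "(h, v) \<in> W" for h v
    unfolding \<alpha>_def by (intro cSup_least A0 ub that)
  have scale: "(\<lambda>x. c * h x, c * v) \<in> W" if "(h, v) \<in> W" for c h v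
    using dominated_graph_add[OF W dominated_graph_zero[OF W] that, of c] by simp
  define W' where "W' = {(h', v'). \<exists>h v t. (h, v) \<in> W \<and> h' = (\<lambda>x. h x + t * g x) \<and> v' = v + t * \<alpha>}"
  have "v + t * \<alpha> \<le> p (\<lambda>x. h x + t * g x)" if hv: "(h, v) \<in> W" for h v t
  proof (cases t "0 :: real" rule: linorder_cases)
    case less
    define s where "s = - t"
    have s: "0 < s" using less by (simp add: s_def)
    have "(1/s) * v - \<alpha> \<le> p (\<lambda>x. (1/s) * h x - g x)"
      using lo[OF scale[OF hv, of "1/s"]] by linarith
    also have "\<dots> = p (\<lambda>x. (1/s) * (h x + t * g x))"
      by (rule arg_cong[where f = p]) (use s in \<open>simp add: fun_eq_iff s_def field_simps\<close>)
    also have "\<dots> \<le> (1/s) * p (\<lambda>x. h x + t * g x)" using s by (intro p_scale) auto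
    finally have "s * ((1/s) * v - \<alpha>) \<le> s * ((1/s) * p (\<lambda>x. h x + t * g x))"
      using s by (intro mult_left_mono) auto
    then have "v - s * \<alpha> \<le> p (\<lambda>x. h x + t * g x)" using s by (simp add: right_diff_distrib)
    then show ?thesis by (simp add: s_def)
  next
    case equal
    then show ?thesis using W_le[OF hv] by simp
  next
    case greater
    have "(1/t) * v + \<alpha> \<le> p (\<lambda>x. (1/t) * h x + g x)"
      using hi[OF scale[OF hv, of "1/t"]] by linarith
    also have "\<dots> = p (\<lambda>x. (1/t) * (h x + t * g x))"
      by (rule arg_cong[where f = p]) (use greater in \<open>simp add: fun_eq_iff field_simps\<close>)
    also have "\<dots> \<le> (1/t) * p (\<lambda>x. h x + t * g x)" using greater by (intro p_scale) auto
    finally have "t * ((1/t) * v + \<alpha>) \<le> t * ((1/t) * p (\<lambda>x. h x + t * g x))"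
      using greater by (intro mult_left_mono) auto
    then show ?thesis using greater by (simp add: distrib_left)
  qed
  then have dom: "\<forall>(h, v)\<in>W'. v \<le> p h" unfolding W'_def by auto
  have lin: "(\<lambda>x. h x + c * h' x, v + c * v') \<in> W'" if "(h, v) \<in> W'" "(h', v') \<in> W'" for h v h' v' c
  proof -
    from that obtain h1 v1 t1 h2 v2 t2 where
      1: "(h1, v1) \<in> W" "h = (\<lambda>x. h1 x + t1 * g x)" "v = v1 + t1 * \<alpha>" and
      2: "(h2, v2) \<in> W" "h' = (\<lambda>x. h2 x + t2 * g x)" "v' = v2 + t2 * \<alpha>"
      unfolding W'_def by auto
    have "(\<lambda>x. h1 x + c * h2 x, v1 + c * v2) \<in> W" by (rule dominated_graph_add[OF W 1(1) 2(1)])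
    then show ?thesis
      unfolding W'_def mem_Collect_eq prod.case 1 2
      by (intro exI[of _ "\<lambda>x. h1 x + c * h2 x"] exI[of _ "v1 + c * v2"] exI[of _ "t1 + c * t2"])
        (auto simp: algebra_simps)
  qed
  have sub: "W \<subseteq> W'"
  proof (rule subrelI)
    fix h v assume "(h, v) \<in> W"
    then show "(h, v) \<in> W'"
      unfolding W'_def mem_Collect_eq prod.case
      by (intro exI[of _ h] exI[of _ v] exI[of _ 0]) simp
  qed
  have "(g, \<alpha>) \<in> W'"
    unfolding W'_def mem_Collect_eq prod.case
    by (intro exI[of _ "\<lambda>x. 0"] exI[of _ 0] exI[of _ 1]) (simp add: dominated_graph_zero[OF W])
  moreover have "dominated_graph X W'"
    unfolding dominated_graph_def
  proof (intro conjI)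
    show "W' \<noteq> {}" using sub dominated_graph_zero[OF W] by blast
    show "\<forall>(h, v)\<in>W'. v \<le> Max ((\<lambda>x. \<bar>h x\<bar>) ` X)" using dom by (simp add: p_def)
    show "\<forall>(h, v)\<in>W'. \<forall>(h', v')\<in>W'. \<forall>c. (\<lambda>x. h x + c * h' x, v + c * v') \<in> W'"
      using lin by blast
  qed
  ultimately show ?thesis using sub by blast
qed

text \<open>On the span of \<open>f\<close> and the \<open>u r\<close>, the functional that is
  \<open>\<epsilon>\<close> at \<open>f\<close> and 0 at each \<open>u r\<close> is dominated by the
  maximum norm, precisely because \<open>f\<close> has distance at least \<open>\<epsilon>\<close>.
  It is extended to the indicators of the points of \<open>X\<close>, one by one, and its values
  there are \<open>\<mu>\<close>.\<close>

lemma uniform_distance_duality: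
  fixes u :: "nat \<Rightarrow> 'x \<Rightarrow> real"
  assumes fin: "finite X" "X \<noteq> {}"
    and far: "\<And>y. \<exists>x\<in>X. \<epsilon> \<le> \<bar>f x - (\<Sum>r<m. y r * u r x)\<bar>" and "0 < \<epsilon>"
  shows "\<exists>\<mu>. (\<Sum>x\<in>X. \<bar>\<mu> x\<bar>) \<le> 1 \<and> (\<forall>r<m. (\<Sum>x\<in>X. \<mu> x * u r x) = 0) \<and> (\<Sum>x\<in>X. \<mu> x * f x) = \<epsilon>"
proof -
  define W0 where "W0 = {(h, v). \<exists>t y. h = (\<lambda>x. t * f x + (\<Sum>r<m. y r * u r x)) \<and> v = t * \<epsilon>}"
  have in_W0: "(\<lambda>x. t * f x + (\<Sum>r<m. y r * u r x), t * \<epsilon>) \<in> W0" for t y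
    unfolding W0_def by blast
  have dom0: "t * \<epsilon> \<le> Max ((\<lambda>x. \<bar>t * f x + (\<Sum>r<m. y r * u r x)\<bar>) ` X)" for t y
  proof (cases "t = 0")
    case True
    obtain x where "x \<in> X" using fin by blast
    then have "\<bar>t * f x + (\<Sum>r<m. y r * u r x)\<bar> \<le> Max ((\<lambda>x. \<bar>t * f x + (\<Sum>r<m. y r * u r x)\<bar>) ` X)"
      using fin by (intro Max_ge) auto
    then show ?thesis using True by simp
  next
    case False
    obtain x where x: "x \<in> X" "\<epsilon> \<le> \<bar>f x - (\<Sum>r<m. (- y r / t) * u r x)\<bar>"
      using far[of "\<lambda>r. - y r / t"] by blast
    have "t * f x + (\<Sum>r<m. y r * u r x) = t * (f x - (\<Sum>r<m. (- y r / t) * u r x))"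
      using False by (simp add: distrib_left sum_distrib_left sum_negf)
    then have "\<bar>t * f x + (\<Sum>r<m. y r * u r x)\<bar> = \<bar>t\<bar> * \<bar>f x - (\<Sum>r<m. (- y r / t) * u r x)\<bar>"
      by (simp add: abs_mult)
    moreover have "\<bar>t\<bar> * \<epsilon> \<le> \<bar>t\<bar> * \<bar>f x - (\<Sum>r<m. (- y r / t) * u r x)\<bar>"
      using x by (intro mult_left_mono) auto
    moreover have "t * \<epsilon> \<le> \<bar>t\<bar> * \<epsilon>" using \<open>0 < \<epsilon>\<close> by (intro mult_right_mono) auto
    moreover have "\<bar>t * f x + (\<Sum>r<m. y r * u r x)\<bar> \<le> Max ((\<lambda>x. \<bar>t * f x + (\<Sum>r<m. y r * u r x)\<bar>) ` X)"
      using fin x by (intro Max_ge) auto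
    ultimately show ?thesis by linarith
  qed
  have W0: "dominated_graph X W0"
    unfolding dominated_graph_def
  proof (intro conjI)
    show "W0 \<noteq> {}" using in_W0 by blast
    show "\<forall>(h, v)\<in>W0. v \<le> Max ((\<lambda>x. \<bar>h x\<bar>) ` X)" using dom0 unfolding W0_def by auto
    have "(\<lambda>x. h x + c * h' x, v + c * v') \<in> W0" if "(h, v) \<in> W0" "(h', v') \<in> W0" for h v h' v' c
    proof -
      from that obtain t y t' y' where
        1: "h = (\<lambda>x. t * f x + (\<Sum>r<m. y r * u r x))" "v = t * \<epsilon>" and
        2: "h' = (\<lambda>x. t' * f x + (\<Sum>r<m. y' r * u r x))" "v' = t' * \<epsilon>"
        unfolding W0_def by auto
      have "(\<lambda>x. h x + c * h' x, v + c * v')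
          = (\<lambda>x. (t + c * t') * f x + (\<Sum>r<m. (y r + c * y' r) * u r x), (t + c * t') * \<epsilon>)"
        unfolding 1 2 by (auto simp: fun_eq_iff algebra_simps sum.distrib sum_distrib_left)
      then show ?thesis using in_W0[of "t + c * t'" "\<lambda>r. y r + c * y' r"] by simp
    qed
    then show "\<forall>(h, v)\<in>W0. \<forall>(h', v')\<in>W0. \<forall>c. (\<lambda>x. h x + c * h' x, v + c * v') \<in> W0" by blast
  qed
  define \<delta> where "\<delta> = (\<lambda>(a :: 'x) x. if x = a then 1 else 0 :: real)"
  have "\<exists>W. dominated_graph X W \<and> W0 \<subseteq> W \<and> (\<forall>a\<in>A. \<exists>v. (\<delta> a, v) \<in> W)" if "finite A" for A :: "'x set"
    using that
  proof (induction A rule: finite_induct)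
    case empty
    then show ?case using W0 by blast
  next
    case (insert a A)
    then obtain W where W: "dominated_graph X W" "W0 \<subseteq> W" "\<forall>a\<in>A. \<exists>v. (\<delta> a, v) \<in> W" by blast
    from dominated_graph_extend[OF fin W(1), of "\<delta> a"] obtain W' v where
      "dominated_graph X W'" "W \<subseteq> W'" "(\<delta> a, v) \<in> W'" by blast
    then show ?case using W by (intro exI[of _ W']) blast
  qed
  from this[OF fin(1)] obtain W where W: "dominated_graph X W" "W0 \<subseteq> W"
    and "\<forall>a\<in>X. \<exists>v. (\<delta> a, v) \<in> W" by blast
  then obtain \<mu> where \<mu>: "\<And>a. a \<in> X \<Longrightarrow> (\<delta> a, \<mu> a) \<in> W" by metis
  have expand: "(\<Sum>a\<in>X. c a * \<delta> a x) = c x" if "x \<in> X" for c x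
    using that fin(1) by (simp add: \<delta>_def if_distrib sum.delta' cong: if_cong)
  \<comment> \<open>The functions in \<open>W\<close> live on the whole type, but domination sees
    only \<open>X\<close>: if two of them agree on \<open>X\<close>, both differences of their
    values are at most 0, so the values coincide.\<close>
  have rep: "(\<Sum>x\<in>X. \<mu> x * h x) = v" if hv: "(h, v) \<in> W" for h v
  proof -
    have in_W: "(\<lambda>x. \<Sum>a\<in>X. h a * \<delta> a x, \<Sum>a\<in>X. h a * \<mu> a) \<in> W"
      by (intro dominated_graph_sum[OF W(1) fin(1)] \<mu>)
    have Max0: "Max ((\<lambda>x. \<bar>k x\<bar>) ` X) = 0" if "\<And>x. x \<in> X \<Longrightarrow> k x = 0" for k :: "'x \<Rightarrow> real"
    proof -
      have "(\<lambda>x. \<bar>k x\<bar>) ` X = {0}" using that fin(2) by force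
      then show ?thesis by simp
    qed
    have "v + (-1) * (\<Sum>a\<in>X. h a * \<mu> a) \<le> 0"
      using dominated_graph_le[OF W(1) dominated_graph_add[OF W(1) hv in_W, of "-1"]]
      by (subst (asm) Max0) (simp_all add: expand)
    moreover have "(\<Sum>a\<in>X. h a * \<mu> a) + (-1) * v \<le> 0"
      using dominated_graph_le[OF W(1) dominated_graph_add[OF W(1) in_W hv, of "-1"]]
      by (subst (asm) Max0) (simp_all add: expand)
    ultimately show ?thesis by (simp add: mult.commute)
  qed
  show ?thesis
  proof (intro exI[of _ \<mu>] conjI allI impI)
    \<comment> \<open>The sign of \<open>\<mu>\<close> as test function has maximum norm at most 1,
      and its value is the sum of the \<open>\<bar>\<mu> x\<bar>\<close>.\<close>
    have "(\<lambda>x. \<Sum>a\<in>X. sgn (\<mu> a) * \<delta> a x, \<Sum>a\<in>X. sgn (\<mu> a) * \<mu> a) \<in> W"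
      by (intro dominated_graph_sum[OF W(1) fin(1)] \<mu>)
    from dominated_graph_le[OF W(1) this]
    have "(\<Sum>a\<in>X. sgn (\<mu> a) * \<mu> a) \<le> Max ((\<lambda>x. \<bar>\<Sum>a\<in>X. sgn (\<mu> a) * \<delta> a x\<bar>) ` X)" .
    also have "\<dots> \<le> 1"
      using fin by (auto simp: expand sgn_if)
    finally show "(\<Sum>x\<in>X. \<bar>\<mu> x\<bar>) \<le> 1" by (simp add: sgn_mult_self_eq abs_sgn mult.commute)
  next
    fix r assume r: "r < m"
    have "(\<lambda>x. 0 * f x + (\<Sum>r'<m. (if r' = r then 1 else 0) * u r' x), 0 * \<epsilon>) \<in> W"
      by (rule subsetD[OF W(2) in_W0])
    moreover have "(\<lambda>x. 0 * f x + (\<Sum>r'<m. (if r' = r then 1 else 0) * u r' x)) = u r"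
      using r by (simp add: fun_eq_iff if_distrib[of "\<lambda>a. a * _"] cong: if_cong)
    ultimately show "(\<Sum>x\<in>X. \<mu> x * u r x) = 0" using rep[of "u r" 0] by simp
  next
    have "(\<lambda>x. 1 * f x + (\<Sum>r'<m. 0 * u r' x), 1 * \<epsilon>) \<in> W"
      by (rule subsetD[OF W(2) in_W0])
    then show "(\<Sum>x\<in>X. \<mu> x * f x) = \<epsilon>" using rep[of f \<epsilon>] by simp
  qed
qed

section \<open>Kolmogorov widths of ellipsoids in the maximum norm\<close>

text \<open>If some point of the ellipsoid were far from the span, duality would give weights
  \<open>\<mu>\<close> whose combination of the vectors \<open>\<phi> k x\<close> lies in the kernel
  of \<open>G\<close>. That combination is short by the Gelfand bound, and the Cauchy-Schwarz
  inequality contradicts the distance. The functions depend on neither \<open>b\<close> nor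
  \<open>\<beta>\<close>.\<close>

lemma kolmogorov_width_ellipsoid:
  fixes \<phi> :: "'k \<Rightarrow> 'x \<Rightarrow> real"
  assumes fin: "finite S" "finite X" "X \<noteq> {}" and m: "0 < m" and K0: "0 < K"
    and K: "\<And>x. x \<in> X \<Longrightarrow> (\<Sum>k\<in>S. (\<phi> k x)\<^sup>2) \<le> K"
  shows "\<exists>u :: nat \<Rightarrow> 'k \<Rightarrow> real. \<forall>b \<beta>. 0 < \<beta> \<longrightarrow> (\<Sum>k\<in>S. (b k)\<^sup>2) \<le> \<beta> \<longrightarrow>
    (\<exists>y. \<forall>x\<in>X. \<bar>(\<Sum>k\<in>S. b k * \<phi> k x) - (\<Sum>r<m. y r * (\<Sum>k\<in>S. u r k * \<phi> k x))\<bar>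
      \<le> sqrt (7000 * \<beta> * K * ln (8 * real (card X)) / real m))"
proof -
  define M where "M = card X"
  define L where "L = ln (8 * real M)"
  have M: "1 \<le> M" using fin unfolding M_def by (simp add: Suc_le_eq card_gt_0_iff)
  have L: "0 < L" unfolding L_def using M by (simp add: ln_gt_zero_iff)
  show ?thesis
  \<comment> \<open>Below this size no \<open>n >= 1\<close> is allowed, but the factor
    \<open>7000 * L / m\<close> exceeds 1 and approximation by 0 is enough.\<close>
  proof (cases "real m < 65 * L")
    case True
    show ?thesis
    proof (intro exI[of _ "\<lambda>_ _. 0"] allI impI exI[of _ "\<lambda>_. 0"] ballI)
      fix b :: "'k \<Rightarrow> real" and \<beta> :: real and x assume \<beta>: "0 < \<beta>" "(\<Sum>k\<in>S. (b k)\<^sup>2) \<le> \<beta>" and x: "x \<in> X"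
      have "(\<Sum>k\<in>S. b k * \<phi> k x)\<^sup>2 \<le> (\<Sum>k\<in>S. (b k)\<^sup>2) * (\<Sum>k\<in>S. (\<phi> k x)\<^sup>2)"
        by (rule Cauchy_Schwarz_ineq_sum)
      also have "\<dots> \<le> \<beta> * K"
        using \<beta> K[OF x] by (intro mult_mono) (auto simp: sum_nonneg)
      also have "\<dots> \<le> \<beta> * K * (7000 * L / real m)"
      proof -
        have "1 \<le> 7000 * L / real m" using True m L by (simp add: field_simps)
        moreover have "0 < \<beta> * K" using \<beta> K0 by simp
        ultimately show ?thesis using mult_left_mono[of 1 "7000 * L / real m" "\<beta> * K"] by simp
      qed
      finally show "\<bar>(\<Sum>k\<in>S. b k * \<phi> k x) - (\<Sum>r<m. 0 * (\<Sum>k\<in>S. 0 * \<phi> k x))\<bar>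
          \<le> sqrt (7000 * \<beta> * K * ln (8 * real (card X)) / real m)"
        by (intro real_le_rsqrt) (simp add: L_def M_def mult_ac)
    qed
  next
    case False
    \<comment> \<open>65 instead of 64 makes \<open>n * L < m / 64\<close> strict; rounding down
      loses at most a factor 2, which gives the 130 below.\<close>
    define n where "n = nat \<lfloor>real m / (65 * L)\<rfloor>"
    have ge1: "1 \<le> real m / (65 * L)" using False L by (simp add: field_simps)
    then have n1: "1 \<le> n" unfolding n_def by (simp add: le_nat_iff le_floor_iff)
    have n_le: "real n \<le> real m / (65 * L)" using ge1 unfolding n_def by simp
    have "real m / (65 * L) \<le> real n + 1" unfolding n_def using ge1 by linarith
    also have "\<dots> \<le> 2 * real n" using n1 by simp
    finally have n_ge: "real m / (130 * L) \<le> real n" using L by (simp add: field_simps)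
    have "real n * L < real m / 64"
    proof -
      have "real n * L \<le> real m / 65" using n_le L by (simp add: field_simps)
      also have "\<dots> < real m / 64" using m by simp
      finally show ?thesis .
    qed
    then have "\<exists>G :: nat \<Rightarrow> 'k \<Rightarrow> real. \<forall>w. (\<Sum>x\<in>X. \<bar>w x\<bar>) \<le> 1 \<longrightarrow>
        (\<forall>r<m. (\<Sum>x\<in>X. w x * (\<Sum>k\<in>S. G r k * \<phi> k x)) = 0) \<longrightarrow>
        (\<Sum>k\<in>S. (\<Sum>x\<in>X. w x * \<phi> k x)\<^sup>2) \<le> 50 * K / real n"
      using gelfand_width_convex_hull[of S X n m "\<lambda>x k. \<phi> k x" K] fin n1 K by (simp add: L_def M_def)
    then obtain G :: "nat \<Rightarrow> 'k \<Rightarrow> real" where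
      G: "\<And>w. \<lbrakk>(\<Sum>x\<in>X. \<bar>w x\<bar>) \<le> 1; \<forall>r<m. (\<Sum>x\<in>X. w x * (\<Sum>k\<in>S. G r k * \<phi> k x)) = 0\<rbrakk> \<Longrightarrow>
        (\<Sum>k\<in>S. (\<Sum>x\<in>X. w x * \<phi> k x)\<^sup>2) \<le> 50 * K / real n" by blast
    show ?thesis
    proof (intro exI[of _ G] allI impI, rule ccontr)
      fix b :: "'k \<Rightarrow> real" and \<beta> :: real assume \<beta>: "0 < \<beta>" "(\<Sum>k\<in>S. (b k)\<^sup>2) \<le> \<beta>"
      define \<epsilon> where "\<epsilon> = sqrt (7000 * \<beta> * K * ln (8 * real (card X)) / real m)"
      assume "\<not> (\<exists>y. \<forall>x\<in>X. \<bar>(\<Sum>k\<in>S. b k * \<phi> k x) - (\<Sum>r<m. y r * (\<Sum>k\<in>S. G r k * \<phi> k x))\<bar>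
        \<le> sqrt (7000 * \<beta> * K * ln (8 * real (card X)) / real m))"
      then have far: "\<exists>x\<in>X. \<epsilon> \<le> \<bar>(\<Sum>k\<in>S. b k * \<phi> k x) - (\<Sum>r<m. y r * (\<Sum>k\<in>S. G r k * \<phi> k x))\<bar>" for y
        unfolding \<epsilon>_def by (meson less_le_not_le linorder_linear)
      have arg: "0 < 7000 * \<beta> * K * L / real m" using \<beta> K0 L m by simp
      then have \<epsilon>0: "0 < \<epsilon>" unfolding \<epsilon>_def L_def M_def by simp
      have \<epsilon>2: "\<epsilon>\<^sup>2 = 7000 * \<beta> * K * L / real m"
        unfolding \<epsilon>_def using arg by (simp add: L_def M_def)
      from uniform_distance_duality[OF fin(2,3) far \<epsilon>0] obtain \<mu> where
        \<mu>: "(\<Sum>x\<in>X. \<bar>\<mu> x\<bar>) \<le> 1" "\<forall>r<m. (\<Sum>x\<in>X. \<mu> x * (\<Sum>k\<in>S. G r k * \<phi> k x)) = 0"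
          "(\<Sum>x\<in>X. \<mu> x * (\<Sum>k\<in>S. b k * \<phi> k x)) = \<epsilon>" by blast
      have "\<epsilon> = (\<Sum>k\<in>S. b k * (\<Sum>x\<in>X. \<mu> x * \<phi> k x))"
        unfolding \<mu>(3)[symmetric] sum_distrib_left by (subst sum.swap) (simp add: mult_ac)
      then have "\<epsilon>\<^sup>2 \<le> (\<Sum>k\<in>S. (b k)\<^sup>2) * (\<Sum>k\<in>S. (\<Sum>x\<in>X. \<mu> x * \<phi> k x)\<^sup>2)"
        using Cauchy_Schwarz_ineq_sum by simp
      also have "\<dots> \<le> \<beta> * (50 * K / real n)"
        using \<beta> G[OF \<mu>(1,2)] by (intro mult_mono) (auto simp: sum_nonneg)
      also have "\<dots> \<le> \<beta> * (50 * K / (real m / (130 * L)))"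
        using n_ge n1 \<beta> K0 L m by (intro mult_left_mono divide_left_mono) auto
      \<comment> \<open>\<open>50 * 130 = 6500\<close>; the constant 7000 is larger, so that the
        contradiction is strict.\<close>
      also have "\<dots> = (13 / 14) * \<epsilon>\<^sup>2" unfolding \<epsilon>2 by simp
      also have "\<dots> < \<epsilon>\<^sup>2" using \<epsilon>0 by simp
      finally show False by simp
    qed
  qed
qed

section \<open>Haar functions\<close>

text \<open>\<open>frac\<close> builds in the period, so the Haar functions are defined and periodic
  on the whole line; rounding down gives half-open intervals without exceptional points.\<close>

definition dyadic_pos :: "nat \<Rightarrow> real \<Rightarrow> nat" where
  "dyadic_pos n t = nat \<lfloor>2 ^ n * frac (t / (2 * pi))\<rfloor>"

text \<open>Level \<open>0\<close> is the constant function, and level \<open>Suc a\<close> consists of the \<open>2 ^ a\<close> Haar functions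
  of the dyadic intervals of length \<open>2 * pi / 2 ^ a\<close>, normalized in the maximum norm.\<close>

definition haar1 :: "nat \<Rightarrow> nat \<Rightarrow> real \<Rightarrow> real" where
  "haar1 a k t = (if a = 0 then of_bool (k = 0)
     else of_bool (dyadic_pos (a - 1) t = k) * (-1) ^ dyadic_pos a t)"

lemma dyadic_pos_div2: "dyadic_pos (Suc n) t div 2 = dyadic_pos n t"
proof -
  define y where "y = 2 ^ Suc n * frac (t / (2 * pi))"
  have y: "0 \<le> y" unfolding y_def by (simp add: frac_ge_0)
  have "\<lfloor>y / real_of_int 2\<rfloor> = \<lfloor>y\<rfloor> div 2" by (rule floor_divide_real_eq_div) simp
  then have "nat \<lfloor>y / 2\<rfloor> = nat \<lfloor>y\<rfloor> div 2" using y by (simp add: nat_div_distrib)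
  then show ?thesis unfolding dyadic_pos_def y_def by simp
qed

lemma dyadic_pos_less: "dyadic_pos n t < 2 ^ n"
proof -
  have "2 ^ n * frac (t / (2 * pi)) < 2 ^ n * 1"
    by (intro mult_strict_left_mono frac_lt_1) simp
  then have "\<lfloor>2 ^ n * frac (t / (2 * pi))\<rfloor> < 2 ^ n"
    by (simp add: floor_less_iff)
  then show ?thesis unfolding dyadic_pos_def
    by (simp add: nat_less_iff frac_ge_0)
qed

lemma dyadic_pos_eq_iff:
  assumes "0 \<le> t" "t < 2 * pi"
  shows "dyadic_pos n t = k \<longleftrightarrow> 2 * pi * real k / 2 ^ n \<le> t \<and> t < 2 * pi * (real k + 1) / 2 ^ n"
proof -
  have "frac (t / (2 * pi)) = t / (2 * pi)"
    using assms by (subst frac_eq) auto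
  then have "dyadic_pos n t = k \<longleftrightarrow> \<lfloor>2 ^ n * (t / (2 * pi))\<rfloor> = int k"
    unfolding dyadic_pos_def using assms by (auto simp: nat_eq_iff)
  also have "\<dots> \<longleftrightarrow> real k \<le> 2 ^ n * (t / (2 * pi)) \<and> 2 ^ n * (t / (2 * pi)) < real k + 1"
    by (simp add: floor_eq_iff)
  finally show ?thesis by (simp add: field_simps)
qed

lemma dyadic_pos_periodic: "dyadic_pos n (t + 2 * pi) = dyadic_pos n t"
proof -
  have "(t + 2 * pi) / (2 * pi) = t / (2 * pi) + 1" by (simp add: field_simps)
  then show ?thesis unfolding dyadic_pos_def by (simp add: frac_1_eq)
qed

lemma haar1_periodic: "haar1 a k (t + 2 * pi) = haar1 a k t"
  unfolding haar1_def by (simp add: dyadic_pos_periodic)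

lemma dyadic_pos_measurable [measurable]: "dyadic_pos n \<in> borel \<rightarrow>\<^sub>M count_space UNIV"
  unfolding dyadic_pos_def frac_def by measurable

lemma haar1_measurable [measurable]: "haar1 a k \<in> borel_measurable borel"
  unfolding haar1_def by measurable

lemma haar1_abs_le: "\<bar>haar1 a k t\<bar> \<le> 1"
  unfolding haar1_def by auto

text \<open>Truncated subtraction makes \<open>2 ^ (a - 1)\<close> equal to 1 at
  \<open>a = 0\<close> as well, the correct count for the constant function.\<close>

abbreviation haar1_index :: "nat \<Rightarrow> nat set" where
  "haar1_index a \<equiv> {..<2 ^ (a - 1)}"

lemma sum_haar1_abs: "(\<Sum>k\<in>haar1_index a. \<bar>haar1 a k t\<bar>) = 1"
proof (cases a)
  case 0
  then show ?thesis by (simp add: haar1_def lessThan_Suc)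
next
  case (Suc b)
  have "(\<Sum>k\<in>haar1_index a. \<bar>haar1 a k t\<bar>) = (\<Sum>k\<in>haar1_index a. if k = dyadic_pos b t then 1 else 0)"
    using Suc by (intro sum.cong) (auto simp: haar1_def abs_mult power_abs)
  then show ?thesis using Suc dyadic_pos_less[of b t] by simp
qed

text \<open>The sum is the kernel of the conditional expectation onto the dyadic intervals of
  level \<open>n\<close>: the Haar functions of level \<open>Suc n\<close> double it on the common half and cancel
  it elsewhere.\<close>

lemma haar1_kernel:
  "(\<Sum>a\<le>n. 2 ^ (a - 1) * (\<Sum>k\<in>haar1_index a. haar1 a k t * haar1 a k u))
    = 2 ^ n * of_bool (dyadic_pos n t = dyadic_pos n u)"
proof (induction n)
  case 0
  have "dyadic_pos 0 t = 0" "dyadic_pos 0 u = 0" using dyadic_pos_less[of 0] by simp_all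
  then show ?case by (simp add: haar1_def lessThan_Suc)
next
  case (Suc n)
  let ?a = "dyadic_pos (Suc n) t" and ?b = "dyadic_pos (Suc n) u"
  have "(\<Sum>k\<in>haar1_index (Suc n). haar1 (Suc n) k t * haar1 (Suc n) k u)
      = (\<Sum>k\<in>haar1_index (Suc n). if k = ?a div 2 then of_bool (?a div 2 = ?b div 2) * ((-1) ^ ?a * (-1) ^ ?b) else 0)"
    by (intro sum.cong) (auto simp: haar1_def dyadic_pos_div2)
  also have "\<dots> = of_bool (?a div 2 = ?b div 2) * ((-1) ^ ?a * (-1) ^ ?b)"
    using dyadic_pos_less[of n t] by (simp add: dyadic_pos_div2)
  finally have level: "(\<Sum>k\<in>haar1_index (Suc n). haar1 (Suc n) k t * haar1 (Suc n) k u)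
      = of_bool (?a div 2 = ?b div 2) * ((-1) ^ ?a * (-1) ^ ?b)" .
  have parity: "of_bool (a div 2 = b div 2) * (1 + (-1) ^ a * (-1) ^ b) = 2 * (of_bool (a = b) :: real)" for a b :: nat
  proof (cases "even a = even b")
    case True
    then have "(-1) ^ a * (-1) ^ b = (1 :: real)" by (auto simp: minus_one_power_iff)
    moreover have "a div 2 = b div 2 \<longleftrightarrow> a = b" using True by presburger
    ultimately show ?thesis by simp
  next
    case False
    then show ?thesis by (auto simp: minus_one_power_iff)
  qed
  have "(\<Sum>a\<le>Suc n. 2 ^ (a - 1) * (\<Sum>k\<in>haar1_index a. haar1 a k t * haar1 a k u))
      = 2 ^ n * (of_bool (?a div 2 = ?b div 2) * (1 + (-1) ^ ?a * (-1) ^ ?b))"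
    by (simp only: sum.atMost_Suc Suc.IH level[unfolded dyadic_pos_div2 diff_Suc_1] dyadic_pos_div2 diff_Suc_1
        distrib_left mult_1_right)
  also have "\<dots> = 2 ^ Suc n * of_bool (?a = ?b)" unfolding parity by simp
  finally show ?case .
qed

text \<open>A Haar function is 1 on the left half of its interval, where
  \<open>dyadic_pos a t\<close> is even, and -1 on the right half, which is the left half moved by
  \<open>h\<close>. Differences of the function thus appear once this translation is passed on in an
  integral. For \<open>a = 0\<close> the interval is the whole period.\<close>

lemma haar1_eq_difference:
  assumes "k < 2 ^ (a - 1)" and h: "h = 2 * pi / 2 ^ a" and l: "l = 2 * pi * (2 * real k) / 2 ^ a"
  shows "indicator {0..<2 * pi} t * haar1 a k t
    = (if a = 0 then indicator {l..<l + h} t else indicator {l..<l + h} t - indicator {l..<l + h} (t - h))"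
proof (cases a)
  case 0
  then show ?thesis using assms by (simp add: haar1_def)
next
  case (Suc b)
  have k1: "real k + 1 \<le> 2 ^ b"
  proof -
    have "k + 1 \<le> 2 ^ b" using assms(1) Suc by simp
    then have "real (k + 1) \<le> real (2 ^ b)" by (rule of_nat_mono)
    then show ?thesis by simp
  qed
  have h0: "0 < h" unfolding h by simp
  have "l + 2 * h = 2 * pi * ((real k + 1) / 2 ^ b)" unfolding h l Suc by (simp add: field_simps)
  also have "\<dots> \<le> 2 * pi * 1" using k1 by (intro mult_left_mono) auto
  finally have top: "l + 2 * h \<le> 2 * pi" by simp
  have l0: "0 \<le> l" unfolding l by simp
  show ?thesis
  proof (cases "0 \<le> t \<and> t < 2 * pi")
    case False
    then show ?thesis using Suc l0 top h0 by (auto simp: indicator_def)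
  next
    case True
    have lo: "dyadic_pos a t = 2 * k \<longleftrightarrow> l \<le> t \<and> t < l + h"
      using True by (subst dyadic_pos_eq_iff) (auto simp: h l add_divide_distrib distrib_left)
    have hi: "dyadic_pos a t = 2 * k + 1 \<longleftrightarrow> l + h \<le> t \<and> t < l + 2 * h"
      using True by (subst dyadic_pos_eq_iff) (auto simp: h l add_divide_distrib distrib_left)
    have "dyadic_pos b t = k \<longleftrightarrow> dyadic_pos a t = 2 * k \<or> dyadic_pos a t = 2 * k + 1"
      unfolding dyadic_pos_div2[of b t, symmetric] Suc by presburger
    then show ?thesis
      using Suc True lo hi h0 by (auto simp: haar1_def indicator_def)
  qed
qed

section \<open>Haar coefficients as integrals of mixed differences\<close>

lemma measurable_lebesgue_translation [measurable]:
  "(\<lambda>x. x + c) \<in> lebesgue \<rightarrow>\<^sub>M (lebesgue :: 'a::euclidean_space measure)"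
proof (rule measurableI)
  fix A :: "'a set" assume A: "A \<in> sets lebesgue"
  have "(\<lambda>x. x + c) -` A = (\<lambda>x. - c + x) ` A"
    by (auto simp: image_iff algebra_simps)
  then show "(\<lambda>x. x + c) -` A \<inter> space lebesgue \<in> sets lebesgue"
    using lebesgue_sets_translation[OF A, of "- c"] by simp
qed simp

lemma distr_lebesgue_translation:
  "distr lebesgue lebesgue (\<lambda>x. x + c) = (lebesgue :: 'a::euclidean_space measure)"
proof (rule measure_eqI)
  fix A :: "'a set" assume "A \<in> sets (distr lebesgue lebesgue (\<lambda>x. x + c))"
  then have A: "A \<in> sets lebesgue" by simp
  have "(\<lambda>x. x + c) -` A = (\<lambda>x. 1 *\<^sub>R x + (- c)) ` A"
    by (auto simp: image_iff algebra_simps)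
  then show "emeasure (distr lebesgue lebesgue (\<lambda>x. x + c)) A = emeasure lebesgue A"
    using A emeasure_lebesgue_affine[of 1 "- c" A] by (subst emeasure_distr) auto
qed simp

lemma integrable_lebesgue_translation:
  fixes f :: "'a::euclidean_space \<Rightarrow> 'b::{banach, second_countable_topology}"
  assumes "integrable lebesgue f"
  shows "integrable lebesgue (\<lambda>x. f (x + c))"
  using assms integrable_distr_eq[OF measurable_lebesgue_translation, of f c]
  by (simp add: distr_lebesgue_translation borel_measurable_integrable)

lemma integral_lebesgue_translation:
  fixes f :: "'a::euclidean_space \<Rightarrow> 'b::{banach, second_countable_topology}"
  assumes "f \<in> borel_measurable lebesgue"
  shows "(\<integral>x. f (x + c) \<partial>lebesgue) = (\<integral>x. f x \<partial>lebesgue)"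
  using integral_distr[OF measurable_lebesgue_translation assms, of c]
  by (simp add: distr_lebesgue_translation)

lemma integrable_coord_diff:
  assumes "integrable lebesgue F"
  shows "integrable lebesgue (coord_diff j a F)"
  unfolding coord_diff_def using assms
  by (intro Bochner_Integration.integrable_diff integrable_lebesgue_translation)

lemma mixed_diff_coord_diff:
  fixes e :: "('d::finite) set"
  assumes "i \<notin> e"
  shows "mixed_diff 1 t e (coord_diff i (t $ i) f) = mixed_diff 1 t (insert i e) f"
proof -
  interpret comp_fun_commute "\<lambda>j. coord_diff j (t $ j) ^^ 1"
    by (rule comp_fun_commute_coord_diff)
  show ?thesis unfolding mixed_diff_def
    by (subst fold_insert2) (use assms in auto)
qed

lemma measurable_lebesgue_vec_nth:
  assumes "g \<in> borel_measurable borel"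
  shows "(\<lambda>x :: real ^ 'd. g (x $ j)) \<in> borel_measurable lebesgue"
proof (rule measurable_completion)
  have "(\<lambda>x :: real ^ 'd. x $ j) \<in> borel_measurable borel"
    by (intro borel_measurable_continuous_onI continuous_intros)
  then show "(\<lambda>x :: real ^ 'd. g (x $ j)) \<in> borel_measurable lborel"
    using assms by simp
qed

text \<open>Discrete integration by parts. In each variable of \<open>e\<close>, translation
  invariance moves the backward shift of the indicator to a forward shift of \<open>F\<close>, at
  the price of one sign.\<close>

lemma integral_shifted_differences:
  fixes F :: "real ^ 'd \<Rightarrow> complex" and h :: "real ^ 'd" and I :: "'d \<Rightarrow> real \<Rightarrow> real"
  assumes "integrable lebesgue F"
    and I: "\<And>j. I j \<in> borel_measurable borel" "\<And>j t. \<bar>I j t\<bar> \<le> 1"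
  shows "(\<integral>x. of_real (\<Prod>j\<in>UNIV. if j \<in> e then I j (x $ j) - I j (x $ j - h $ j) else I j (x $ j)) * F x \<partial>lebesgue)
    = (-1) ^ card e * (\<integral>x. of_real (\<Prod>j\<in>UNIV. I j (x $ j)) * mixed_diff 1 h e F x \<partial>lebesgue)"
proof -
  define W where "W = (\<lambda>e (x :: real ^ 'd). \<Prod>j\<in>UNIV. if j \<in> e then I j (x $ j) - I j (x $ j - h $ j) else I j (x $ j))"
  have W_meas: "W e \<in> borel_measurable lebesgue" for e
    unfolding W_def
  proof (intro borel_measurable_prod)
    fix j
    have "(\<lambda>t. if j \<in> e then I j t - I j (t - h $ j) else I j t) \<in> borel_measurable borel"
      using I(1)[of j] by measurable
    from measurable_lebesgue_vec_nth[OF this, of j]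
    show "(\<lambda>x. if j \<in> e then I j (x $ j) - I j (x $ j - h $ j) else I j (x $ j)) \<in> borel_measurable lebesgue"
      by simp
  qed
  have W_bound: "\<bar>W e x\<bar> \<le> 2 ^ CARD('d)" for e x
  proof -
    have "\<bar>W e x\<bar> \<le> (\<Prod>j\<in>(UNIV :: 'd set). 2)"
      unfolding W_def abs_prod
    proof (intro prod_mono conjI)
      fix j
      show "\<bar>if j \<in> e then I j (x $ j) - I j (x $ j - h $ j) else I j (x $ j)\<bar> \<le> 2"
        using I(2)[of j "x $ j"] I(2)[of j "x $ j - h $ j"] by auto
    qed simp
    then show ?thesis by simp
  qed
  have int: "integrable lebesgue (\<lambda>x. of_real (W e (x + c)) * G x)" if "integrable lebesgue G" for e c and G :: "real ^ 'd \<Rightarrow> complex"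
  proof (rule Bochner_Integration.integrable_bound)
    show "integrable lebesgue (\<lambda>x. 2 ^ CARD('d) * norm (G x))" using that by auto
    have "(\<lambda>x. W e (x + c)) \<in> borel_measurable lebesgue"
      using W_meas[of e] by measurable
    then show "(\<lambda>x. of_real (W e (x + c)) * G x) \<in> borel_measurable lebesgue"
      using borel_measurable_integrable[OF that] by measurable
    show "AE x in lebesgue. norm (of_real (W e (x + c)) * G x) \<le> norm (2 ^ CARD('d) * norm (G x))"
      using W_bound by (auto simp: norm_mult intro!: mult_right_mono)
  qed
  have int0: "integrable lebesgue (\<lambda>x. of_real (W e x) * G x)" if "integrable lebesgue G" for e and G :: "real ^ 'd \<Rightarrow> complex"
    using int[OF that, of e 0] by simp
  have "finite e" by simp
  then have "(\<integral>x. of_real (W e x) * F x \<partial>lebesgue)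
      = (-1) ^ card e * (\<integral>x. of_real (W {} x) * mixed_diff 1 h e F x \<partial>lebesgue)"
    using assms(1)
  proof (induction e arbitrary: F rule: finite_induct)
    case empty
    then show ?case by simp
  next
    case (insert i e)
    let ?c = "axis i (h $ i) :: real ^ 'd"
    have step: "W (insert i e) x = W e x - W e (x + (- ?c))" for x
    proof -
      define A where "A = (\<lambda>x :: real ^ 'd. \<Prod>j\<in>UNIV - {i}. if j \<in> e then I j (x $ j) - I j (x $ j - h $ j) else I j (x $ j))"
      have A: "A (x + (- ?c)) = A x"
        unfolding A_def by (intro prod.cong) (auto simp: axis_def)
      have W_e: "W e x = I i (x $ i) * A x" for x
        unfolding W_def A_def using insert.hyps by (subst prod.remove[of _ i]) auto
      have "W (insert i e) x = (I i (x $ i) - I i (x $ i - h $ i)) * A x"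
        unfolding W_def A_def by (subst prod.remove[of _ i]) (auto intro!: prod.cong)
      then show ?thesis unfolding W_e A by (simp add: axis_def left_diff_distrib)
    qed
    have "(\<integral>x. of_real (W (insert i e) x) * F x \<partial>lebesgue)
        = (\<integral>x. of_real (W e x) * F x - of_real (W e (x + (- ?c))) * F x \<partial>lebesgue)"
      unfolding step by (simp add: left_diff_distrib)
    also have "\<dots> = (\<integral>x. of_real (W e x) * F x \<partial>lebesgue) - (\<integral>x. of_real (W e (x + (- ?c))) * F x \<partial>lebesgue)"
      by (intro Bochner_Integration.integral_diff int int0 insert.prems)
    also have "(\<integral>x. of_real (W e (x + (- ?c))) * F x \<partial>lebesgue) = (\<integral>x. of_real (W e x) * F (x + ?c) \<partial>lebesgue)"
      using integral_lebesgue_translation[OF borel_measurable_integrable[OF int[OF insert.prems, of e "- ?c"]], of ?c]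
      by simp
    also have "(\<integral>x. of_real (W e x) * F x \<partial>lebesgue) - (\<integral>x. of_real (W e x) * F (x + ?c) \<partial>lebesgue)
        = (\<integral>x. of_real (W e x) * F x - of_real (W e x) * F (x + ?c) \<partial>lebesgue)"
      by (intro Bochner_Integration.integral_diff[symmetric] int0 insert.prems integrable_lebesgue_translation)
    also have "\<dots> = (\<integral>x. - (of_real (W e x) * coord_diff i (h $ i) F x) \<partial>lebesgue)"
      by (simp add: coord_diff_def right_diff_distrib)
    also have "\<dots> = - (\<integral>x. of_real (W e x) * coord_diff i (h $ i) F x \<partial>lebesgue)"
      by (rule integral_minus)
    also have "\<dots> = - ((-1) ^ card e * (\<integral>x. of_real (W {} x) * mixed_diff 1 h e (coord_diff i (h $ i) F) x \<partial>lebesgue))"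
      by (subst insert.IH[OF integrable_coord_diff[OF insert.prems]]) simp
    finally show ?case
      unfolding mixed_diff_coord_diff[OF insert.hyps(2)] using insert.hyps by simp
  qed
  then show ?thesis unfolding W_def by simp
qed

text \<open>A mixed first difference reads the function only at the corners of a box. This allows
  passing from \<open>f\<close> cut off outside the torus cube, which is integrable on the whole
  space, back to \<open>f\<close>.\<close>

lemma mixed_diff_cong:
  fixes e :: "('d::finite) set"
  assumes "\<And>e'. e' \<subseteq> e \<Longrightarrow> F (x + (\<Sum>j\<in>e'. axis j (t $ j))) = f (x + (\<Sum>j\<in>e'. axis j (t $ j)))"
  shows "mixed_diff 1 t e F x = mixed_diff 1 t e f x"
proof -
  have "finite e" by simp
  then show ?thesis using assms
  proof (induction e arbitrary: x rule: finite_induct)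
    case empty
    then show ?case by force
  next
    case (insert i e)
    have "mixed_diff 1 t e F x = mixed_diff 1 t e f x"
      by (rule insert.IH) (use insert.prems in blast)
    moreover have "mixed_diff 1 t e F (x + axis i (t $ i)) = mixed_diff 1 t e f (x + axis i (t $ i))"
    proof (rule insert.IH)
      fix e' assume e': "e' \<subseteq> e"
      then have "i \<notin> e'" "finite e'" using insert.hyps by auto
      then have eq: "x + axis i (t $ i) + (\<Sum>j\<in>e'. axis j (t $ j)) = x + (\<Sum>j\<in>insert i e'. axis j (t $ j))"
        by (simp add: add.assoc)
      then show "F (x + axis i (t $ i) + (\<Sum>j\<in>e'. axis j (t $ j))) = f (x + axis i (t $ i) + (\<Sum>j\<in>e'. axis j (t $ j)))"
        using insert.prems[of "insert i e'"] e' unfolding eq by blast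
    qed
    ultimately show ?case
      using insert.hyps by (simp add: mixed_diff_insert coord_diff_def)
  qed
qed

section \<open>Half-open boxes and the normalized measure of the torus\<close>

text \<open>Half-open, so that dyadic cells are disjoint and fill the cube exactly.
  \<open>torus_measure\<close> is built on the closed cube, and \<open>AE_torus_cube\<close> shows
  that the faces do not matter.\<close>

definition half_open_box :: "real ^ 'd \<Rightarrow> real ^ 'd \<Rightarrow> (real ^ 'd) set" where
  "half_open_box l u = {x. \<forall>j. l $ j \<le> x $ j \<and> x $ j < u $ j}"

abbreviation torus_cube :: "(real ^ 'd) set" where
  "torus_cube \<equiv> half_open_box 0 (\<chi> j. 2 * pi)"

lemma half_open_box_sets [measurable]: "half_open_box l u \<in> sets borel"
proof -
  have "half_open_box l u = (\<Inter>j. {x. l $ j \<le> x $ j} \<inter> {x. x $ j < u $ j})"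
    unfolding half_open_box_def by auto
  moreover have "{x. l $ j \<le> x $ j} \<inter> {x. x $ j < u $ j} \<in> sets borel" for j
    by (intro sets.Int borel_closed borel_open closed_halfspace_component_ge_cart open_halfspace_component_lt_cart)
  ultimately show ?thesis by auto
qed

lemma half_open_box_lebesgue [measurable]: "half_open_box l u \<in> sets lebesgue"
  using half_open_box_sets[of l u] by simp

lemma
  fixes l u :: "real ^ 'd"
  assumes "\<And>j. l $ j \<le> u $ j"
  shows emeasure_half_open_box: "emeasure lebesgue (half_open_box l u) = ennreal (\<Prod>j\<in>UNIV. u $ j - l $ j)"
    and measure_half_open_box: "measure lebesgue (half_open_box l u) = (\<Prod>j\<in>UNIV. u $ j - l $ j)"
proof -
  have ne: "cbox l u \<noteq> {}" using assms by (auto simp: interval_ne_empty_cart)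
  have c: "measure lborel (cbox l u) = (\<Prod>j\<in>UNIV. u $ j - l $ j)" by (rule content_cbox_cart[OF ne])
  have cb: "emeasure lborel (cbox l u) = ennreal (\<Prod>j\<in>UNIV. u $ j - l $ j)"
    unfolding c[symmetric] using emeasure_lborel_cbox_finite[of l u] by (intro emeasure_eq_ennreal_measure) auto
  have b: "emeasure lborel (box l u) = emeasure lborel (cbox l u)"
    unfolding emeasure_lborel_box_eq emeasure_lborel_cbox_eq by (rule refl)
  have "emeasure lborel (half_open_box l u) \<le> emeasure lborel (cbox l u)"
    by (intro emeasure_mono) (auto simp: half_open_box_def mem_box_cart less_imp_le)
  moreover have "emeasure lborel (box l u) \<le> emeasure lborel (half_open_box l u)"
    by (intro emeasure_mono) (auto simp: half_open_box_def mem_box_cart less_imp_le)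
  ultimately have "emeasure lborel (half_open_box l u) = ennreal (\<Prod>j\<in>UNIV. u $ j - l $ j)"
    unfolding b cb by simp
  then show e: "emeasure lebesgue (half_open_box l u) = ennreal (\<Prod>j\<in>UNIV. u $ j - l $ j)"
    by simp
  show "measure lebesgue (half_open_box l u) = (\<Prod>j\<in>UNIV. u $ j - l $ j)"
    unfolding measure_def e using assms by (simp add: prod_nonneg)
qed

lemma emeasure_torus_cube: "emeasure lebesgue (torus_cube :: (real ^ 'd) set) = ennreal ((2 * pi) ^ CARD('d))"
  by (subst emeasure_half_open_box) auto

lemma emeasure_cbox_torus: "emeasure lebesgue (cbox 0 (\<chi> j. 2 * pi) :: (real ^ 'd) set) = ennreal ((2 * pi) ^ CARD('d))"
proof -
  have ne: "cbox 0 (\<chi> j. 2 * pi) \<noteq> ({} :: (real ^ 'd) set)" by (auto simp: interval_ne_empty_cart)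
  have "emeasure lebesgue (cbox 0 (\<chi> j. 2 * pi) :: (real ^ 'd) set) = ennreal (measure lborel (cbox 0 (\<chi> j. 2 * pi) :: (real ^ 'd) set))"
    using emeasure_lborel_cbox_finite[of 0 "\<chi> j. 2 * pi :: real ^ 'd"]
    by (subst emeasure_eq_ennreal_measure[symmetric]) auto
  then show ?thesis unfolding content_cbox_cart[OF ne] by simp
qed

lemma prob_space_torus_measure: "prob_space (torus_measure :: (real ^ 'd) measure)"
  unfolding torus_measure_def
  by (rule prob_space_uniform_measure) (simp_all add: emeasure_cbox_torus ennreal_eq_0_iff not_le)

lemma AE_torus_cube: "AE x in lebesgue. x \<in> cbox 0 (\<chi> j. 2 * pi) \<longleftrightarrow> x \<in> (torus_cube :: (real ^ 'd) set)"
proof -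
  have "negligible (\<Union>j. {x :: real ^ 'd. x $ j = 2 * pi})"
  proof (intro negligible_Union)
    fix A assume "A \<in> range (\<lambda>j. {x :: real ^ 'd. x $ j = 2 * pi})"
    then obtain j where A: "A = {x :: real ^ 'd. x \<bullet> axis j 1 = 2 * pi}" by (auto simp: inner_axis)
    show "negligible A" unfolding A by (rule negligible_standard_hyperplane) (simp add: axis_in_Basis_iff)
  qed simp
  then have "(\<Union>j. {x :: real ^ 'd. x $ j = 2 * pi}) \<in> null_sets lebesgue"
    by (simp add: negligible_iff_null_sets)
  then show ?thesis
    by (rule AE_I') (auto simp: half_open_box_def mem_box_cart le_less)
qed

lemma AE_torus_measure_iff:
  "(AE x in torus_measure. P x) \<longleftrightarrow> (AE x :: real ^ 'd in lebesgue. x \<in> torus_cube \<longrightarrow> P x)"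
proof -
  have "(AE x in torus_measure. P x) \<longleftrightarrow> (AE x :: real ^ 'd in lebesgue. x \<in> cbox 0 (\<chi> j. 2 * pi) \<longrightarrow> P x)"
    unfolding torus_measure_def
    by (rule AE_uniform_measure) (simp_all add: emeasure_cbox_torus ennreal_eq_0_iff not_le)
  also have "\<dots> \<longleftrightarrow> (AE x :: real ^ 'd in lebesgue. x \<in> torus_cube \<longrightarrow> P x)"
    using AE_torus_cube by (intro eventually_subst) (auto elim: eventually_mono)
  finally show ?thesis .
qed

lemma nn_integral_torus_measure:
  assumes [measurable]: "g \<in> borel_measurable (lebesgue :: (real ^ 'd) measure)"
  shows "(\<integral>\<^sup>+ x. g x * indicator torus_cube x \<partial>lebesgue) = ennreal ((2 * pi) ^ CARD('d)) * (\<integral>\<^sup>+ x. g x \<partial>torus_measure)"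
proof -
  have "(\<integral>\<^sup>+ x. g x * indicator torus_cube x \<partial>lebesgue) = (\<integral>\<^sup>+ x. g x * indicator (cbox 0 (\<chi> j. 2 * pi)) x \<partial>lebesgue)"
    using AE_torus_cube by (intro nn_integral_cong_AE) (auto simp: indicator_def elim: eventually_mono)
  also have "\<dots> = ennreal ((2 * pi) ^ CARD('d)) * ((\<integral>\<^sup>+ x. g x * indicator (cbox 0 (\<chi> j. 2 * pi)) x \<partial>lebesgue) / ennreal ((2 * pi) ^ CARD('d)))"
    unfolding ennreal_times_divide mult.commute[of "ennreal _"]
    by (rule ennreal_mult_divide_eq[symmetric]) (simp_all add: ennreal_eq_0_iff not_le)
  also have "\<dots> = ennreal ((2 * pi) ^ CARD('d)) * (\<integral>\<^sup>+ x. g x \<partial>torus_measure)"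
    unfolding torus_measure_def by (subst nn_integral_uniform_measure) (auto simp: emeasure_cbox_torus)
  finally show ?thesis .
qed

lemma measurable_mixed_diff:
  fixes f :: "real ^ 'd \<Rightarrow> complex"
  assumes "f \<in> borel_measurable lebesgue"
  shows "mixed_diff 1 t e f \<in> borel_measurable lebesgue"
proof -
  have "finite e" by simp
  then show ?thesis
  proof (induction e rule: finite_induct)
    case (insert i e)
    define g where "g = mixed_diff 1 t e f"
    have [measurable]: "g \<in> borel_measurable lebesgue" using insert by (simp add: g_def)
    have "mixed_diff 1 t (insert i e) f = (\<lambda>x. g (x + axis i (t $ i)) - g x)"
      using insert.hyps by (simp add: mixed_diff_insert coord_diff_def g_def)
    then show ?case by simp
  qed (use assms in simp)
qed

text \<open>Makes the case \<open>p = \<infinity>\<close> one of finite exponents: as the measure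
  has total mass 1, a bound on the essential supremum bounds the mean of any power, and 3 is one
  choice above 2.\<close>

lemma Lp_norm_le_imp_nn_integral_le:
  fixes g :: "real ^ 'd \<Rightarrow> complex"
  assumes "2 < p" and q: "q = (if p = \<infinity> then 3 else enn2real p)"
    and le: "Lp_norm p g \<le> ennreal D" "0 \<le> D"
  shows "(\<integral>\<^sup>+ x. ennreal (cmod (g x) powr q) \<partial>torus_measure) \<le> ennreal (D powr q)"
proof (cases "p = \<infinity>")
  case True
  have "AE x in torus_measure. ennreal (cmod (g x)) \<le> esssup torus_measure (\<lambda>x. ennreal (cmod (g x)))"
    by (rule esssup_AE)
  moreover have "esssup torus_measure (\<lambda>x. ennreal (cmod (g x))) \<le> ennreal D"
    using le(1) True unfolding Lp_norm_def by simp
  ultimately have "AE x in torus_measure. ennreal (cmod (g x)) \<le> ennreal D"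
    by (elim eventually_mono) (rule order_trans)
  then have "AE x in torus_measure. ennreal (cmod (g x) powr q) \<le> ennreal (D powr q)"
    using le(2) True q by (elim eventually_mono) (auto intro!: ennreal_leI powr_mono2 simp: ennreal_le_iff)
  then have "(\<integral>\<^sup>+ x. ennreal (cmod (g x) powr q) \<partial>torus_measure) \<le> (\<integral>\<^sup>+ x. ennreal (D powr q) \<partial>(torus_measure :: (real ^ 'd) measure))"
    by (rule nn_integral_mono_AE)
  also have "\<dots> = ennreal (D powr q) * emeasure (torus_measure :: (real ^ 'd) measure) (space torus_measure)" by simp
  also have "emeasure (torus_measure :: (real ^ 'd) measure) (space torus_measure) \<le> 1"
    by (simp add: prob_space.emeasure_space_1[OF prob_space_torus_measure])
  finally show ?thesis by (simp add: mult_left_mono)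
next
  case False
  define I where "I = (\<integral>\<^sup>+ x. ennreal (cmod (g x) powr q) \<partial>torus_measure)"
  have q0: "0 < q"
    using assms(1) False q by (cases p) (auto simp: enn2real_positive_iff less_top)
  have "I \<noteq> \<infinity>" and le': "ennreal (enn2real I powr (1 / q)) \<le> ennreal D"
    using le False unfolding Lp_norm_def I_def q Let_def by (auto split: if_splits simp: top_unique)
  then have "enn2real I powr (1 / q) \<le> D" using le(2) by (simp add: ennreal_le_iff)
  then have "(enn2real I powr (1 / q)) powr q \<le> D powr q" using q0 by (intro powr_mono2) auto
  then have "enn2real I \<le> D powr q" using q0 by (simp add: powr_powr)
  then have "ennreal (enn2real I) \<le> ennreal (D powr q)" by (rule ennreal_leI)
  moreover have "ennreal (enn2real I) = I" using \<open>I \<noteq> \<infinity>\<close> by (simp add: less_top)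
  ultimately show ?thesis by (simp only: I_def)
qed

section \<open>Haar coefficients in several variables\<close>

definition haar :: "('d \<Rightarrow> nat) \<Rightarrow> ('d \<Rightarrow> nat) \<Rightarrow> real ^ 'd \<Rightarrow> real" where
  "haar s k x = (\<Prod>j\<in>UNIV. haar1 (s j) (k j) (x $ j))"

definition haar_index :: "('d \<Rightarrow> nat) \<Rightarrow> ('d \<Rightarrow> nat) set" where
  "haar_index s = PiE UNIV (\<lambda>j. haar1_index (s j))"

text \<open>The factor is the reciprocal of the integral of the squared Haar function, because these
  functions are normalized in the maximum norm and not in mean square.\<close>

definition haar_coeff :: "(real ^ 'd \<Rightarrow> complex) \<Rightarrow> ('d \<Rightarrow> nat) \<Rightarrow> ('d \<Rightarrow> nat) \<Rightarrow> complex" where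
  "haar_coeff f s k = of_real ((\<Prod>j\<in>UNIV. 2 ^ (s j - 1)) / (2 * pi) ^ CARD('d)) *
     (\<integral>x. of_real (indicator torus_cube x * haar s k x) * f x \<partial>lebesgue)"

lemma integrable_powr_torus_cube:
  fixes g :: "real ^ 'd \<Rightarrow> complex"
  assumes [measurable]: "g \<in> borel_measurable lebesgue"
    and le: "(\<integral>\<^sup>+ x. ennreal (cmod (g x) powr q) \<partial>torus_measure) \<le> ennreal E" and "0 \<le> E"
  shows "integrable lebesgue (\<lambda>x. indicator torus_cube x * cmod (g x) powr q)" (is ?I)
    and "(\<integral>x. indicator torus_cube x * cmod (g x) powr q \<partial>lebesgue) \<le> (2 * pi) ^ CARD('d) * E"
proof -
  have eq: "ennreal (indicator torus_cube x * cmod (g x) powr q) = ennreal (cmod (g x) powr q) * indicator torus_cube x" for x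
    by (simp add: indicator_def)
  have nn: "(\<integral>\<^sup>+ x. ennreal (indicator torus_cube x * cmod (g x) powr q) \<partial>lebesgue)
      \<le> ennreal ((2 * pi) ^ CARD('d)) * ennreal E"
    unfolding eq by (subst nn_integral_torus_measure) (auto intro!: mult_left_mono le)
  also have "\<dots> = ennreal ((2 * pi) ^ CARD('d) * E)" using \<open>0 \<le> E\<close> by (simp add: ennreal_mult)
  finally have nn': "(\<integral>\<^sup>+ x. ennreal (indicator torus_cube x * cmod (g x) powr q) \<partial>lebesgue) \<le> ennreal ((2 * pi) ^ CARD('d) * E)" .
  show ?I
    by (rule integrableI_nonneg) (auto intro!: le_less_trans[OF nn'])
  then have "ennreal (\<integral>x. indicator torus_cube x * cmod (g x) powr q \<partial>lebesgue) \<le> ennreal ((2 * pi) ^ CARD('d) * E)"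
    using nn' by (subst nn_integral_eq_integral[symmetric]) auto
  then show "(\<integral>x. indicator torus_cube x * cmod (g x) powr q \<partial>lebesgue) \<le> (2 * pi) ^ CARD('d) * E"
    using \<open>0 \<le> E\<close> by (subst (asm) ennreal_le_iff) auto
qed

text \<open>Does the work of Jensen's inequality, up to a constant: either \<open>a\<close> is at
  most \<open>u\<close>, or \<open>a powr (1 - q)\<close> is at most
  \<open>u powr (1 - q)\<close>.\<close>

lemma le_add_powr:
  fixes a u q :: real
  assumes "0 < u" "0 \<le> a" "1 \<le> q"
  shows "a \<le> u + a powr q * u powr (1 - q)"
proof (cases "a \<le> u")
  case True
  then show ?thesis using assms by (simp add: add_increasing2)
next
  case False
  then have "0 < a" using assms by simp
  then have "a = a powr q * a powr (1 - q)" by (simp add: powr_add[symmetric])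
  also have "\<dots> \<le> a powr q * u powr (1 - q)"
    using False assms by (intro mult_left_mono powr_mono2') auto
  finally show ?thesis using assms by simp
qed

lemma integrable_indicator_half_open_box:
  fixes l u :: "real ^ 'd"
  assumes "\<And>j. l $ j \<le> u $ j"
  shows "integrable lebesgue (indicator (half_open_box l u) :: real ^ 'd \<Rightarrow> real)"
  using emeasure_half_open_box[of l u] assms by (intro integrable_real_indicator) auto

lemma integrable_torus_cube:
  fixes g :: "real ^ 'd \<Rightarrow> complex"
  assumes [measurable]: "g \<in> borel_measurable lebesgue" and "1 \<le> q"
    and int: "integrable lebesgue (\<lambda>x. indicator torus_cube x * cmod (g x) powr q)"
  shows "integrable lebesgue (\<lambda>x. of_real (indicator torus_cube x) * g x)"
proof (rule Bochner_Integration.integrable_bound)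
  show "integrable lebesgue (\<lambda>x. indicator torus_cube x + indicator torus_cube x * cmod (g x) powr q)"
    by (intro Bochner_Integration.integrable_add int integrable_indicator_half_open_box) simp
  show "AE x in lebesgue. norm (of_real (indicator torus_cube x) * g x)
      \<le> norm (indicator torus_cube x + indicator torus_cube x * cmod (g x) powr q)"
    using le_add_powr[OF zero_less_one norm_ge_zero \<open>1 \<le> q\<close>]
    by (intro AE_I2) (auto simp: norm_mult indicator_def abs_of_nonneg)
qed simp

text \<open>The box is the product of the left halves in the variables with
  \<open>s j \<noteq> 0\<close> and of the full period in the others. Moving the differences to
  \<open>f\<close> leaves the integral of a mixed difference over it. A shift by \<open>h\<close>
  leads from a left half to the right half, so all arguments stay in the cube.\<close>

lemma haar_coeff_le_integral:
  fixes f :: "real ^ 'd \<Rightarrow> complex"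
  assumes F: "integrable lebesgue (\<lambda>x. of_real (indicator torus_cube x) * f x)"
    and k: "k \<in> haar_index s"
    and h: "h = (\<chi> j. 2 * pi / 2 ^ s j)" and l: "l = (\<chi> j. 2 * pi * (2 * real (k j)) / 2 ^ s j)"
  shows "cmod (haar_coeff f s k) * measure lebesgue (half_open_box l (l + h))
    \<le> (\<integral>x. indicator (half_open_box l (l + h)) x * cmod (mixed_diff 1 h {j. s j \<noteq> 0} f x) \<partial>lebesgue)"
    and "half_open_box l (l + h) \<subseteq> torus_cube"
proof -
  define F where "F = (\<lambda>x. of_real (indicator torus_cube x) * f x)"
  define e where "e = {j. s j \<noteq> 0}"
  define I where "I = (\<lambda>j. indicator {l $ j..<l $ j + h $ j} :: real \<Rightarrow> real)"
  let ?L = "half_open_box l (l + h)"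
  have kj: "k j < 2 ^ (s j - 1)" for j using k by (auto simp: haar_index_def)
  have h0: "0 < h $ j" for j unfolding h by simp
  have l0: "0 \<le> l $ j" for j unfolding l by simp
  have top: "l $ j + h $ j \<le> 2 * pi" "j \<in> e \<Longrightarrow> l $ j + 2 * h $ j \<le> 2 * pi" for j
  proof -
    have "real (k j + 1) \<le> real (2 ^ (s j - 1))" using kj[of j] by (intro of_nat_mono) simp
    then have k1: "real (k j) + 1 \<le> 2 ^ (s j - 1)" by simp
    show 2: "l $ j + 2 * h $ j \<le> 2 * pi" if je: "j \<in> e"
    proof -
      obtain b where b: "s j = Suc b" using je by (cases "s j") (auto simp: e_def)
      have "l $ j + 2 * h $ j = 2 * pi * ((real (k j) + 1) / 2 ^ b)" unfolding h l by (simp add: b field_simps)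
      also have "\<dots> \<le> 2 * pi * 1" using k1 b by (intro mult_left_mono) auto
      finally show ?thesis by simp
    qed
    show "l $ j + h $ j \<le> 2 * pi"
    proof (cases "j \<in> e")
      case True
      then show ?thesis using 2 h0[of j] by simp
    next
      case False
      then have "s j = 0" by (simp add: e_def)
      then show ?thesis using kj[of j] by (simp add: l h)
    qed
  qed
  show "?L \<subseteq> torus_cube"
    using top(1) l0 by (fastforce simp: half_open_box_def intro: order_trans less_le_trans)
  have prodI: "(\<Prod>j\<in>UNIV. I j (x $ j)) = indicator ?L x" for x
  proof (cases "x \<in> ?L")
    case True
    then show ?thesis by (simp add: I_def half_open_box_def indicator_def)
  next
    case False
    then obtain j where "I j (x $ j) = 0" by (auto simp: I_def half_open_box_def indicator_def)
    then show ?thesis using False by (auto intro: prod_zero)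
  qed
  have prod_cube: "(\<Prod>j\<in>UNIV. indicator {0..<2 * pi} (x $ j)) = (indicator torus_cube x :: real)" for x :: "real ^ 'd"
  proof (cases "x \<in> torus_cube")
    case True
    then show ?thesis by (simp add: half_open_box_def indicator_def)
  next
    case False
    then obtain j where "indicator {0..<2 * pi} (x $ j) = (0 :: real)" by (auto simp: half_open_box_def indicator_def)
    then show ?thesis using False by (auto intro: prod_zero)
  qed
  have haar_eq: "indicator torus_cube x * haar s k x
      = (\<Prod>j\<in>UNIV. if j \<in> e then I j (x $ j) - I j (x $ j - h $ j) else I j (x $ j))" for x
    unfolding haar_def prod_cube[symmetric] prod.distrib[symmetric] I_def
    by (intro prod.cong refl) (use kj haar1_eq_difference[of _ _ "h $ _" "l $ _"] in \<open>simp add: e_def h l\<close>)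
  have "(\<integral>x. of_real (indicator torus_cube x * haar s k x) * f x \<partial>lebesgue)
      = (\<integral>x. of_real (indicator torus_cube x * haar s k x) * F x \<partial>lebesgue)"
    by (intro Bochner_Integration.integral_cong) (auto simp: F_def indicator_def)
  also have "\<dots> = (-1) ^ card e * (\<integral>x. of_real (\<Prod>j\<in>UNIV. I j (x $ j)) * mixed_diff 1 h e F x \<partial>lebesgue)"
    unfolding haar_eq by (rule integral_shifted_differences) (use F in \<open>auto simp: F_def I_def\<close>)
  also have "\<dots> = (-1) ^ card e * (\<integral>x. of_real (indicator ?L x) * mixed_diff 1 h e f x \<partial>lebesgue)"
  proof -
    have "mixed_diff 1 h e F x = mixed_diff 1 h e f x" if x: "x \<in> ?L" for x
    proof (rule mixed_diff_cong)
      fix e' assume e': "e' \<subseteq> e"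
      have coord: "(x + (\<Sum>j\<in>e'. axis j (h $ j))) $ i = x $ i + (if i \<in> e' then h $ i else 0)" for i
        by (simp add: axis_def if_distrib cong: if_cong)
      have "x + (\<Sum>j\<in>e'. axis j (h $ j)) \<in> torus_cube"
        unfolding half_open_box_def mem_Collect_eq coord
      proof (intro allI)
        fix i
        have "l $ i \<le> x $ i" "x $ i < l $ i + h $ i" using x by (auto simp: half_open_box_def)
        then show "0 $ i \<le> x $ i + (if i \<in> e' then h $ i else 0) \<and> x $ i + (if i \<in> e' then h $ i else 0) < (\<chi> j. 2 * pi) $ i"
          using l0[of i] h0[of i] top[of i] e' by auto
      qed
      then show "F (x + (\<Sum>j\<in>e'. axis j (h $ j))) = f (x + (\<Sum>j\<in>e'. axis j (h $ j)))"
        by (simp add: F_def)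
    qed
    then show ?thesis
      unfolding prodI
      by (intro arg_cong[where f = "\<lambda>a. (-1) ^ card e * a"] Bochner_Integration.integral_cong) (auto simp: indicator_def)
  qed
  finally have "cmod (\<integral>x. of_real (indicator torus_cube x * haar s k x) * f x \<partial>lebesgue)
      = cmod (\<integral>x. of_real (indicator ?L x) * mixed_diff 1 h e f x \<partial>lebesgue)"
    by (simp add: norm_mult norm_power)
  also have "\<dots> \<le> (\<integral>x. cmod (of_real (indicator ?L x) * mixed_diff 1 h e f x) \<partial>lebesgue)"
    by (rule integral_norm_bound)
  also have "\<dots> = (\<integral>x. indicator ?L x * cmod (mixed_diff 1 h e f x) \<partial>lebesgue)"
    by (simp add: norm_mult)
  finally have le: "cmod (\<integral>x. of_real (indicator torus_cube x * haar s k x) * f x \<partial>lebesgue)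
      \<le> (\<integral>x. indicator ?L x * cmod (mixed_diff 1 h e f x) \<partial>lebesgue)" .
  define c where "c = (\<Prod>j\<in>(UNIV :: 'd set). 2 ^ (s j - 1)) / (2 * pi) ^ CARD('d)"
  have c0: "0 \<le> c" unfolding c_def by (simp add: prod_nonneg)
  \<comment> \<open>Variable by variable, the factor is 1/2, or 1 where \<open>s j = 0\<close> and
    the subtraction is truncated.\<close>
  have "c * measure lebesgue ?L = (\<Prod>j\<in>(UNIV :: 'd set). 2 ^ (s j - 1)) * (\<Prod>j\<in>(UNIV :: 'd set). 1 / 2 ^ s j)"
    using h0 by (subst measure_half_open_box) (auto simp: less_imp_le c_def h prod_dividef)
  also have "\<dots> = (\<Prod>j\<in>(UNIV :: 'd set). 2 ^ (s j - 1) / 2 ^ s j)" by (simp add: prod.distrib[symmetric])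
  also have "\<dots> \<le> 1"
  proof (intro prod_le_1 conjI)
    fix j show "(2 :: real) ^ (s j - 1) / 2 ^ s j \<le> 1" using power_increasing[of "s j - 1" "s j" "2 :: real"] by simp
  qed simp
  finally have cL: "c * measure lebesgue ?L \<le> 1" .
  have "cmod (haar_coeff f s k) * measure lebesgue ?L
      = (c * measure lebesgue ?L) * cmod (\<integral>x. of_real (indicator torus_cube x * haar s k x) * f x \<partial>lebesgue)"
    unfolding haar_coeff_def c_def[symmetric] norm_mult using c0 by simp
  also have "\<dots> \<le> 1 * cmod (\<integral>x. of_real (indicator torus_cube x * haar s k x) * f x \<partial>lebesgue)"
    by (intro mult_right_mono cL) simp
  finally show "cmod (haar_coeff f s k) * measure lebesgue ?L
      \<le> (\<integral>x. indicator ?L x * cmod (mixed_diff 1 h {j. s j \<noteq> 0} f x) \<partial>lebesgue)"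
    using le by (simp add: e_def)
qed

lemma finite_haar_index [simp]: "finite (haar_index (s :: 'd::finite \<Rightarrow> nat))"
  unfolding haar_index_def by (intro finite_PiE) auto

text \<open>Up to the factor \<open>2 powr q\<close>, the q-th power of a coefficient is at most the
  mean of that of the mixed difference over its box. The boxes of a block are disjoint, so the sum
  is at most a multiple of one integral over the torus, where the class gives the bound
  \<open>D\<close>. The power of two is that integral's normalization against the volume of a
  box.\<close>

lemma sum_haar_coeff_powr_le:
  fixes f :: "real ^ 'd \<Rightarrow> complex"
  assumes f: "f \<in> borel_measurable lebesgue" and q: "1 \<le> q"
    and le: "\<And>e t. (\<integral>\<^sup>+ x. ennreal (cmod (mixed_diff 1 t e f x) powr q) \<partial>torus_measure)
      \<le> ennreal ((\<Prod>j\<in>e. \<bar>t $ j\<bar> powr (1/2)) powr q)"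
  shows "(\<Sum>k\<in>haar_index s. cmod (haar_coeff f s k) powr q)
    \<le> 2 ^ (\<Sum>j\<in>UNIV. s j) * (2 * (2 * pi) powr (real CARD('d) / 2) * 2 powr (- real (\<Sum>j\<in>UNIV. s j) / 2)) powr q"
proof -
  define h :: "real ^ 'd" where "h = (\<chi> j. 2 * pi / 2 ^ s j)"
  define l :: "('d \<Rightarrow> nat) \<Rightarrow> real ^ 'd" where "l = (\<lambda>k. \<chi> j. 2 * pi * (2 * real (k j)) / 2 ^ s j)"
  define e where "e = {j. s j \<noteq> 0}"
  define g where "g = mixed_diff 1 h e f"
  define L where "L = (\<lambda>k. half_open_box (l k) (l k + h))"
  define D where "D = (\<Prod>j\<in>e. \<bar>h $ j\<bar> powr (1/2))"
  define V where "V = (\<Prod>j\<in>UNIV. h $ j)"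
  define A where "A = (\<lambda>k. \<integral>x. indicator (L k) x * cmod (g x) powr q \<partial>lebesgue)"
  have h0: "0 < h $ j" for j unfolding h_def by simp
  have V0: "0 < V" unfolding V_def using h0 by (intro prod_pos) auto
  have mL: "measure lebesgue (L k) = V" for k
    unfolding L_def V_def using h0 by (subst measure_half_open_box) (auto simp: less_imp_le)
  have [measurable]: "L k \<in> sets lebesgue" for k unfolding L_def by simp
  have intL: "integrable lebesgue (indicator (L k) :: _ \<Rightarrow> real)" for k
    unfolding L_def using h0 by (intro integrable_indicator_half_open_box) (auto simp: less_imp_le)
  have D0: "0 \<le> D" unfolding D_def by (intro prod_nonneg) auto
  have [measurable]: "g \<in> borel_measurable lebesgue" unfolding g_def by (rule measurable_mixed_diff[OF f])
  note gq = integrable_powr_torus_cube[of g q "D powr q"]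
  have gle: "(\<integral>\<^sup>+ x. ennreal (cmod (g x) powr q) \<partial>torus_measure) \<le> ennreal (D powr q)"
    unfolding g_def D_def by (rule le)
  have int: "integrable lebesgue (\<lambda>x. indicator torus_cube x * cmod (g x) powr q)"
    and int_le: "(\<integral>x. indicator torus_cube x * cmod (g x) powr q \<partial>lebesgue) \<le> (2 * pi) ^ CARD('d) * D powr q"
    using gq gle by auto
  have "integrable lebesgue (\<lambda>x. indicator torus_cube x * cmod (f x) powr q)"
    by (rule integrable_powr_torus_cube(1)[OF f, of q 1]) (use le[of 0 "{}"] in simp_all)
  then have F: "integrable lebesgue (\<lambda>x. of_real (indicator torus_cube x) * f x)"
    by (intro integrable_torus_cube[OF f q])
  have coeff: "cmod (haar_coeff f s k) * V \<le> (\<integral>x. indicator (L k) x * cmod (g x) \<partial>lebesgue)" if "k \<in> haar_index s" for k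
    using haar_coeff_le_integral(1)[OF F that h_def, of "l k"] mL[of k] by (simp add: L_def g_def e_def l_def)
  have L_sub: "L k \<subseteq> torus_cube" if "k \<in> haar_index s" for k
    using haar_coeff_le_integral(2)[OF F that h_def, of "l k"] by (simp add: L_def l_def)
  have intA: "integrable lebesgue (\<lambda>x. indicator (L k) x * cmod (g x) powr q)" if "k \<in> haar_index s" for k
    using L_sub[OF that] by (intro Bochner_Integration.integrable_bound[OF int]) (auto simp: indicator_def)
  have A0: "0 \<le> A k" for k unfolding A_def by (intro integral_nonneg_AE) auto
  have one: "cmod (haar_coeff f s k) powr q \<le> 2 powr q * A k / V" if k: "k \<in> haar_index s" for k
  proof (cases "cmod (haar_coeff f s k) = 0")
    case True
    then show ?thesis using A0[of k] V0 by simp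
  next
    case False
    \<comment> \<open>With half the coefficient as the splitting level, the term
      \<open>u * V\<close> is absorbed by the left side \<open>2 * u * V\<close>.\<close>
    define u where "u = cmod (haar_coeff f s k) / 2"
    have u: "0 < u" using False unfolding u_def by simp
    have "2 * u * V \<le> (\<integral>x. indicator (L k) x * cmod (g x) \<partial>lebesgue)"
      using coeff[OF k] unfolding u_def by simp
    also have "\<dots> \<le> (\<integral>x. u * indicator (L k) x + u powr (1 - q) * (indicator (L k) x * cmod (g x) powr q) \<partial>lebesgue)"
    proof (rule integral_mono')
      show "integrable lebesgue (\<lambda>x. u * indicator (L k) x + u powr (1 - q) * (indicator (L k) x * cmod (g x) powr q))"
        by (intro Bochner_Integration.integrable_add integrable_mult_right intL intA k)
      show "indicator (L k) x * cmod (g x) \<le> u * indicator (L k) x + u powr (1 - q) * (indicator (L k) x * cmod (g x) powr q)" for x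
        using le_add_powr[OF u norm_ge_zero q, of "g x"] by (auto simp: indicator_def mult.commute)
    qed (use u in \<open>simp add: indicator_def\<close>)
    also have "\<dots> = u * V + u powr (1 - q) * A k"
      unfolding A_def using intL[of k] intA[OF k] by (simp add: mL)
    finally have "u * V \<le> u powr (1 - q) * A k" by (simp add: mult.commute)
    then have "u powr (q - 1) * (u * V) \<le> u powr (q - 1) * (u powr (1 - q) * A k)"
      by (intro mult_left_mono) auto
    moreover have "u powr (q - 1) * u = u powr q" using u by (simp add: powr_diff)
    moreover have "u powr (q - 1) * u powr (1 - q) = 1" using u by (simp add: powr_add[symmetric])
    ultimately have "u powr q * V \<le> A k" by (simp add: mult.assoc[symmetric])
    then have "u powr q \<le> A k / V" using V0 by (simp add: field_simps)
    then have "2 powr q * u powr q \<le> 2 powr q * (A k / V)" by (intro mult_left_mono) auto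
    moreover have "2 powr q * u powr q = cmod (haar_coeff f s k) powr q"
      unfolding u_def by (simp add: powr_mult[symmetric])
    ultimately show ?thesis by simp
  qed
  \<comment> \<open>The left corners lie on a grid of step \<open>2 * h\<close>, whereas the boxes
    have edge \<open>h\<close>.\<close>
  have disj: "k = k'" if "x \<in> L k" "x \<in> L k'" for x k k'
  proof
    fix j
    have "l k $ j < l k' $ j + h $ j" "l k' $ j < l k $ j + h $ j"
      using that unfolding L_def half_open_box_def by (force intro: le_less_trans)+
    moreover have "l k $ j = h $ j * (2 * real (k j))" for k unfolding l_def h_def by simp
    ultimately have "h $ j * (2 * real (k j)) < h $ j * (2 * real (k' j) + 1)"
      "h $ j * (2 * real (k' j)) < h $ j * (2 * real (k j) + 1)"
      by (simp_all only: distrib_left mult_1_right)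
    then have "2 * real (k j) < 2 * real (k' j) + 1" "2 * real (k' j) < 2 * real (k j) + 1"
      using h0[of j] by (simp_all only: mult_less_cancel_left_pos)
    then show "k j = k' j" by linarith
  qed
  have "(\<Sum>k\<in>haar_index s. A k) = (\<integral>x. (\<Sum>k\<in>haar_index s. indicator (L k) x * cmod (g x) powr q) \<partial>lebesgue)"
    unfolding A_def by (intro Bochner_Integration.integral_sum[symmetric] intA)
  also have "\<dots> \<le> (\<integral>x. indicator torus_cube x * cmod (g x) powr q \<partial>lebesgue)"
  proof (rule integral_mono[OF _ int])
    show "integrable lebesgue (\<lambda>x. \<Sum>k\<in>haar_index s. indicator (L k) x * cmod (g x) powr q)"
      by (intro Bochner_Integration.integrable_sum intA)
    fix x
    show "(\<Sum>k\<in>haar_index s. indicator (L k) x * cmod (g x) powr q) \<le> indicator torus_cube x * cmod (g x) powr q"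
    proof (cases "\<exists>k\<in>haar_index s. x \<in> L k")
      case True
      then obtain k where k: "k \<in> haar_index s" "x \<in> L k" by blast
      have "(\<Sum>k'\<in>haar_index s. indicator (L k') x * cmod (g x) powr q)
          = (\<Sum>k'\<in>haar_index s. if k' = k then cmod (g x) powr q else 0)"
        using k disj by (intro sum.cong) (auto simp: indicator_def)
      also have "\<dots> = cmod (g x) powr q" using k by simp
      finally show ?thesis using k L_sub by (auto simp: indicator_def)
    next
      case False
      then show ?thesis by (auto simp: indicator_def intro!: sum_nonneg sum_nonpos)
    qed
  qed
  finally have sumA: "(\<Sum>k\<in>haar_index s. A k) \<le> (2 * pi) ^ CARD('d) * D powr q" using int_le by linarith
  have VV: "(2 * pi) ^ CARD('d) / V = 2 ^ (\<Sum>j\<in>UNIV. s j)"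
    unfolding V_def h_def by (simp add: prod_dividef power_sum)
  have DD: "D \<le> (2 * pi) powr (real CARD('d) / 2) * 2 powr (- real (\<Sum>j\<in>UNIV. s j) / 2)"
  proof -
    have h_le: "\<bar>h $ j\<bar> powr (1/2) = (2 * pi) powr (1/2) * 2 powr (- real (s j) / 2)" for j
    proof -
      have "\<bar>h $ j\<bar> = 2 * pi * 2 powr (- real (s j))"
        unfolding h_def by (simp add: powr_minus powr_realpow field_simps)
      then show ?thesis by (simp add: powr_mult powr_powr)
    qed
    have pi1: "1 \<le> (2 * pi) powr (1/2)" using pi_ge_two by (intro ge_one_powr_ge_zero) auto
    \<comment> \<open>Variables with \<open>s j = 0\<close> give no smoothness factor; a factor
      \<open>sqrt (2 * pi)\<close>, which is at least 1, is inserted for each so that the bound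
      depends on the level alone.\<close>
    have "D \<le> D * (\<Prod>j\<in>UNIV - e. (2 * pi) powr (1/2) * 2 powr (- real (s j) / 2))"
    proof -
      have "1 \<le> (\<Prod>j\<in>UNIV - e. (2 * pi) powr (1/2) * 2 powr (- real (s j) / 2))"
        using pi1 by (intro prod_ge_1) (auto simp: e_def)
      then show ?thesis using D0 mult_left_mono[of 1 _ D] by simp
    qed
    also have "\<dots> = (\<Prod>j\<in>UNIV. (2 * pi) powr (1/2) * 2 powr (- real (s j) / 2))"
      unfolding D_def h_le by (subst prod.subset_diff[of e UNIV]) (auto simp: mult.commute)
    also have "\<dots> = (2 * pi) powr (real CARD('d) / 2) * 2 powr (- real (\<Sum>j\<in>UNIV. s j) / 2)"
      by (simp add: prod.distrib powr_sum[symmetric] powr_power sum_divide_distrib sum_negf)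
    finally show ?thesis .
  qed
  have "(\<Sum>k\<in>haar_index s. cmod (haar_coeff f s k) powr q) \<le> (\<Sum>k\<in>haar_index s. 2 powr q * A k / V)"
    by (intro sum_mono one)
  also have "\<dots> = 2 powr q * (\<Sum>k\<in>haar_index s. A k) / V"
    by (simp add: sum_divide_distrib sum_distrib_left)
  also have "\<dots> \<le> 2 powr q * ((2 * pi) ^ CARD('d) * D powr q) / V"
    using V0 sumA by (intro divide_right_mono mult_left_mono) auto
  also have "\<dots> = 2 ^ (\<Sum>j\<in>UNIV. s j) * (2 * D) powr q"
    using D0 by (simp add: VV[symmetric] powr_mult)
  also have "\<dots> \<le> 2 ^ (\<Sum>j\<in>UNIV. s j) * (2 * ((2 * pi) powr (real CARD('d) / 2) * 2 powr (- real (\<Sum>j\<in>UNIV. s j) / 2))) powr q"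
    using DD D0 q by (intro mult_left_mono powr_mono2) auto
  finally show ?thesis by (simp add: mult.assoc)
qed

section \<open>Convergence of Haar expansions\<close>

lemma tendsto_integral_truncation:
  fixes F :: "'a \<Rightarrow> complex"
  assumes F: "integrable M F"
  shows "(\<lambda>n. \<integral>x. cmod (F x - (if cmod (F x) \<le> real n then F x else 0)) \<partial>M) \<longlonglongrightarrow> 0"
proof -
  have [measurable]: "F \<in> borel_measurable M" using F by auto
  have "(\<lambda>n. \<integral>x. cmod (F x - (if cmod (F x) \<le> real n then F x else 0)) \<partial>M) \<longlonglongrightarrow> (\<integral>x. 0 \<partial>M)"
  proof (rule integral_dominated_convergence[where w = "\<lambda>x. cmod (F x)"])
    show "AE x in M. (\<lambda>n. cmod (F x - (if cmod (F x) \<le> real n then F x else 0))) \<longlonglongrightarrow> 0"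
    proof (intro AE_I2 tendsto_eventually)
      fix x
      obtain N where N: "cmod (F x) \<le> real N" using real_arch_simple by blast
      show "\<forall>\<^sub>F n in sequentially. cmod (F x - (if cmod (F x) \<le> real n then F x else 0)) = 0"
        using eventually_ge_at_top[of N] by eventually_elim (use N in auto)
    qed
  qed (use F in auto)
  then show ?thesis by simp
qed

text \<open>A Lebesgue measurable function is almost everywhere a limit of continuous ones.
  Truncating the function and retracting the approximants to a fixed ball gives dominated
  convergence, hence closeness in mean.\<close>

lemma integrable_approx_continuous:
  fixes F :: "'a::euclidean_space \<Rightarrow> complex"
  assumes F: "integrable lebesgue F" and A: "A \<in> sets lebesgue" "emeasure lebesgue A < \<infinity>" and "0 < \<epsilon>"
  shows "\<exists>g. continuous_on UNIV g \<and> bounded (range g) \<and> (\<integral>x. indicator A x * cmod (F x - g x) \<partial>lebesgue) < \<epsilon>"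
proof -
  have [measurable]: "F \<in> borel_measurable lebesgue" "A \<in> sets lebesgue" using F A by auto
  from order_tendstoD(2)[OF tendsto_integral_truncation[OF F], of "\<epsilon> / 2"] \<open>0 < \<epsilon>\<close>
  obtain K where K: "(\<integral>x. cmod (F x - (if cmod (F x) \<le> real K then F x else 0)) \<partial>lebesgue) < \<epsilon> / 2"
    by (auto simp: eventually_sequentially)
  define G where "G = (\<lambda>x. if cmod (F x) \<le> real K then F x else 0)"
  have [measurable]: "G \<in> borel_measurable lebesgue" unfolding G_def by measurable
  have G_le: "cmod (G x) \<le> real K" for x unfolding G_def by auto
  have "G measurable_on UNIV"
    by (subst measurable_on_iff_borel_measurable) simp_all
  then obtain N g where N: "negligible N" and g: "\<And>n. continuous_on UNIV (g n)"
    and lim: "\<And>x. x \<notin> N \<Longrightarrow> (\<lambda>n. g n x) \<longlonglongrightarrow> G x"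
    unfolding measurable_on_def by auto
  \<comment> \<open>Radial retraction onto the ball of radius \<open>K + 1\<close>; the successor
    keeps the denominator positive also for \<open>K = 0\<close>.\<close>
  define r where "r = (\<lambda>z :: complex. of_real (real (Suc K) / max (real (Suc K)) (cmod z)) * z)"
  have r_cont: "continuous_on UNIV r"
    unfolding r_def by (intro continuous_intros) (auto simp: max_def)
  have r_id: "r z = z" if "cmod z \<le> real K" for z
    using that unfolding r_def by (simp add: max_def)
  have r_le: "cmod (r z) \<le> real (Suc K)" for z
    unfolding r_def norm_mult norm_of_real by (auto simp: max_def divide_simps)
  have rg: "continuous_on UNIV (\<lambda>x. r (g n x))" for n
    using continuous_on_compose2[OF r_cont g] by auto
  have [measurable]: "(\<lambda>x. r (g n x)) \<in> borel_measurable lebesgue" for n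
    using borel_measurable_continuous_onI[OF rg] by (intro measurable_completion) simp
  have Gg_le: "indicator A x * cmod (G x - r (g n x)) \<le> indicator A x * (2 * real (Suc K))" for n x
  proof -
    have "cmod (G x - r (g n x)) \<le> cmod (G x) + cmod (r (g n x))" by (rule norm_triangle_ineq4)
    also have "\<dots> \<le> 2 * real (Suc K)" using G_le[of x] r_le[of "g n x"] by simp
    finally show ?thesis by (intro mult_left_mono) auto
  qed
  have "(\<lambda>n. \<integral>x. indicator A x * cmod (G x - r (g n x)) \<partial>lebesgue) \<longlonglongrightarrow> (\<integral>x. 0 \<partial>(lebesgue :: 'a measure))"
  proof (rule integral_dominated_convergence[where w = "\<lambda>x. indicator A x * (2 * real (Suc K))"])
    show "integrable lebesgue (\<lambda>x. indicator A x * (2 * real (Suc K)))"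
      using A by (intro integrable_mult_left integrable_real_indicator) auto
    show "AE x in lebesgue. norm (indicator A x * cmod (G x - r (g n x))) \<le> indicator A x * (2 * real (Suc K))" for n
      by (intro AE_I2) (simp add: Gg_le abs_mult del: of_nat_Suc)
    have "(\<lambda>n. indicator A x * cmod (G x - r (g n x))) \<longlonglongrightarrow> 0" if "x \<notin> N" for x
    proof -
      have "isCont r (G x)" using r_cont by (simp add: continuous_on_eq_continuous_at)
      then have "(\<lambda>n. r (g n x)) \<longlonglongrightarrow> r (G x)" by (rule isCont_tendsto_compose) (rule lim[OF that])
      then have "(\<lambda>n. indicator A x * cmod (G x - r (g n x))) \<longlonglongrightarrow> indicator A x * cmod (G x - r (G x))"
        by (intro tendsto_intros)
      then show ?thesis by (simp add: r_id[OF G_le])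
    qed
    then show "AE x in lebesgue. (\<lambda>n. indicator A x * cmod (G x - r (g n x))) \<longlonglongrightarrow> 0"
      using N by (intro AE_I'[of N]) (auto simp: negligible_iff_null_sets)
  qed measurable
  then have "(\<lambda>n. \<integral>x. indicator A x * cmod (G x - r (g n x)) \<partial>lebesgue) \<longlonglongrightarrow> 0" by simp
  from order_tendstoD(2)[OF this, of "\<epsilon> / 2"] \<open>0 < \<epsilon>\<close>
  obtain n where n: "(\<integral>x. indicator A x * cmod (G x - r (g n x)) \<partial>lebesgue) < \<epsilon> / 2"
    by (auto simp: eventually_sequentially)
  have intFG: "integrable lebesgue (\<lambda>x. cmod (F x - G x))"
    by (rule Bochner_Integration.integrable_bound[OF F]) (auto simp: G_def)
  have intGg: "integrable lebesgue (\<lambda>x. indicator A x * cmod (G x - r (g n x)))"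
  proof (rule Bochner_Integration.integrable_bound)
    show "integrable lebesgue (\<lambda>x. indicator A x * (2 * real (Suc K)))"
      using A by (intro integrable_mult_left integrable_real_indicator) auto
    show "AE x in lebesgue. norm (indicator A x * cmod (G x - r (g n x))) \<le> norm (indicator A x * (2 * real (Suc K)))"
      by (intro AE_I2) (simp add: Gg_le abs_mult del: of_nat_Suc)
  qed measurable
  have "(\<integral>x. indicator A x * cmod (F x - r (g n x)) \<partial>lebesgue)
      \<le> (\<integral>x. cmod (F x - G x) + indicator A x * cmod (G x - r (g n x)) \<partial>lebesgue)"
  proof (rule integral_mono')
    show "integrable lebesgue (\<lambda>x. cmod (F x - G x) + indicator A x * cmod (G x - r (g n x)))"
      by (intro Bochner_Integration.integrable_add intFG intGg)
    fix x
    have "cmod (F x - r (g n x)) \<le> cmod (F x - G x) + cmod (G x - r (g n x))"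
      using norm_triangle_ineq[of "F x - G x" "G x - r (g n x)"] by simp
    then show "indicator A x * cmod (F x - r (g n x)) \<le> cmod (F x - G x) + indicator A x * cmod (G x - r (g n x))"
      by (auto simp: indicator_def)
  qed (auto simp: indicator_def)
  also have "\<dots> = (\<integral>x. cmod (F x - G x) \<partial>lebesgue) + (\<integral>x. indicator A x * cmod (G x - r (g n x)) \<partial>lebesgue)"
    by (intro Bochner_Integration.integral_add intFG intGg)
  also have "\<dots> < \<epsilon>" using K n unfolding G_def by linarith
  finally show ?thesis
    using rg r_le by (intro exI[of _ "\<lambda>x. r (g n x)"]) (auto intro!: boundedI)
qed

section \<open>Averages over dyadic cells and Haar partial sums\<close>

definition dyadic_cell :: "nat \<Rightarrow> ('d \<Rightarrow> nat) \<Rightarrow> (real ^ 'd) set" where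
  "dyadic_cell n \<kappa> = half_open_box (\<chi> j. 2 * pi * real (\<kappa> j) / 2 ^ n) (\<chi> j. 2 * pi * (real (\<kappa> j) + 1) / 2 ^ n)"

definition cell_index :: "nat \<Rightarrow> real ^ 'd \<Rightarrow> 'd \<Rightarrow> nat" where
  "cell_index n x = (\<lambda>j. dyadic_pos n (x $ j))"

text \<open>The conditional expectation on the grid of cells of side \<open>2 * pi / 2 ^ n\<close>,
  given at every point by the cell that contains it modulo the period.\<close>

definition cell_average :: "nat \<Rightarrow> (real ^ 'd \<Rightarrow> complex) \<Rightarrow> real ^ 'd \<Rightarrow> complex" where
  "cell_average n G x = of_real ((2 ^ n) ^ CARD('d) / (2 * pi) ^ CARD('d)) *
     (\<integral>y. of_real (indicator (dyadic_cell n (cell_index n x)) y) * G y \<partial>lebesgue)"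

abbreviation cell_indices :: "nat \<Rightarrow> ('d \<Rightarrow> nat) set" where
  "cell_indices n \<equiv> PiE UNIV (\<lambda>_. {..<2 ^ n})"

lemma cell_index_in [simp]: "cell_index n x \<in> cell_indices n"
  by (auto simp: cell_index_def dyadic_pos_less PiE_UNIV_domain)

lemma dyadic_cell_lebesgue [measurable, simp]: "dyadic_cell n \<kappa> \<in> sets lebesgue"
  unfolding dyadic_cell_def by simp

lemma measure_dyadic_cell: "measure lebesgue (dyadic_cell n \<kappa> :: (real ^ 'd) set) = (2 * pi) ^ CARD('d) / (2 ^ n) ^ CARD('d)"
  unfolding dyadic_cell_def
  by (subst measure_half_open_box) (auto simp: divide_right_mono diff_divide_distrib[symmetric] algebra_simps power_divide)

lemma integrable_dyadic_cell: "integrable lebesgue (indicator (dyadic_cell n \<kappa>) :: real ^ 'd \<Rightarrow> real)"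
  unfolding dyadic_cell_def
  by (intro integrable_indicator_half_open_box) (auto simp: divide_right_mono)

lemma mem_dyadic_cell_iff:
  assumes "x \<in> torus_cube"
  shows "x \<in> dyadic_cell n \<kappa> \<longleftrightarrow> cell_index n x = \<kappa>"
  using assms by (auto simp: dyadic_cell_def half_open_box_def cell_index_def fun_eq_iff dyadic_pos_eq_iff)

lemma dyadic_cell_subset:
  assumes "\<kappa> \<in> cell_indices n"
  shows "dyadic_cell n \<kappa> \<subseteq> torus_cube"
proof
  fix x assume x: "x \<in> dyadic_cell n \<kappa>"
  show "x \<in> torus_cube"
    unfolding half_open_box_def mem_Collect_eq
  proof
    fix j
    have "\<kappa> j + 1 \<le> 2 ^ n" using assms by (auto simp: Suc_le_eq)
    then have "real (\<kappa> j + 1) \<le> real (2 ^ n)" by (rule of_nat_mono)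
    then have "2 * pi * ((real (\<kappa> j) + 1) / 2 ^ n) \<le> 2 * pi * 1" by (intro mult_left_mono) auto
    moreover have "2 * pi * real (\<kappa> j) / 2 ^ n \<le> x $ j" "x $ j < 2 * pi * (real (\<kappa> j) + 1) / 2 ^ n"
      using x by (auto simp: dyadic_cell_def half_open_box_def)
    moreover have "0 \<le> 2 * pi * real (\<kappa> j) / 2 ^ n" by simp
    moreover have "2 * pi * (real (\<kappa> j) + 1) / 2 ^ n = 2 * pi * ((real (\<kappa> j) + 1) / 2 ^ n)" by simp
    ultimately have "0 \<le> x $ j" "x $ j < 2 * pi" by linarith+
    then show "0 $ j \<le> x $ j \<and> x $ j < (\<chi> j. 2 * pi) $ j" by simp
  qed
qed

lemma sum_indicator_dyadic_cell:
  fixes c :: "('d::finite \<Rightarrow> nat) \<Rightarrow> 'b::semiring_1"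
  shows "(\<Sum>\<kappa>\<in>cell_indices n. indicator (dyadic_cell n \<kappa>) x * c \<kappa>)
    = indicator torus_cube x * c (cell_index n x)"
proof (cases "x \<in> torus_cube")
  case True
  have "(\<Sum>\<kappa>\<in>cell_indices n. indicator (dyadic_cell n \<kappa>) x * c \<kappa>)
      = (\<Sum>\<kappa>\<in>cell_indices n. if \<kappa> = cell_index n x then c (cell_index n x) else 0)"
    using mem_dyadic_cell_iff[OF True, of n] by (intro sum.cong) (auto simp: indicator_def)
  then show ?thesis using True by (subst (asm) sum.delta) (auto intro: finite_PiE)
next
  case False
  then have "x \<notin> dyadic_cell n \<kappa>" if "\<kappa> \<in> cell_indices n" for \<kappa>
    using dyadic_cell_subset[OF that] by blast
  then show ?thesis using False by (auto simp: indicator_def intro!: sum.neutral)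
qed

lemma integrable_indicator_mult:
  fixes G :: "'a \<Rightarrow> complex"
  assumes "integrable M G" "A \<in> sets M"
  shows "integrable M (\<lambda>y. of_real (indicator A y) * G y)"
  using assms by (intro Bochner_Integration.integrable_bound[OF assms(1)]) (auto simp: indicator_def)

lemma cell_average_diff:
  assumes "integrable lebesgue F" "integrable lebesgue G"
  shows "cell_average n (\<lambda>y. F y - G y) x = cell_average n F x - cell_average n G x"
  unfolding cell_average_def right_diff_distrib
  by (subst Bochner_Integration.integral_diff) (auto intro!: integrable_indicator_mult assms simp: right_diff_distrib)

lemma cell_average_eq_sum:
  "indicator torus_cube x * cmod (cell_average n G x)
    = (\<Sum>\<kappa>\<in>cell_indices n. indicator (dyadic_cell n \<kappa>) x * ((2 ^ n) ^ CARD('d) / (2 * pi) ^ CARD('d) *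
        cmod (\<integral>y. of_real (indicator (dyadic_cell n \<kappa>) y) * G y \<partial>lebesgue)))"
  for x :: "real ^ 'd"
  unfolding sum_indicator_dyadic_cell cell_average_def norm_mult norm_of_real by simp

lemma integral_cell_average_le:
  fixes G :: "real ^ 'd \<Rightarrow> complex"
  assumes G: "integrable lebesgue G"
  shows "integrable lebesgue (\<lambda>x. indicator torus_cube x * cmod (cell_average n G x))"
    and "(\<integral>x. indicator torus_cube x * cmod (cell_average n G x) \<partial>lebesgue) \<le> (\<integral>x. indicator torus_cube x * cmod (G x) \<partial>lebesgue)"
proof -
  show "integrable lebesgue (\<lambda>x. indicator torus_cube x * cmod (cell_average n G x))"
    unfolding cell_average_eq_sum
    by (intro Bochner_Integration.integrable_sum integrable_mult_left integrable_dyadic_cell)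
  have intG: "integrable lebesgue (\<lambda>x. indicator A x * cmod (G x))" if "A \<in> sets lebesgue" for A
    using integrable_norm[OF integrable_indicator_mult[OF G that]] by (simp add: norm_mult)
  have "(\<integral>x. indicator torus_cube x * cmod (cell_average n G x) \<partial>lebesgue)
      = (\<Sum>\<kappa>\<in>cell_indices n. measure lebesgue (dyadic_cell n \<kappa> :: (real ^ 'd) set) * ((2 ^ n) ^ CARD('d) / (2 * pi) ^ CARD('d) *
        cmod (\<integral>y. of_real (indicator (dyadic_cell n \<kappa>) y) * G y \<partial>lebesgue)))"
    unfolding cell_average_eq_sum
    by (subst Bochner_Integration.integral_sum) (auto intro!: integrable_mult_left integrable_dyadic_cell)
  also have "\<dots> = (\<Sum>\<kappa>\<in>cell_indices n. cmod (\<integral>y. of_real (indicator (dyadic_cell n \<kappa>) y) * G y \<partial>lebesgue))"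
    by (simp add: measure_dyadic_cell)
  also have "\<dots> \<le> (\<Sum>\<kappa>\<in>cell_indices n. \<integral>y. indicator (dyadic_cell n \<kappa>) y * cmod (G y) \<partial>lebesgue)"
  proof (intro sum_mono)
    fix \<kappa> :: "'d \<Rightarrow> nat"
    have "cmod (\<integral>y. of_real (indicator (dyadic_cell n \<kappa>) y) * G y \<partial>lebesgue)
        \<le> (\<integral>y. cmod (of_real (indicator (dyadic_cell n \<kappa>) y) * G y) \<partial>lebesgue)" by (rule integral_norm_bound)
    then show "cmod (\<integral>y. of_real (indicator (dyadic_cell n \<kappa>) y) * G y \<partial>lebesgue)
        \<le> (\<integral>y. indicator (dyadic_cell n \<kappa>) y * cmod (G y) \<partial>lebesgue)" by (simp add: norm_mult)
  qed
  also have "\<dots> = (\<integral>y. (\<Sum>\<kappa>\<in>cell_indices n. indicator (dyadic_cell n \<kappa>) y * cmod (G y)) \<partial>lebesgue)"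
    by (intro Bochner_Integration.integral_sum[symmetric] intG) simp
  also have "\<dots> = (\<integral>x. indicator torus_cube x * cmod (G x) \<partial>lebesgue)"
    using sum_indicator_dyadic_cell[of n _ "\<lambda>_. cmod (G _)"] by (simp add: sum_indicator_dyadic_cell)
  finally show "(\<integral>x. indicator torus_cube x * cmod (cell_average n G x) \<partial>lebesgue) \<le> (\<integral>x. indicator torus_cube x * cmod (G x) \<partial>lebesgue)" .
qed

lemma dist_dyadic_cell_le:
  fixes x y :: "real ^ 'd"
  assumes "x \<in> dyadic_cell n \<kappa>" "y \<in> dyadic_cell n \<kappa>"
  shows "dist x y \<le> real CARD('d) * (2 * pi / 2 ^ n)"
proof -
  have "dist x y \<le> (\<Sum>j\<in>UNIV. \<bar>(x - y) $ j\<bar>)" unfolding dist_norm by (rule norm_le_l1_cart)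
  also have "\<dots> \<le> (\<Sum>j\<in>(UNIV :: 'd set). 2 * pi / 2 ^ n)"
  proof (intro sum_mono)
    fix j
    have "2 * pi * real (\<kappa> j) / 2 ^ n \<le> x $ j" "x $ j < 2 * pi * real (\<kappa> j) / 2 ^ n + 2 * pi / 2 ^ n"
      "2 * pi * real (\<kappa> j) / 2 ^ n \<le> y $ j" "y $ j < 2 * pi * real (\<kappa> j) / 2 ^ n + 2 * pi / 2 ^ n"
      using assms by (auto simp: dyadic_cell_def half_open_box_def distrib_left add_divide_distrib)
    then show "\<bar>(x - y) $ j\<bar> \<le> 2 * pi / 2 ^ n" unfolding vector_minus_component by linarith
  qed
  finally show ?thesis by simp
qed

lemma cell_average_continuous:
  fixes g :: "real ^ 'd \<Rightarrow> complex"
  assumes g: "continuous_on UNIV g" and "0 < \<epsilon>"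
    and int: "integrable lebesgue (\<lambda>x. of_real (indicator torus_cube x) * g x)"
  shows "\<forall>\<^sub>F n in sequentially. \<forall>x\<in>torus_cube.
    cmod (g x - cell_average n (\<lambda>x. of_real (indicator torus_cube x) * g x) x) \<le> \<epsilon>"
proof -
  have "uniformly_continuous_on (cbox 0 (\<chi> j. 2 * pi)) g"
    using g by (intro compact_uniformly_continuous) (auto intro: continuous_on_subset)
  then obtain \<delta> where \<delta>: "0 < \<delta>" and uc: "\<And>x y. \<lbrakk>x \<in> cbox 0 (\<chi> j. 2 * pi); y \<in> cbox 0 (\<chi> j. 2 * pi); dist x y < \<delta>\<rbrakk> \<Longrightarrow> dist (g x) (g y) < \<epsilon>"
    using \<open>0 < \<epsilon>\<close> unfolding uniformly_continuous_on_def by (metis dist_commute)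
  have sub: "torus_cube \<subseteq> cbox 0 (\<chi> j. 2 * pi :: real ^ 'd)"
    by (auto simp: half_open_box_def mem_box_cart less_imp_le)
  have "(\<lambda>n. real CARD('d) * (2 * pi / 2 ^ n)) \<longlonglongrightarrow> 0"
    by (intro tendsto_mult_right_zero tendsto_divide_0[OF tendsto_const] filterlim_at_top_imp_at_infinity filterlim_realpow_sequentially_gt1) simp
  then have "\<forall>\<^sub>F n in sequentially. real CARD('d) * (2 * pi / 2 ^ n) < \<delta>" using \<delta> by (rule order_tendstoD(2))
  then show ?thesis
  proof eventually_elim
    case (elim n)
    show ?case
    proof
      fix x :: "real ^ 'd" assume x: "x \<in> torus_cube"
      let ?C = "dyadic_cell n (cell_index n x) :: (real ^ 'd) set"
      let ?G = "\<lambda>x. of_real (indicator torus_cube x) * g x"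
      define c :: real where "c = (2 ^ n) ^ CARD('d) / (2 * pi) ^ CARD('d)"
      have cm: "c * measure lebesgue ?C = 1" unfolding c_def measure_dyadic_cell by simp
      have c0: "0 \<le> c" unfolding c_def by simp
      have xC: "x \<in> ?C" using mem_dyadic_cell_iff[OF x] by simp
      have CT: "?C \<subseteq> torus_cube" by (rule dyadic_cell_subset) simp
      have i1: "integrable lebesgue (\<lambda>y. of_real (indicator ?C y) * g x)"
        using integrable_dyadic_cell[of n "cell_index n x"] by (intro integrable_mult_left integrable_of_real)
      have i2: "integrable lebesgue (\<lambda>y. of_real (indicator ?C y) * ?G y)"
        by (intro integrable_indicator_mult int) simp
      have "g x = of_real c * (\<integral>y. of_real (indicator ?C y) * g x \<partial>lebesgue)"
        using cm by (simp add: mult.assoc[symmetric] of_real_mult[symmetric] del: of_real_mult)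
      then have "g x - cell_average n ?G x
          = of_real c * ((\<integral>y. of_real (indicator ?C y) * g x \<partial>lebesgue) - (\<integral>y. of_real (indicator ?C y) * ?G y \<partial>lebesgue))"
        unfolding cell_average_def c_def by (simp add: right_diff_distrib)
      also have "\<dots> = of_real c * (\<integral>y. of_real (indicator ?C y) * g x - of_real (indicator ?C y) * ?G y \<partial>lebesgue)"
        by (subst Bochner_Integration.integral_diff[OF i1 i2]) (rule refl)
      finally have "cmod (g x - cell_average n ?G x)
          = c * cmod (\<integral>y. of_real (indicator ?C y) * g x - of_real (indicator ?C y) * ?G y \<partial>lebesgue)"
        using c0 by (simp add: norm_mult)
      also have "\<dots> \<le> c * (\<integral>y. cmod (of_real (indicator ?C y) * g x - of_real (indicator ?C y) * ?G y) \<partial>lebesgue)"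
        using c0 by (intro mult_left_mono integral_norm_bound)
      also have "\<dots> \<le> c * (\<integral>y. indicator ?C y * \<epsilon> \<partial>lebesgue)"
      proof (intro mult_left_mono c0 integral_mono')
        show "integrable lebesgue (\<lambda>y. indicator ?C y * \<epsilon>)" by (intro integrable_mult_left integrable_dyadic_cell)
        fix y
        show "cmod (of_real (indicator ?C y) * g x - of_real (indicator ?C y) * ?G y) \<le> indicator ?C y * \<epsilon>"
        proof (cases "y \<in> ?C")
          case True
          have "dist x y < \<delta>" using dist_dyadic_cell_le[OF xC True] elim by linarith
          then have "dist (g x) (g y) < \<epsilon>" using uc x True CT sub by blast
          then show ?thesis using True CT by (auto simp: dist_norm)
        qed simp
        show "0 \<le> indicator ?C y * \<epsilon>" using \<open>0 < \<epsilon>\<close> by simp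
      qed
      also have "\<dots> = \<epsilon>" using cm by (simp add: mult.assoc[symmetric])
      finally show "cmod (g x - cell_average n ?G x) \<le> \<epsilon>" .
    qed
  qed
qed

text \<open>Taking the levels from a cube makes the index set a product, and the sum factors into
  the kernels of one variable. For this reason partial sums run over cubes, although the
  approximation is organized by \<open>level\<close>.\<close>

lemma haar_kernel:
  fixes x y :: "real ^ 'd"
  shows "(\<Sum>s\<in>PiE UNIV (\<lambda>_. {..n}). (\<Prod>j\<in>UNIV. 2 ^ (s j - 1)) * (\<Sum>k\<in>haar_index s. haar s k x * haar s k y))
    = (2 ^ n) ^ CARD('d) * of_bool (cell_index n x = cell_index n y)"
proof -
  have "(\<Sum>k\<in>haar_index s. haar s k x * haar s k y)
      = (\<Prod>j\<in>UNIV. \<Sum>k\<in>haar1_index (s j). haar1 (s j) k (x $ j) * haar1 (s j) k (y $ j))" for s :: "'d \<Rightarrow> nat"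
    unfolding haar_index_def haar_def by (subst prod_sum_PiE) (simp_all add: prod.distrib)
  then have "(\<Sum>s\<in>PiE UNIV (\<lambda>_. {..n}). (\<Prod>j\<in>UNIV. 2 ^ (s j - 1)) * (\<Sum>k\<in>haar_index s. haar s k x * haar s k y))
      = (\<Sum>s\<in>PiE UNIV (\<lambda>_. {..n}). \<Prod>j\<in>UNIV. 2 ^ (s j - 1) * (\<Sum>k\<in>haar1_index (s j). haar1 (s j) k (x $ j) * haar1 (s j) k (y $ j)))"
    by (simp add: prod.distrib)
  also have "\<dots> = (\<Prod>j\<in>UNIV. \<Sum>a\<le>n. 2 ^ (a - 1) * (\<Sum>k\<in>haar1_index a. haar1 a k (x $ j) * haar1 a k (y $ j)))"
    by (subst prod_sum_PiE) simp_all
  also have "\<dots> = (\<Prod>j\<in>UNIV. 2 ^ n * of_bool (dyadic_pos n (x $ j) = dyadic_pos n (y $ j)))"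
    unfolding haar1_kernel by (rule refl)
  also have "\<dots> = (2 ^ n) ^ CARD('d) * of_bool (cell_index n x = cell_index n y)"
  proof (cases "cell_index n x = cell_index n y")
    case True
    then have "dyadic_pos n (x $ j) = dyadic_pos n (y $ j)" for j unfolding cell_index_def by (rule fun_cong)
    then show ?thesis using True by simp
  next
    case False
    then obtain j where "dyadic_pos n (x $ j) \<noteq> dyadic_pos n (y $ j)" by (auto simp: cell_index_def fun_eq_iff)
    then show ?thesis using False by (auto intro!: prod_zero)
  qed
  finally show ?thesis .
qed

lemma haar_measurable: "haar s k \<in> borel_measurable (lebesgue :: (real ^ 'd) measure)"
  unfolding haar_def[abs_def] by (intro borel_measurable_prod measurable_lebesgue_vec_nth haar1_measurable)

lemma haar_abs_le: "\<bar>haar s k x\<bar> \<le> 1"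
  unfolding haar_def abs_prod by (intro prod_le_1) (auto simp: haar1_abs_le)

lemma haar_partial_sum:
  fixes f :: "real ^ 'd \<Rightarrow> complex"
  assumes F: "integrable lebesgue (\<lambda>x. of_real (indicator torus_cube x) * f x)"
  shows "(\<Sum>s\<in>PiE UNIV (\<lambda>_. {..n}). \<Sum>k\<in>haar_index s. haar_coeff f s k * of_real (haar s k x))
    = cell_average n (\<lambda>x. of_real (indicator torus_cube x) * f x) x"
proof -
  define F where "F = (\<lambda>x. of_real (indicator torus_cube x) * f x)"
  have intF: "integrable lebesgue F" using F by (simp add: F_def)
  have F_haar: "of_real (indicator torus_cube y * haar s k y) * f y = of_real (haar s k y) * F y" for s k y
    by (simp add: F_def)
  have int: "integrable lebesgue (\<lambda>y. of_real (haar s k y) * F y)" for s k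
  proof (rule Bochner_Integration.integrable_bound[OF intF])
    have [measurable]: "haar s k \<in> borel_measurable lebesgue" "F \<in> borel_measurable lebesgue"
      using haar_measurable intF by auto
    show "(\<lambda>y. of_real (haar s k y) * F y) \<in> borel_measurable lebesgue" by measurable
    show "AE y in lebesgue. norm (of_real (haar s k y) * F y) \<le> norm (F y)"
      by (intro AE_I2) (simp add: norm_mult mult_left_le_one_le haar_abs_le)
  qed
  define w where "w = (\<lambda>s :: 'd \<Rightarrow> nat. (\<Prod>j\<in>UNIV. 2 ^ (s j - 1) :: real))"
  define c :: real where "c = 1 / (2 * pi) ^ CARD('d)"
  have "(\<Sum>s\<in>PiE UNIV (\<lambda>_. {..n}). \<Sum>k\<in>haar_index s. haar_coeff f s k * of_real (haar s k x))
      = (\<Sum>s\<in>PiE UNIV (\<lambda>_. {..n}). \<Sum>k\<in>haar_index s. \<integral>y. of_real (c * w s * haar s k x) * (of_real (haar s k y) * F y) \<partial>lebesgue)"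
  proof (intro sum.cong refl)
    fix s k
    have "haar_coeff f s k = of_real (c * w s) * (\<integral>y. of_real (haar s k y) * F y \<partial>lebesgue)"
      unfolding haar_coeff_def F_haar by (simp add: w_def c_def)
    then show "haar_coeff f s k * of_real (haar s k x)
        = (\<integral>y. of_real (c * w s * haar s k x) * (of_real (haar s k y) * F y) \<partial>lebesgue)"
      unfolding integral_mult_right_zero by (simp only: of_real_mult mult_ac)
  qed
  also have "\<dots> = (\<integral>y. (\<Sum>s\<in>PiE UNIV (\<lambda>_. {..n}). \<Sum>k\<in>haar_index s. of_real (c * w s * haar s k x) * (of_real (haar s k y) * F y)) \<partial>lebesgue)"
    by (simp only: Bochner_Integration.integral_sum Bochner_Integration.integrable_sum integrable_mult_right[OF int])
  also have "\<dots> = (\<integral>y. of_real ((2 ^ n) ^ CARD('d) / (2 * pi) ^ CARD('d)) * (of_real (indicator (dyadic_cell n (cell_index n x)) y) * F y) \<partial>lebesgue)"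
  proof (intro Bochner_Integration.integral_cong refl)
    fix y
    have "(\<Sum>s\<in>PiE UNIV (\<lambda>_. {..n}). \<Sum>k\<in>haar_index s. of_real (c * w s * haar s k x) * (of_real (haar s k y) * F y))
        = of_real (c * (\<Sum>s\<in>PiE UNIV (\<lambda>_. {..n}). w s * (\<Sum>k\<in>haar_index s. haar s k x * haar s k y))) * F y"
      by (simp add: sum_distrib_left sum_distrib_right mult_ac)
    also have "\<dots> = of_real (c * ((2 ^ n) ^ CARD('d) * of_bool (cell_index n x = cell_index n y))) * F y"
      unfolding w_def haar_kernel by (rule refl)
    also have "\<dots> = of_real ((2 ^ n) ^ CARD('d) / (2 * pi) ^ CARD('d)) * (of_real (indicator (dyadic_cell n (cell_index n x)) y) * F y)"
    proof (cases "y \<in> torus_cube")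
      case True
      have "(indicator (dyadic_cell n (cell_index n x)) y :: real) = of_bool (cell_index n x = cell_index n y)"
        using mem_dyadic_cell_iff[OF True, of n "cell_index n x"] by (auto simp: indicator_def)
      then show ?thesis unfolding c_def by simp
    qed (simp add: F_def)
    finally show "(\<Sum>s\<in>PiE UNIV (\<lambda>_. {..n}). \<Sum>k\<in>haar_index s. of_real (c * w s * haar s k x) * (of_real (haar s k y) * F y))
        = of_real ((2 ^ n) ^ CARD('d) / (2 * pi) ^ CARD('d)) * (of_real (indicator (dyadic_cell n (cell_index n x)) y) * F y)" .
  qed
  also have "\<dots> = cell_average n F x" unfolding cell_average_def by (rule integral_mult_right_zero)
  finally show ?thesis by (simp add: F_def)
qed

text \<open>A bounded continuous function is approximated uniformly by its averages, and the
  remaining part of \<open>F\<close>, small in mean, does not grow under averaging.\<close>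

lemma cell_average_tendsto_L1:
  fixes F :: "real ^ 'd \<Rightarrow> complex"
  assumes F: "integrable lebesgue F" and \<epsilon>: "0 < \<epsilon>"
  shows "\<forall>\<^sub>F n in sequentially. (\<integral>x. indicator torus_cube x * cmod (F x - cell_average n F x) \<partial>lebesgue) \<le> \<epsilon>"
proof -
  define V :: real where "V = (2 * pi) ^ CARD('d)"
  have V0: "0 < V" unfolding V_def by simp
  have "emeasure lebesgue (torus_cube :: (real ^ 'd) set) < \<infinity>" unfolding emeasure_torus_cube by simp
  from integrable_approx_continuous[OF F half_open_box_lebesgue this, of "\<epsilon> / 4"] \<epsilon>
  obtain g where g: "continuous_on UNIV g" and bg: "bounded (range g)"
    and close: "(\<integral>x. indicator torus_cube x * cmod (F x - g x) \<partial>lebesgue) < \<epsilon> / 4" by auto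
  define G where "G = (\<lambda>x. of_real (indicator torus_cube x) * g x)"
  have [measurable]: "g \<in> borel_measurable lebesgue"
    using borel_measurable_continuous_onI[OF g] by (intro measurable_completion) simp
  have itc: "integrable lebesgue (indicator torus_cube :: real ^ 'd \<Rightarrow> real)"
    by (intro integrable_indicator_half_open_box) simp
  obtain B where B: "\<And>x. cmod (g x) \<le> B" using bg by (auto simp: bounded_iff)
  have intG: "integrable lebesgue G" unfolding G_def
  proof (rule Bochner_Integration.integrable_bound)
    show "integrable lebesgue (\<lambda>x :: real ^ 'd. indicator torus_cube x * B)" using itc by simp
    show "AE x in lebesgue. norm (of_real (indicator torus_cube x) * g x) \<le> norm (indicator torus_cube x * B)"
      using B by (intro AE_I2) (auto simp: indicator_def intro: order_trans[OF B])
  qed measurable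
  have eqG: "(\<integral>x. indicator torus_cube x * cmod (F x - G x) \<partial>lebesgue) = (\<integral>x. indicator torus_cube x * cmod (F x - g x) \<partial>lebesgue)"
    by (intro Bochner_Integration.integral_cong) (auto simp: G_def indicator_def)
  have intFG: "integrable lebesgue (\<lambda>x. F x - G x)" using F intG by simp
  have int1: "integrable lebesgue (\<lambda>x. indicator torus_cube x * cmod (F x - G x))"
    using integrable_norm[OF integrable_indicator_mult[OF intFG half_open_box_lebesgue]] by (simp add: norm_mult)
  from cell_average_continuous[OF g, of "\<epsilon> / (4 * V)"] intG \<epsilon> V0
  have "\<forall>\<^sub>F n in sequentially. \<forall>x\<in>torus_cube. cmod (g x - cell_average n G x) \<le> \<epsilon> / (4 * V)"
    by (simp add: G_def)
  then show ?thesis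
  proof eventually_elim
    case (elim n)
    define H where "H = (\<lambda>x. F x - G x)"
    note avg = integral_cell_average_le[OF intFG, folded H_def, of n]
    have "(\<integral>x. indicator torus_cube x * cmod (F x - cell_average n F x) \<partial>lebesgue)
        \<le> (\<integral>x. indicator torus_cube x * cmod (F x - G x) + indicator torus_cube x * (\<epsilon> / (4 * V))
            + indicator torus_cube x * cmod (cell_average n H x) \<partial>lebesgue)"
    proof (rule integral_mono')
      show "integrable lebesgue (\<lambda>x. indicator torus_cube x * cmod (F x - G x) + indicator torus_cube x * (\<epsilon> / (4 * V))
            + indicator torus_cube x * cmod (cell_average n H x))"
        using int1 itc avg(1) by simp
      fix x :: "real ^ 'd"
      show "indicator torus_cube x * cmod (F x - cell_average n F x)
          \<le> indicator torus_cube x * cmod (F x - G x) + indicator torus_cube x * (\<epsilon> / (4 * V))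
            + indicator torus_cube x * cmod (cell_average n H x)"
      proof (cases "x \<in> torus_cube")
        case True
        have "F x - cell_average n F x = (F x - G x) + (g x - cell_average n G x) - cell_average n H x"
          unfolding H_def cell_average_diff[OF F intG] using True by (simp add: G_def)
        then have "cmod (F x - cell_average n F x) \<le> cmod (F x - G x) + cmod (g x - cell_average n G x) + cmod (cell_average n H x)"
          by (smt (verit) norm_triangle_ineq norm_triangle_ineq4)
        then show ?thesis using True elim by fastforce
      qed simp
      show "0 \<le> indicator torus_cube x * cmod (F x - G x) + indicator torus_cube x * (\<epsilon> / (4 * V))
            + indicator torus_cube x * cmod (cell_average n H x)" using \<epsilon> V0 by simp
    qed
    also have "\<dots> = (\<integral>x. indicator torus_cube x * cmod (F x - G x) \<partial>lebesgue) + measure lebesgue (torus_cube :: (real ^ 'd) set) * (\<epsilon> / (4 * V))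
        + (\<integral>x. indicator torus_cube x * cmod (cell_average n H x) \<partial>lebesgue)"
      using int1 itc avg(1) by simp
    also have "measure lebesgue (torus_cube :: (real ^ 'd) set) = V"
      unfolding V_def by (subst measure_half_open_box) auto
    also have "(\<integral>x. indicator torus_cube x * cmod (F x - G x) \<partial>lebesgue) + V * (\<epsilon> / (4 * V))
        + (\<integral>x. indicator torus_cube x * cmod (cell_average n H x) \<partial>lebesgue) \<le> \<epsilon>"
    proof -
      have "(\<integral>x. indicator torus_cube x * cmod (cell_average n H x) \<partial>lebesgue) < \<epsilon> / 4"
        using avg(2) close eqG by (simp add: H_def)
      moreover have "V * (\<epsilon> / (4 * V)) = \<epsilon> / 4" using V0 by simp
      ultimately show ?thesis using close eqG \<epsilon> by linarith
    qed
    finally show ?case .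
  qed
qed

text \<open>Convergence in mean suffices: the excess of \<open>cmod (F x - S x)\<close> over
  \<open>\<tau>\<close> is at most the distance of \<open>F\<close> from its n-th average for every
  \<open>n \<ge> N\<close>, hence its integral is 0.\<close>

lemma AE_le_if_cell_average_le:
  fixes F S :: "real ^ 'd \<Rightarrow> complex"
  assumes F: "integrable lebesgue F" and [measurable]: "S \<in> borel_measurable lebesgue"
    and le: "\<And>n x. N \<le> n \<Longrightarrow> cmod (cell_average n F x - S x) \<le> \<tau>"
  shows "AE x in lebesgue. x \<in> torus_cube \<longrightarrow> cmod (F x - S x) \<le> \<tau>"
proof -
  have [measurable]: "F \<in> borel_measurable lebesgue" using F by auto
  define u where "u = (\<lambda>x. indicator torus_cube x * max 0 (cmod (F x - S x) - \<tau>))"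
  have [measurable]: "u \<in> borel_measurable lebesgue" unfolding u_def by measurable
  have u0: "0 \<le> u x" for x unfolding u_def by simp
  have u_le: "u x \<le> indicator torus_cube x * cmod (F x - cell_average n F x)" if "N \<le> n" for n x
  proof -
    have "cmod (F x - S x) \<le> cmod (F x - cell_average n F x) + cmod (cell_average n F x - S x)"
      using norm_triangle_ineq[of "F x - cell_average n F x" "cell_average n F x - S x"] by simp
    then have "cmod (F x - S x) - \<tau> \<le> cmod (F x - cell_average n F x)" using le[OF that, of x] by linarith
    then show ?thesis unfolding u_def by (intro mult_left_mono) auto
  qed
  have int: "integrable lebesgue (\<lambda>x. indicator torus_cube x * cmod (F x - cell_average n F x))" for n
  proof -
    define c where "c = (\<lambda>\<kappa>. of_real ((2 ^ n) ^ CARD('d) / (2 * pi) ^ CARD('d)) *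
      (\<integral>y. of_real (indicator (dyadic_cell n \<kappa>) y) * F y \<partial>lebesgue))"
    have "of_real (indicator torus_cube x) * cell_average n F x = (\<Sum>\<kappa>\<in>cell_indices n. of_real (indicator (dyadic_cell n \<kappa>) x) * c \<kappa>)" for x
      using sum_indicator_dyadic_cell[of n x c] by (simp add: cell_average_def c_def of_real_indicator)
    moreover have "integrable lebesgue (\<lambda>x. \<Sum>\<kappa>\<in>cell_indices n. of_real (indicator (dyadic_cell n \<kappa>) x) * c \<kappa>)"
      by (intro Bochner_Integration.integrable_sum integrable_mult_left integrable_of_real integrable_dyadic_cell)
    ultimately have "integrable lebesgue (\<lambda>x. of_real (indicator torus_cube x) * F x - of_real (indicator torus_cube x) * cell_average n F x)"
      using integrable_indicator_mult[OF F half_open_box_lebesgue] by simp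
    from integrable_norm[OF this] show ?thesis
      by (simp add: right_diff_distrib[symmetric] norm_mult)
  qed
  have intu: "integrable lebesgue u"
    using u_le[of N] u0 by (intro Bochner_Integration.integrable_bound[OF int[of N]]) auto
  have "(\<integral>x. u x \<partial>lebesgue) \<le> \<epsilon>" if "0 < \<epsilon>" for \<epsilon>
  proof -
    from eventually_conj[OF cell_average_tendsto_L1[OF F that] eventually_ge_at_top[of N]]
    obtain n where n: "N \<le> n" "(\<integral>x. indicator torus_cube x * cmod (F x - cell_average n F x) \<partial>lebesgue) \<le> \<epsilon>"
      by (auto simp: eventually_sequentially)
    have "(\<integral>x. u x \<partial>lebesgue) \<le> (\<integral>x. indicator torus_cube x * cmod (F x - cell_average n F x) \<partial>lebesgue)"
      by (intro integral_mono intu int u_le n)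
    then show ?thesis using n by linarith
  qed
  then have "(\<integral>x. u x \<partial>lebesgue) \<le> 0" by (meson dense not_le)
  moreover have "0 \<le> (\<integral>x. u x \<partial>lebesgue)" by (intro integral_nonneg_AE AE_I2 u0)
  ultimately have "(\<integral>x. u x \<partial>lebesgue) = 0" by simp
  then have "AE x in lebesgue. u x = 0" using integral_nonneg_eq_0_iff_AE[OF intu] u0 by simp
  then show ?thesis
    by (rule AE_mp) (auto simp: u_def max_def split: if_splits)
qed

section \<open>Coefficients and counting\<close>

lemma mixed_Hoelder_class_nn_integral_le:
  fixes f :: "real ^ 'd \<Rightarrow> complex"
  assumes "2 < p" and q: "q = (if p = \<infinity> then 3 else enn2real p)"
    and f: "f \<in> mixed_Hoelder_class (1/2) p"
  shows "(\<integral>\<^sup>+ x. ennreal (cmod (mixed_diff 1 t e f x) powr q) \<partial>torus_measure)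
    \<le> ennreal ((\<Prod>j\<in>e. \<bar>t $ j\<bar> powr (1/2)) powr q)"
proof (rule Lp_norm_le_imp_nn_integral_le[OF assms(1) q])
  have "nat \<lfloor>1/2 :: real\<rfloor> + 1 = 1" by simp
  then show "Lp_norm p (mixed_diff 1 t e f) \<le> ennreal (\<Prod>j\<in>e. \<bar>t $ j\<bar> powr (1/2))"
    using f unfolding mixed_Hoelder_class_def by simp
qed (simp add: prod_nonneg)

lemma exponent_gt_2:
  assumes "2 < p" "q = (if p = \<infinity> then 3 else enn2real p)"
  shows "2 < q"
proof (cases "p = \<infinity>")
  case False
  then obtain r where r: "p = ennreal r" "0 \<le> r" by (cases p) auto
  have "ennreal 2 < ennreal r" using assms(1) r by simp
  then have "2 < r" by (subst (asm) ennreal_less_iff) auto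
  then show ?thesis using assms(2) False r by simp
qed (use assms in simp)

text \<open>Apart from measurability, these two facts are all that the approximation uses of the
  class: the size of the coefficients, and that a uniform bound for the partial sums passes to the
  function.\<close>

lemma
  fixes f :: "real ^ 'd \<Rightarrow> complex"
  assumes p: "2 < p" and q: "q = (if p = \<infinity> then 3 else enn2real p)"
    and f: "f \<in> mixed_Hoelder_class (1/2) p"
  shows mixed_Hoelder_class_haar_coeff: "(\<Sum>k\<in>haar_index s. cmod (haar_coeff f s k) powr q)
      \<le> 2 ^ (\<Sum>j\<in>UNIV. s j) * (2 * (2 * pi) powr (real CARD('d) / 2) * 2 powr (- real (\<Sum>j\<in>UNIV. s j) / 2)) powr q"
    and mixed_Hoelder_class_AE_le: "\<lbrakk>S \<in> borel_measurable lebesgue;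
      \<And>n x. N \<le> n \<Longrightarrow> cmod ((\<Sum>s\<in>PiE UNIV (\<lambda>_. {..n}). \<Sum>k\<in>haar_index s. haar_coeff f s k * of_real (haar s k x)) - S x) \<le> \<tau>\<rbrakk>
      \<Longrightarrow> AE x in torus_measure. cmod (f x - S x) \<le> \<tau>"
proof -
  have q2: "2 < q" by (rule exponent_gt_2[OF p q])
  have fm: "f \<in> borel_measurable lebesgue" using f by (simp add: mixed_Hoelder_class_def Lp_space_def)
  note le = mixed_Hoelder_class_nn_integral_le[OF p q f]
  show "(\<Sum>k\<in>haar_index s. cmod (haar_coeff f s k) powr q)
      \<le> 2 ^ (\<Sum>j\<in>UNIV. s j) * (2 * (2 * pi) powr (real CARD('d) / 2) * 2 powr (- real (\<Sum>j\<in>UNIV. s j) / 2)) powr q"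
    by (rule sum_haar_coeff_powr_le[OF fm _ le]) (use q2 in simp)
  have "integrable lebesgue (\<lambda>x. indicator torus_cube x * cmod (f x) powr q)"
    by (rule integrable_powr_torus_cube(1)[OF fm, of q 1]) (use le[of 0 "{}"] in simp_all)
  then have F: "integrable lebesgue (\<lambda>x. of_real (indicator torus_cube x) * f x)"
    using q2 by (intro integrable_torus_cube[OF fm, of q]) auto
  assume S: "S \<in> borel_measurable lebesgue"
    and N: "\<And>n x. N \<le> n \<Longrightarrow> cmod ((\<Sum>s\<in>PiE UNIV (\<lambda>_. {..n}). \<Sum>k\<in>haar_index s. haar_coeff f s k * of_real (haar s k x)) - S x) \<le> \<tau>"
  have "AE x in lebesgue. x \<in> torus_cube \<longrightarrow> cmod (of_real (indicator torus_cube x) * f x - S x) \<le> \<tau>"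
    by (rule AE_le_if_cell_average_le[OF F S, of N]) (use N in \<open>simp add: haar_partial_sum[OF F]\<close>)
  then show "AE x in torus_measure. cmod (f x - S x) \<le> \<tau>"
    unfolding AE_torus_measure_iff by (rule AE_mp) simp
qed

section \<open>Haar blocks in the maximum norm\<close>

text \<open>For fixed \<open>s\<close> the supports tile the torus: at each point one function of
  the block is 1 or -1 and the others vanish. Hence the largest coefficient bounds the
  block.\<close>

lemma sum_haar_abs: "(\<Sum>k\<in>haar_index s. \<bar>haar s k x\<bar>) = 1"
proof -
  have "(\<Sum>k\<in>haar_index s. \<bar>haar s k x\<bar>) = (\<Prod>j\<in>UNIV. \<Sum>k\<in>haar1_index (s j). \<bar>haar1 (s j) k (x $ j)\<bar>)"
    unfolding haar_index_def haar_def abs_prod by (rule prod_sum_PiE[symmetric]) auto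
  then show ?thesis unfolding sum_haar1_abs by simp
qed

lemma sum_haar_square_le: "(\<Sum>k\<in>haar_index s. (haar s k x)\<^sup>2) \<le> 1"
proof -
  have "(\<Sum>k\<in>haar_index s. (haar s k x)\<^sup>2) \<le> (\<Sum>k\<in>haar_index s. \<bar>haar s k x\<bar>)"
  proof (intro sum_mono)
    fix k
    have "\<bar>haar s k x\<bar> * \<bar>haar s k x\<bar> \<le> \<bar>haar s k x\<bar> * 1" by (intro mult_left_mono haar_abs_le) simp
    then show "(haar s k x)\<^sup>2 \<le> \<bar>haar s k x\<bar>" by (simp add: power2_eq_square)
  qed
  then show ?thesis by (simp add: sum_haar_abs)
qed

lemma card_haar_index_le: "card (haar_index (s :: 'd::finite \<Rightarrow> nat)) \<le> 2 ^ (\<Sum>j\<in>UNIV. s j)"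
proof -
  have "card (haar_index s) = (\<Prod>j\<in>UNIV. 2 ^ (s j - 1))" unfolding haar_index_def by (subst card_PiE) simp_all
  also have "\<dots> \<le> (\<Prod>j\<in>UNIV. 2 ^ s j)" by (intro prod_mono) (auto intro: power_increasing)
  also have "\<dots> = 2 ^ (\<Sum>j\<in>UNIV. s j)" by (simp add: power_sum)
  finally show ?thesis .
qed

lemma haar_periodic: "haar s k (x + axis j (2 * pi)) = haar s k x"
  unfolding haar_def
proof (intro prod.cong refl)
  fix i
  show "haar1 (s i) (k i) ((x + axis j (2 * pi)) $ i) = haar1 (s i) (k i) (x $ i)"
    by (cases "i = j") (simp_all add: axis_def haar1_periodic)
qed

lemma dyadic_pos_mono:
  assumes "a \<le> n" "dyadic_pos n t = dyadic_pos n u"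
  shows "dyadic_pos a t = dyadic_pos a u"
  using assms
proof (induction n)
  case (Suc n)
  show ?case
  proof (cases "a = Suc n")
    case False
    have "dyadic_pos n t = dyadic_pos n u"
      using dyadic_pos_div2[of n t] dyadic_pos_div2[of n u] Suc.prems(2) by metis
    then show ?thesis using Suc False by simp
  qed (use Suc in simp)
qed simp

lemma haar_eq_if_cell_index_eq:
  assumes "\<And>j. s j \<le> n" "cell_index n x = cell_index n y"
  shows "haar s k x = haar s k y"
  unfolding haar_def
proof (intro prod.cong refl)
  fix j
  have e: "dyadic_pos n (x $ j) = dyadic_pos n (y $ j)" using fun_cong[OF assms(2), of j] by (simp add: cell_index_def)
  show "haar1 (s j) (k j) (x $ j) = haar1 (s j) (k j) (y $ j)"
    unfolding haar1_def using dyadic_pos_mono[OF _ e] assms(1)[of j] by simp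
qed

text \<open>Reduces the maximum norm of step functions to a finite set. Its size is exponential in
  \<open>n\<close>, but the width bound sees only its logarithm.\<close>

lemma exists_cell_representatives:
  "\<exists>X :: (real ^ 'd) set. finite X \<and> X \<noteq> {} \<and> card X \<le> (2 ^ n) ^ CARD('d) \<and> (\<forall>x. \<exists>y\<in>X. cell_index n x = cell_index n y)"
proof -
  define r :: "('d \<Rightarrow> nat) \<Rightarrow> real ^ 'd" where "r = (\<lambda>\<kappa>. SOME x. cell_index n x = \<kappa>)"
  have r: "cell_index n (r (cell_index n x)) = cell_index n x" for x :: "real ^ 'd"
    unfolding r_def by (rule someI[where P = "\<lambda>y. cell_index n y = cell_index n x"]) simp
  have fin: "finite (cell_indices n :: ('d \<Rightarrow> nat) set)" by (intro finite_PiE) auto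
  have card: "card (cell_indices n :: ('d \<Rightarrow> nat) set) = (2 ^ n) ^ CARD('d)" by (simp add: card_PiE)
  show ?thesis
  proof (intro exI[of _ "r ` cell_indices n"] conjI allI)
    show "card (r ` cell_indices n) \<le> (2 ^ n) ^ CARD('d)" using card_image_le[OF fin, of r] card by simp
    show "r ` cell_indices n \<noteq> {}" using cell_index_in[of n 0] by blast
    fix x :: "real ^ 'd"
    show "\<exists>y\<in>r ` cell_indices n. cell_index n x = cell_index n y"
      using r[of x] by (intro bexI[of _ "r (cell_index n x)"]) auto
  qed (use fin in simp)
qed

section \<open>Counting multi-indices by level\<close>

lemma finite_level: "finite {s :: 'd::finite \<Rightarrow> nat. (\<Sum>j\<in>UNIV. s j) < b}"
proof (rule finite_subset)
  show "{s :: 'd \<Rightarrow> nat. (\<Sum>j\<in>UNIV. s j) < b} \<subseteq> PiE UNIV (\<lambda>_. {..b})"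
  proof
    fix s :: "'d \<Rightarrow> nat" assume s: "s \<in> {s. (\<Sum>j\<in>UNIV. s j) < b}"
    have "s j \<le> (\<Sum>j\<in>UNIV. s j)" for j by (rule member_le_sum) auto
    then show "s \<in> PiE UNIV (\<lambda>_. {..b})" using s by (auto simp: PiE_UNIV_domain intro: order_trans less_imp_le le_less_trans)
  qed
qed (intro finite_PiE; simp)

text \<open>All components but one determine the last, and each is at most \<open>n\<close>. This
  polynomial factor is the source of d - 1 of the logarithms.\<close>

lemma card_level_le:
  "card {s :: 'd::finite \<Rightarrow> nat. (\<Sum>j\<in>UNIV. s j) = n} \<le> (n + 1) ^ (CARD('d) - 1)"
proof -
  obtain j0 :: 'd where True by simp
  let ?r = "\<lambda>s :: 'd \<Rightarrow> nat. restrict s (UNIV - {j0})"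
  let ?A = "{s :: 'd \<Rightarrow> nat. (\<Sum>j\<in>UNIV. s j) = n}"
  have split: "(\<Sum>j\<in>UNIV. s j) = s j0 + (\<Sum>j\<in>UNIV - {j0}. s j)" for s :: "'d \<Rightarrow> nat"
    by (rule sum.remove) auto
  have inj: "inj_on ?r ?A"
  proof (rule inj_onI)
    fix s s' assume a: "s \<in> ?A" "s' \<in> ?A" "?r s = ?r s'"
    have eq: "s j = s' j" if "j \<noteq> j0" for j using fun_cong[OF a(3), of j] that by simp
    then have "(\<Sum>j\<in>UNIV - {j0}. s j) = (\<Sum>j\<in>UNIV - {j0}. s' j)" by (intro sum.cong) auto
    then have "s j0 = s' j0" using a(1,2) split[of s] split[of s'] by simp
    then show "s = s'" using eq by (metis ext)
  qed
  have "?r ` ?A \<subseteq> PiE (UNIV - {j0}) (\<lambda>_. {..n})"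
  proof
    fix t assume "t \<in> ?r ` ?A"
    then obtain s where s: "s \<in> ?A" "t = ?r s" by blast
    have "s j \<le> (\<Sum>j\<in>UNIV. s j)" for j by (rule member_le_sum) auto
    then show "t \<in> PiE (UNIV - {j0}) (\<lambda>_. {..n})" using s by auto
  qed
  then have "card ?A \<le> card (PiE (UNIV - {j0}) (\<lambda>_. {..n}))"
    by (intro card_inj_on_le[OF inj] finite_PiE) auto
  also have "\<dots> = (n + 1) ^ (CARD('d) - 1)" by (simp add: card_PiE card_Diff_singleton)
  finally show ?thesis .
qed

lemma sum_level_le:
  fixes g :: "nat \<Rightarrow> real"
  assumes "finite A" "A \<subseteq> {s :: 'd::finite \<Rightarrow> nat. a \<le> (\<Sum>j\<in>UNIV. s j) \<and> (\<Sum>j\<in>UNIV. s j) < b}" "\<And>l. 0 \<le> g l"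
  shows "(\<Sum>s\<in>A. g (\<Sum>j\<in>UNIV. s j)) \<le> (\<Sum>l\<in>{a..<b}. (real l + 1) ^ (CARD('d) - 1) * g l)"
proof -
  let ?lv = "\<lambda>s :: 'd \<Rightarrow> nat. \<Sum>j\<in>UNIV. s j"
  have "(\<Sum>s\<in>A. g (?lv s)) = (\<Sum>l\<in>{a..<b}. \<Sum>s\<in>{s\<in>A. ?lv s = l}. g (?lv s))"
    by (rule sum.group[symmetric]) (use assms in auto)
  also have "\<dots> = (\<Sum>l\<in>{a..<b}. real (card {s\<in>A. ?lv s = l}) * g l)" by simp
  also have "\<dots> \<le> (\<Sum>l\<in>{a..<b}. (real l + 1) ^ (CARD('d) - 1) * g l)"
  proof (intro sum_mono mult_right_mono assms)
    fix l
    have "{s :: 'd \<Rightarrow> nat. ?lv s = l} \<subseteq> {s. ?lv s < l + 1}" by auto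
    then have "finite {s :: 'd \<Rightarrow> nat. ?lv s = l}" using finite_level by (rule finite_subset)
    then have "card {s\<in>A. ?lv s = l} \<le> card {s :: 'd \<Rightarrow> nat. ?lv s = l}" by (rule card_mono) auto
    also have "\<dots> \<le> (l + 1) ^ (CARD('d) - 1)" by (rule card_level_le)
    finally have "real (card {s\<in>A. ?lv s = l}) \<le> real ((l + 1) ^ (CARD('d) - 1))" by (rule of_nat_mono)
    then show "real (card {s\<in>A. ?lv s = l}) \<le> (real l + 1) ^ (CARD('d) - 1)" by (simp add: add.commute)
  qed
  finally show ?thesis .
qed

text \<open>From \<open>l + 1 \<le> (a + 1) * (l - a + 1)\<close> the polynomial at the starting
  level factors out, and what remains is bounded by one convergent series; thus \<open>C\<close>
  does not depend on \<open>a\<close> and \<open>b\<close>.\<close>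

lemma sum_power_geometric_le:
  assumes "0 < \<theta>"
  shows "\<exists>C>0. \<forall>a b. (\<Sum>l\<in>{a..<b}. (real l + 1) ^ D * 2 powr (- \<theta> * (real l - real a))) \<le> C * (real a + 1) ^ D"
proof -
  define g where "g = (\<lambda>i. (real i + 1) ^ D * 2 powr (- \<theta> * real i))"
  have g0: "0 \<le> g i" for i unfolding g_def by simp
  \<comment> \<open>Chosen such that the polynomial consumes at most half of the exponential
    decay.\<close>
  define c where "c = \<theta> * ln 2 / (2 * (real D + 1))"
  have c0: "0 < c" unfolding c_def using assms by simp
  have g_le: "g i \<le> (1 + 1 / c) ^ D * exp (- \<theta> * ln 2 / 2) ^ i" for i
  proof -
    have "real i + 1 \<le> (1 + 1 / c) * (1 + c * real i)" using c0 by (simp add: field_simps)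
    also have "\<dots> \<le> (1 + 1 / c) * exp (c * real i)" using c0 by (intro mult_left_mono exp_ge_add_one_self) auto
    finally have "(real i + 1) ^ D \<le> ((1 + 1 / c) * exp (c * real i)) ^ D" by (intro power_mono) auto
    also have "\<dots> = (1 + 1 / c) ^ D * exp (real D * (c * real i))" by (simp add: power_mult_distrib exp_of_nat_mult)
    also have "\<dots> \<le> (1 + 1 / c) ^ D * exp (\<theta> * ln 2 / 2 * real i)"
    proof -
      have "real D * c \<le> (real D + 1) * c" using c0 by (intro mult_right_mono) auto
      also have "\<dots> = \<theta> * ln 2 / 2" unfolding c_def by (simp add: field_simps)
      finally have "real D * c * real i \<le> \<theta> * ln 2 / 2 * real i" by (intro mult_right_mono) auto
      then show ?thesis using c0 by (intro mult_left_mono) (auto simp: mult.assoc)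
    qed
    finally have "g i \<le> ((1 + 1 / c) ^ D * exp (\<theta> * ln 2 / 2 * real i)) * 2 powr (- \<theta> * real i)"
      unfolding g_def by (intro mult_right_mono) auto
    also have "2 powr (- \<theta> * real i) = exp (- \<theta> * real i * ln 2)" by (simp add: powr_def)
    also have "(1 + 1 / c) ^ D * exp (\<theta> * ln 2 / 2 * real i) * \<dots> = (1 + 1 / c) ^ D * exp (\<theta> * ln 2 / 2 * real i + - \<theta> * real i * ln 2)"
      by (simp only: exp_add mult.assoc)
    also have "\<theta> * ln 2 / 2 * real i + - \<theta> * real i * ln 2 = real i * (- \<theta> * ln 2 / 2)" by simp
    finally show ?thesis by (simp only: exp_of_nat_mult)
  qed
  have "summable (\<lambda>i. (1 + 1 / c) ^ D * exp (- \<theta> * ln 2 / 2) ^ i)"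
    using assms by (intro summable_mult summable_geometric) auto
  then have "summable g"
    by (rule summable_comparison_test') (use g0 g_le in \<open>simp only: real_norm_def abs_of_nonneg\<close>)
  have "(\<Sum>l\<in>{a..<b}. (real l + 1) ^ D * 2 powr (- \<theta> * (real l - real a))) \<le> (suminf g + 1) * (real a + 1) ^ D" for a b
  proof -
    have "(\<Sum>l\<in>{a..<b}. (real l + 1) ^ D * 2 powr (- \<theta> * (real l - real a)))
        \<le> (\<Sum>l\<in>{a..<b}. (real a + 1) ^ D * g (l - a))"
    proof (intro sum_mono)
      fix l assume l: "l \<in> {a..<b}"
      have "(real l + 1) ^ D \<le> ((real a + 1) * (real (l - a) + 1)) ^ D"
      proof (intro power_mono)
        have "0 \<le> real a * real (l - a)" by simp
        then show "real l + 1 \<le> (real a + 1) * (real (l - a) + 1)" using l by (simp add: distrib_left distrib_right)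
      qed simp
      then have "(real l + 1) ^ D * 2 powr (- \<theta> * (real l - real a))
          \<le> ((real a + 1) * (real (l - a) + 1)) ^ D * 2 powr (- \<theta> * (real l - real a))"
        by (intro mult_right_mono) auto
      also have "\<dots> = (real a + 1) ^ D * g (l - a)"
        using l unfolding g_def by (simp add: power_mult_distrib of_nat_diff)
      finally show "(real l + 1) ^ D * 2 powr (- \<theta> * (real l - real a)) \<le> (real a + 1) ^ D * g (l - a)" .
    qed
    also have "\<dots> = (real a + 1) ^ D * (\<Sum>i<b - a. g i)"
      unfolding sum_distrib_left sum.atLeastLessThan_shift_0[of _ a b] by (simp add: atLeast0LessThan)
    also have "\<dots> \<le> (real a + 1) ^ D * (suminf g + 1)"
    proof (intro mult_left_mono)
      have "(\<Sum>i<b - a. g i) \<le> suminf g" by (rule sum_le_suminf[OF \<open>summable g\<close>]) (simp_all add: g0)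
      then show "(\<Sum>i<b - a. g i) \<le> suminf g + 1" by simp
    qed simp
    finally show ?thesis by (simp add: mult.commute)
  qed
  moreover have "0 < suminf g + 1" using suminf_nonneg[OF \<open>summable g\<close> g0] by simp
  ultimately show ?thesis by blast
qed

abbreviation level :: "('d::finite \<Rightarrow> nat) \<Rightarrow> nat" where
  "level s \<equiv> (\<Sum>j\<in>UNIV. s j)"

lemma norm_sum_haar_le:
  fixes c :: "('d::finite \<Rightarrow> nat) \<Rightarrow> complex"
  assumes "\<And>k. k \<in> haar_index s \<Longrightarrow> cmod (c k) \<le> \<tau>"
  shows "cmod (\<Sum>k\<in>haar_index s. c k * of_real (haar s k x)) \<le> \<tau>"
proof -
  have "cmod (\<Sum>k\<in>haar_index s. c k * of_real (haar s k x)) \<le> (\<Sum>k\<in>haar_index s. \<tau> * \<bar>haar s k x\<bar>)"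
    by (intro sum_norm_le) (auto simp: norm_mult intro!: mult_right_mono assms)
  then show ?thesis by (simp add: sum_distrib_left[symmetric] sum_haar_abs)
qed

section \<open>Splitting the coefficients by size\<close>

text \<open>Says that about \<open>2 ^ level s\<close> coefficients of size
  \<open>C0 * 2 powr (- level s / 2)\<close> in the q-mean are allowed. Working with this class of
  sequences keeps the subspace independent of the function.\<close>

definition in_coeff_class :: "real \<Rightarrow> real \<Rightarrow> (('d::finite \<Rightarrow> nat) \<Rightarrow> ('d \<Rightarrow> nat) \<Rightarrow> complex) \<Rightarrow> bool" where
  "in_coeff_class q C0 c \<longleftrightarrow> (\<forall>s. (\<Sum>k\<in>haar_index s. cmod (c s k) powr q)
      \<le> 2 ^ level s * (C0 * 2 powr (- real (level s) / 2)) powr q)"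

lemma coeff_le:
  assumes c: "in_coeff_class q C0 c" and q: "2 < q" and C0: "0 < C0" and k: "k \<in> haar_index s"
  shows "cmod (c s k) \<le> C0 * 2 powr (- (1/2 - 1/q) * real (level s))"
proof -
  define l where "l = level s"
  have "cmod (c s k) powr q \<le> (\<Sum>k\<in>haar_index s. cmod (c s k) powr q)"
    by (intro member_le_sum k) auto
  also have "\<dots> \<le> 2 ^ l * (C0 * 2 powr (- real l / 2)) powr q"
    using c unfolding in_coeff_class_def l_def by blast
  also have "\<dots> = (2 powr (real l / q) * (C0 * 2 powr (- real l / 2))) powr q"
    using q C0 by (simp add: powr_mult powr_powr powr_realpow)
  finally have le: "cmod (c s k) powr q \<le> (2 powr (real l / q) * (C0 * 2 powr (- real l / 2))) powr q" .
  have "cmod (c s k) \<le> 2 powr (real l / q) * (C0 * 2 powr (- real l / 2))"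
  proof (rule ccontr)
    assume "\<not> ?thesis"
    then have "(2 powr (real l / q) * (C0 * 2 powr (- real l / 2))) powr q < cmod (c s k) powr q"
      using q C0 by (intro powr_less_mono2) auto
    then show False using le by simp
  qed
  also have "\<dots> = C0 * (2 powr (real l / q) * 2 powr (- real l / 2))" by simp
  also have "2 powr (real l / q) * 2 powr (- real l / 2) = 2 powr (- (1/2 - 1/q) * real l)"
    unfolding powr_add[symmetric] by (rule arg_cong[where f = "\<lambda>t. 2 powr t"]) (simp add: algebra_simps)
  finally show ?thesis unfolding l_def .
qed

text \<open>Coefficients of level \<open>l \<ge> N\<close> are cut at the height \<open>threshold C0 N l\<close>; what is below it
  is small in the maximum norm, and \<open>q > 2\<close> makes what is above it geometrically small in mean square.\<close>

definition threshold :: "real \<Rightarrow> nat \<Rightarrow> nat \<Rightarrow> real" where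
  "threshold C0 N l = (if l < N then 0 else C0 * 2 powr ((real l - real N) / 4 - real l / 2))"

text \<open>The square root of the mean square bound, up to the constant \<open>C0\<close>: above
  \<open>N\<close> that bound decays with exponent \<open>(q - 2) / 4\<close>. Below
  \<open>N\<close> nothing is cut, and 2 serves because its square covers the factor 2 that arises
  there.\<close>

definition tail_weight :: "real \<Rightarrow> nat \<Rightarrow> nat \<Rightarrow> real" where
  "tail_weight q N l = (if l < N then 2 else 2 powr (- ((q - 2) / 8) * (real l - real N)))"

lemma tail_weight_pos: "0 < tail_weight q N l"
  by (simp add: tail_weight_def)

lemma powr_minus_cancel:
  fixes a :: real
  assumes "0 < a"
  shows "a powr q * a powr (2 - q) = a\<^sup>2"
  using assms by (simp add: powr_add[symmetric] powr_numeral)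

text \<open>Above a height \<open>\<tau>\<close> one has
  \<open>x\<^sup>2 \<le> x powr q * \<tau> powr (2 - q)\<close>. For levels from \<open>N\<close>
  on, \<open>\<tau>\<close> is the threshold, which exceeds the typical size \<open>B\<close> by the
  factor \<open>2 powr ((l - N) / 4)\<close>; this is the gain. For lower levels,
  \<open>\<tau> = B\<close>, and smaller coefficients count \<open>B\<^sup>2\<close> each.\<close>

lemma sum_large_coeff_square_le:
  assumes c: "in_coeff_class q C0 c" and q: "2 < q" and C0: "0 < C0"
  shows "(\<Sum>k\<in>haar_index s. (if cmod (c s k) \<le> threshold C0 N (level s) then 0 else cmod (c s k))\<^sup>2)
    \<le> C0\<^sup>2 * (tail_weight q N (level s))\<^sup>2"
proof -
  define l where "l = level s"
  define B where "B = C0 * 2 powr (- real l / 2)"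
  have B0: "0 < B" unfolding B_def using C0 by simp
  have B2: "2 ^ l * B\<^sup>2 = C0\<^sup>2"
  proof -
    have "(2 powr (- real l / 2))\<^sup>2 = 2 powr (- real l)" by (simp add: power2_eq_square powr_add[symmetric])
    then show ?thesis unfolding B_def by (simp add: power_mult_distrib powr_minus powr_realpow)
  qed
  have cB: "(\<Sum>k\<in>haar_index s. cmod (c s k) powr q) \<le> 2 ^ l * B powr q"
    using c unfolding in_coeff_class_def l_def B_def by blast
  show ?thesis
  proof (cases "l < N")
    case True
    have "(if cmod (c s k) \<le> threshold C0 N (level s) then 0 else cmod (c s k))\<^sup>2
        \<le> B\<^sup>2 + cmod (c s k) powr q * B powr (2 - q)" for k
    proof (cases "cmod (c s k) \<le> B")
      case True
      then have "(cmod (c s k))\<^sup>2 \<le> B\<^sup>2" by (intro power_mono) auto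
      moreover have "0 \<le> cmod (c s k) powr q * B powr (2 - q)" by simp
      ultimately show ?thesis by (auto intro: add_nonneg_nonneg order_trans simp del: norm_le_zero_iff)
    next
      case False
      then have "0 < cmod (c s k)" using B0 by linarith
      then have "(cmod (c s k))\<^sup>2 = cmod (c s k) powr q * cmod (c s k) powr (2 - q)" by (rule powr_minus_cancel[symmetric])
      also have "\<dots> \<le> cmod (c s k) powr q * B powr (2 - q)"
        using False B0 q by (intro mult_left_mono powr_mono2') auto
      finally have "(cmod (c s k))\<^sup>2 \<le> B\<^sup>2 + cmod (c s k) powr q * B powr (2 - q)" by (simp add: add_increasing)
      then show ?thesis by (auto intro: add_nonneg_nonneg)
    qed
    then have "(\<Sum>k\<in>haar_index s. (if cmod (c s k) \<le> threshold C0 N (level s) then 0 else cmod (c s k))\<^sup>2)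
        \<le> (\<Sum>k\<in>haar_index s. B\<^sup>2 + cmod (c s k) powr q * B powr (2 - q))"
      by (intro sum_mono)
    also have "\<dots> = real (card (haar_index s)) * B\<^sup>2 + (\<Sum>k\<in>haar_index s. cmod (c s k) powr q) * B powr (2 - q)"
      by (simp add: sum.distrib sum_distrib_right)
    also have "\<dots> \<le> 2 ^ l * B\<^sup>2 + 2 ^ l * B powr q * B powr (2 - q)"
    proof (intro add_mono mult_right_mono cB)
      have "real (card (haar_index s)) \<le> real (2 ^ l)" unfolding l_def by (intro of_nat_mono card_haar_index_le)
      then show "real (card (haar_index s)) \<le> 2 ^ l" by simp
    qed auto
    also have "\<dots> = C0\<^sup>2 * 2" using B2 powr_minus_cancel[OF B0, of q] by (simp add: mult.assoc)
    also have "\<dots> \<le> C0\<^sup>2 * (tail_weight q N (level s))\<^sup>2"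
      using True by (intro mult_left_mono) (auto simp: tail_weight_def l_def)
    finally show ?thesis .
  next
    case False
    define \<tau> where "\<tau> = threshold C0 N (level s)"
    have \<tau>: "\<tau> = B * 2 powr ((real l - real N) / 4)"
      unfolding \<tau>_def threshold_def B_def l_def[symmetric] using False by (simp add: powr_add[symmetric])
    have \<tau>0: "0 < \<tau>" unfolding \<tau> using B0 by simp
    have "(if cmod (c s k) \<le> \<tau> then 0 else cmod (c s k))\<^sup>2 \<le> cmod (c s k) powr q * \<tau> powr (2 - q)" for k
    proof (cases "cmod (c s k) \<le> \<tau>")
      case False
      then have "0 < cmod (c s k)" using \<tau>0 by linarith
      then have "(cmod (c s k))\<^sup>2 = cmod (c s k) powr q * cmod (c s k) powr (2 - q)" by (rule powr_minus_cancel[symmetric])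
      also have "\<dots> \<le> cmod (c s k) powr q * \<tau> powr (2 - q)"
        using False \<tau>0 q by (intro mult_left_mono powr_mono2') auto
      finally show ?thesis using False by simp
    qed simp
    then have "(\<Sum>k\<in>haar_index s. (if cmod (c s k) \<le> \<tau> then 0 else cmod (c s k))\<^sup>2)
        \<le> (\<Sum>k\<in>haar_index s. cmod (c s k) powr q * \<tau> powr (2 - q))"
      by (intro sum_mono)
    also have "\<dots> = (\<Sum>k\<in>haar_index s. cmod (c s k) powr q) * \<tau> powr (2 - q)" by (simp add: sum_distrib_right)
    also have "\<dots> \<le> 2 ^ l * B powr q * \<tau> powr (2 - q)" by (intro mult_right_mono cB) simp
    also have "\<dots> = C0\<^sup>2 * (2 powr ((real l - real N) / 4)) powr (2 - q)"
      unfolding \<tau> using B0 B2 powr_minus_cancel[OF B0, of q] by (simp add: powr_mult mult.assoc[symmetric])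
         (simp add: mult.assoc)
    also have "(2 powr ((real l - real N) / 4)) powr (2 - q) = (2 powr (- ((q - 2) / 8) * (real l - real N)))\<^sup>2"
      unfolding power2_eq_square powr_powr powr_add[symmetric] by (rule arg_cong[where f = "\<lambda>t. 2 powr t"]) (simp add: field_simps)
    also have "C0\<^sup>2 * \<dots> = C0\<^sup>2 * (tail_weight q N (level s))\<^sup>2"
      using False by (simp add: tail_weight_def l_def)
    finally show ?thesis unfolding \<tau>_def .
  qed
qed

lemma tail_sum_le:
  fixes c :: "('d::finite \<Rightarrow> nat) \<Rightarrow> ('d \<Rightarrow> nat) \<Rightarrow> complex"
  assumes c: "in_coeff_class q C0 c" and q: "2 < q" and C0: "0 < C0"
    and A: "finite A" "\<And>s. s \<in> A \<Longrightarrow> n2 \<le> level s"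
    and C: "\<And>a b. (\<Sum>l\<in>{a..<b}. (real l + 1) ^ (CARD('d) - 1) * 2 powr (- (1/2 - 1/q) * (real l - real a)))
      \<le> C * (real a + 1) ^ (CARD('d) - 1)"
  shows "cmod (\<Sum>s\<in>A. \<Sum>k\<in>haar_index s. c s k * of_real (haar s k x))
    \<le> C0 * C * 2 powr (- (1/2 - 1/q) * real n2) * (real n2 + 1) ^ (CARD('d) - 1)"
proof -
  define \<theta> where "\<theta> = 1/2 - 1/q"
  obtain b where b: "\<And>s. s \<in> A \<Longrightarrow> level s < b"
    using finite_nat_set_iff_bounded[of "level ` A"] A(1) by auto
  have "cmod (\<Sum>s\<in>A. \<Sum>k\<in>haar_index s. c s k * of_real (haar s k x)) \<le> (\<Sum>s\<in>A. C0 * 2 powr (- \<theta> * real (level s)))"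
    unfolding \<theta>_def by (intro sum_norm_le norm_sum_haar_le coeff_le[OF c q C0])
  also have "\<dots> \<le> (\<Sum>l\<in>{n2..<b}. (real l + 1) ^ (CARD('d) - 1) * (C0 * 2 powr (- \<theta> * real l)))"
    by (rule sum_level_le) (use A b C0 in auto)
  also have "\<dots> = (C0 * 2 powr (- \<theta> * real n2)) * (\<Sum>l\<in>{n2..<b}. (real l + 1) ^ (CARD('d) - 1) * 2 powr (- \<theta> * (real l - real n2)))"
    unfolding sum_distrib_left
  proof (intro sum.cong refl)
    fix l
    have "2 powr (- \<theta> * real l) = 2 powr (- \<theta> * real n2) * 2 powr (- \<theta> * (real l - real n2))"
      unfolding powr_add[symmetric] by (simp add: algebra_simps)
    then show "(real l + 1) ^ (CARD('d) - 1) * (C0 * 2 powr (- \<theta> * real l))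
        = C0 * 2 powr (- \<theta> * real n2) * ((real l + 1) ^ (CARD('d) - 1) * 2 powr (- \<theta> * (real l - real n2)))"
      by simp
  qed
  also have "\<dots> \<le> (C0 * 2 powr (- \<theta> * real n2)) * (C * (real n2 + 1) ^ (CARD('d) - 1))"
    using C0 C unfolding \<theta>_def by (intro mult_left_mono) auto
  finally show ?thesis unfolding \<theta>_def by (simp add: mult_ac)
qed

text \<open>A block is at most its threshold, and
  \<open>(l - N) / 4 - l / 2 = - N / 2 - (l - N) / 4\<close>, so the sum behaves like its terms at
  level \<open>N\<close>. Any slope strictly between 0 and 1/2 in place of 1/4 would leave decay
  both here and above the threshold.\<close>

lemma small_coeff_sum_le:
  fixes c :: "('d::finite \<Rightarrow> nat) \<Rightarrow> ('d \<Rightarrow> nat) \<Rightarrow> complex"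
  assumes C0: "0 < C0" and A: "A = {s. n0 \<le> level s \<and> level s < n2}" and "n0 \<le> N" "N \<le> n2"
    and C: "\<And>a b. (\<Sum>l\<in>{a..<b}. (real l + 1) ^ (CARD('d) - 1) * 2 powr (- (1/4) * (real l - real a)))
      \<le> C * (real a + 1) ^ (CARD('d) - 1)"
  shows "cmod (\<Sum>s\<in>A. \<Sum>k\<in>haar_index s. (if cmod (c s k) \<le> threshold C0 N (level s) then c s k else 0) * of_real (haar s k x))
    \<le> C0 * C * 2 powr (- real N / 2) * (real N + 1) ^ (CARD('d) - 1)"
proof -
  have fin: "finite A" unfolding A by (rule finite_subset[OF _ finite_level[of n2]]) auto
  have \<tau>0: "0 \<le> threshold C0 N l" for l using C0 by (simp add: threshold_def)
  have "cmod (\<Sum>s\<in>A. \<Sum>k\<in>haar_index s. (if cmod (c s k) \<le> threshold C0 N (level s) then c s k else 0) * of_real (haar s k x))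
      \<le> (\<Sum>s\<in>A. threshold C0 N (level s))"
    by (intro sum_norm_le norm_sum_haar_le) (use \<tau>0 in auto)
  also have "\<dots> \<le> (\<Sum>l\<in>{n0..<n2}. (real l + 1) ^ (CARD('d) - 1) * threshold C0 N l)"
    by (rule sum_level_le[OF fin]) (auto simp: A \<tau>0)
  also have "\<dots> = (\<Sum>l\<in>{N..<n2}. (real l + 1) ^ (CARD('d) - 1) * threshold C0 N l)"
    using \<open>n0 \<le> N\<close> by (intro sum.mono_neutral_right) (auto simp: threshold_def)
  also have "\<dots> = (C0 * 2 powr (- real N / 2)) * (\<Sum>l\<in>{N..<n2}. (real l + 1) ^ (CARD('d) - 1) * 2 powr (- (1/4) * (real l - real N)))"
    unfolding sum_distrib_left
  proof (intro sum.cong refl)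
    fix l assume "l \<in> {N..<n2}"
    moreover have "2 powr ((real l - real N) / 4 - real l / 2) = 2 powr (- real N / 2) * 2 powr (- (1/4) * (real l - real N))"
      unfolding powr_add[symmetric] by (rule arg_cong[where f = "\<lambda>t. 2 powr t"]) (simp add: field_simps)
    ultimately show "(real l + 1) ^ (CARD('d) - 1) * threshold C0 N l
        = C0 * 2 powr (- real N / 2) * ((real l + 1) ^ (CARD('d) - 1) * 2 powr (- (1/4) * (real l - real N)))"
      by (simp add: threshold_def)
  qed
  also have "\<dots> \<le> (C0 * 2 powr (- real N / 2)) * (C * (real N + 1) ^ (CARD('d) - 1))"
    using C0 C by (intro mult_left_mono) auto
  finally show ?thesis by (simp add: mult_ac)
qed

text \<open>The cut depends on the coefficients, but its result always lies in one fixed ellipsoid,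
  so one \<open>g\<close> serves for all \<open>c\<close>. Real and imaginary parts are approximated
  separately by the same functions, hence the factor 2. All functions involved are constant on the
  cells of order \<open>n2\<close>.\<close>

lemma large_coeff_approx:
  fixes A :: "('d::finite \<Rightarrow> nat) set"
  assumes q: "2 < q" and C0: "0 < C0" and m1: "0 < m1" and A: "A = {s. n0 \<le> level s \<and> level s < n2}"
    and W0: "0 < W" and W: "(\<Sum>l\<in>{n0..<n2}. (real l + 1) ^ (CARD('d) - 1) * tail_weight q N l) \<le> W"
  shows "\<exists>g :: nat \<Rightarrow> ('d \<Rightarrow> nat) \<times> ('d \<Rightarrow> nat) \<Rightarrow> real. \<forall>c. in_coeff_class q C0 c \<longrightarrow>
    (\<exists>y :: nat \<Rightarrow> complex. \<forall>x. cmod ((\<Sum>s\<in>A. \<Sum>k\<in>haar_index s.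
        (if cmod (c s k) \<le> threshold C0 N (level s) then 0 else c s k) * of_real (haar s k x))
      - (\<Sum>r<m1. y r * of_real (\<Sum>z\<in>Sigma A haar_index. g r z * haar (fst z) (snd z) x)))
      \<le> 2 * (C0 * W * sqrt (7000 * (3 + real n2 * real CARD('d)) / real m1)))"
proof -
  \<comment> \<open>The weights \<open>sqrt (t z)\<close> balance the two factors of the width bound: the sum of the squares
    of the basis functions and that of the coefficients are both of the order of the sum of the \<open>tail_weight\<close>s.\<close>
  define t where "t = (\<lambda>z :: ('d \<Rightarrow> nat) \<times> ('d \<Rightarrow> nat). tail_weight q N (level (fst z)))"
  define I where "I = Sigma A haar_index"
  define \<phi> where "\<phi> = (\<lambda>z x. sqrt (t z) * haar (fst z) (snd z) x)"
  have fA: "finite A" unfolding A by (rule finite_subset[OF _ finite_level[of n2]]) auto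
  have fI: "finite I" unfolding I_def using fA by simp
  have t0: "0 < t z" for z unfolding t_def by (rule tail_weight_pos)
  have sum_tw: "(\<Sum>s\<in>A. tail_weight q N (level s)) \<le> W"
  proof -
    have "(\<Sum>s\<in>A. tail_weight q N (level s)) \<le> (\<Sum>l\<in>{n0..<n2}. (real l + 1) ^ (CARD('d) - 1) * tail_weight q N l)"
      by (rule sum_level_le[OF fA]) (auto simp: A less_imp_le[OF tail_weight_pos])
    then show ?thesis using W by linarith
  qed
  have sumI: "(\<Sum>z\<in>I. f z) = (\<Sum>s\<in>A. \<Sum>k\<in>haar_index s. f (s, k))" for f :: "_ \<Rightarrow> 'b::comm_monoid_add"
    unfolding I_def using fA by (simp add: sum.Sigma)
  obtain X :: "(real ^ 'd) set" where X: "finite X" "X \<noteq> {}" "card X \<le> (2 ^ n2) ^ CARD('d)"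
    and rep: "\<And>x. \<exists>y\<in>X. cell_index n2 x = cell_index n2 y"
    using exists_cell_representatives[of n2] by blast
  have "(\<Sum>z\<in>I. (\<phi> z x)\<^sup>2) \<le> W" for x :: "real ^ 'd"
  proof -
    have "(\<Sum>z\<in>I. (\<phi> z x)\<^sup>2) = (\<Sum>s\<in>A. tail_weight q N (level s) * (\<Sum>k\<in>haar_index s. (haar s k x)\<^sup>2))"
      unfolding sumI \<phi>_def t_def
      by (simp add: power_mult_distrib sum_distrib_left less_imp_le[OF tail_weight_pos])
    also have "\<dots> \<le> (\<Sum>s\<in>A. tail_weight q N (level s) * 1)"
      by (intro sum_mono mult_left_mono sum_haar_square_le less_imp_le[OF tail_weight_pos])
    finally show ?thesis using sum_tw by simp
  qed
  then obtain u :: "nat \<Rightarrow> ('d \<Rightarrow> nat) \<times> ('d \<Rightarrow> nat) \<Rightarrow> real" where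
    u: "\<And>b \<beta>. \<lbrakk>0 < \<beta>; (\<Sum>z\<in>I. (b z)\<^sup>2) \<le> \<beta>\<rbrakk> \<Longrightarrow>
      \<exists>y. \<forall>x\<in>X. \<bar>(\<Sum>z\<in>I. b z * \<phi> z x) - (\<Sum>r<m1. y r * (\<Sum>z\<in>I. u r z * \<phi> z x))\<bar>
        \<le> sqrt (7000 * \<beta> * W * ln (8 * real (card X)) / real m1)"
    using kolmogorov_width_ellipsoid[OF fI X(1,2) m1 W0, of \<phi>] by blast
  define E where "E = C0 * W * sqrt (7000 * (3 + real n2 * real CARD('d)) / real m1)"
  \<comment> \<open>The logarithm of the number of cells enters here: \<open>8 * card X\<close> is
    at most \<open>2 ^ (3 + n2 * d)\<close>. With \<open>n2\<close> linear in \<open>N\<close> this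
    gives the extra factor of order \<open>sqrt N\<close>.\<close>
  have E: "sqrt (7000 * (C0\<^sup>2 * W) * W * ln (8 * real (card X)) / real m1) \<le> E"
  proof -
    have cX: "0 < real (card X)" using X by (simp add: card_gt_0_iff)
    have "real (card X) \<le> real ((2 ^ n2) ^ CARD('d))" using X(3) by (rule of_nat_mono)
    then have "8 * real (card X) \<le> 2 ^ 3 * 2 ^ (n2 * CARD('d))" by (simp add: power_mult)
    also have "\<dots> = 2 ^ (3 + n2 * CARD('d))" by (simp only: power_add)
    finally have "ln (8 * real (card X)) \<le> ln (2 ^ (3 + n2 * CARD('d)))" using cX by (intro ln_mono) auto
    also have "\<dots> = real (3 + n2 * CARD('d)) * ln 2" by (rule ln_realpow)
    also have "\<dots> \<le> real (3 + n2 * CARD('d)) * 1" using ln_2_less_1 by (intro mult_left_mono) auto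
    finally have ln_le: "ln (8 * real (card X)) \<le> 3 + real n2 * real CARD('d)" by simp
    have "7000 * (C0\<^sup>2 * W) * W * ln (8 * real (card X)) / real m1
        = (C0 * W)\<^sup>2 * (7000 * ln (8 * real (card X)) / real m1)"
      by (simp add: power2_eq_square)
    also have "\<dots> \<le> (C0 * W)\<^sup>2 * (7000 * (3 + real n2 * real CARD('d)) / real m1)"
      using ln_le by (intro mult_left_mono divide_right_mono) auto
    finally have "sqrt (7000 * (C0\<^sup>2 * W) * W * ln (8 * real (card X)) / real m1)
        \<le> sqrt ((C0 * W)\<^sup>2 * (7000 * (3 + real n2 * real CARD('d)) / real m1))"
      by (rule real_sqrt_le_mono)
    also have "\<dots> = E" unfolding E_def real_sqrt_mult[of "(C0 * W)\<^sup>2"] using C0 W0 by simp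
    finally show ?thesis .
  qed
  define g where "g = (\<lambda>r z. u r z * sqrt (t z))"
  show ?thesis
  proof (intro exI[of _ g] allI impI)
    fix c :: "('d \<Rightarrow> nat) \<Rightarrow> ('d \<Rightarrow> nat) \<Rightarrow> complex"
    assume c: "in_coeff_class q C0 c"
    define cc where "cc = (\<lambda>s k. if cmod (c s k) \<le> threshold C0 N (level s) then 0 else c s k)"
    have approx: "\<exists>y. \<forall>x. \<bar>(\<Sum>s\<in>A. \<Sum>k\<in>haar_index s. a (s, k) * haar s k x)
        - (\<Sum>r<m1. y r * (\<Sum>z\<in>I. g r z * haar (fst z) (snd z) x))\<bar> \<le> E"
      if a: "\<And>s k. \<bar>a (s, k)\<bar> \<le> cmod (cc s k)" for a :: "('d \<Rightarrow> nat) \<times> ('d \<Rightarrow> nat) \<Rightarrow> real"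
    proof -
      define b where "b = (\<lambda>z. a z / sqrt (t z))"
      have "(\<Sum>z\<in>I. (b z)\<^sup>2) = (\<Sum>s\<in>A. (\<Sum>k\<in>haar_index s. (a (s, k))\<^sup>2) / tail_weight q N (level s))"
        unfolding sumI b_def t_def
        by (simp add: power_divide sum_divide_distrib less_imp_le[OF tail_weight_pos])
      also have "\<dots> \<le> (\<Sum>s\<in>A. C0\<^sup>2 * tail_weight q N (level s))"
      proof (intro sum_mono)
        fix s
        have "(\<Sum>k\<in>haar_index s. (a (s, k))\<^sup>2) \<le> (\<Sum>k\<in>haar_index s. (cmod (cc s k))\<^sup>2)"
          using a by (intro sum_mono) (simp add: abs_le_square_iff[symmetric])
        also have "\<dots> = (\<Sum>k\<in>haar_index s. (if cmod (c s k) \<le> threshold C0 N (level s) then 0 else cmod (c s k))\<^sup>2)"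
          by (intro sum.cong) (auto simp: cc_def)
        also have "\<dots> \<le> C0\<^sup>2 * (tail_weight q N (level s))\<^sup>2" by (rule sum_large_coeff_square_le[OF c q C0])
        finally show "(\<Sum>k\<in>haar_index s. (a (s, k))\<^sup>2) / tail_weight q N (level s) \<le> C0\<^sup>2 * tail_weight q N (level s)"
          using tail_weight_pos[of q N "level s"] by (simp add: divide_le_eq power2_eq_square mult.assoc)
      qed
      also have "\<dots> \<le> C0\<^sup>2 * W" using sum_tw by (simp add: sum_distrib_left[symmetric] mult_left_mono)
      finally have "(\<Sum>z\<in>I. (b z)\<^sup>2) \<le> C0\<^sup>2 * W" .
      moreover have "0 < C0\<^sup>2 * W" using C0 W0 by simp
      ultimately obtain y where y: "\<And>x. x \<in> X \<Longrightarrow> \<bar>(\<Sum>z\<in>I. b z * \<phi> z x) - (\<Sum>r<m1. y r * (\<Sum>z\<in>I. u r z * \<phi> z x))\<bar>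
          \<le> sqrt (7000 * (C0\<^sup>2 * W) * W * ln (8 * real (card X)) / real m1)"
        using u[of "C0\<^sup>2 * W" b] by blast
      have "\<bar>(\<Sum>s\<in>A. \<Sum>k\<in>haar_index s. a (s, k) * haar s k x)
          - (\<Sum>r<m1. y r * (\<Sum>z\<in>I. g r z * haar (fst z) (snd z) x))\<bar> \<le> E" for x
      proof -
        obtain x' where x': "x' \<in> X" "cell_index n2 x = cell_index n2 x'" using rep by blast
        have h: "haar (fst z) (snd z) x = haar (fst z) (snd z) x'" if "z \<in> I" for z
        proof (rule haar_eq_if_cell_index_eq[OF _ x'(2)])
          fix j
          have "fst z j \<le> level (fst z)" by (rule member_le_sum) auto
          also have "\<dots> < n2" using that unfolding I_def A by auto
          finally show "fst z j \<le> n2" by simp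
        qed
        have "(\<Sum>s\<in>A. \<Sum>k\<in>haar_index s. a (s, k) * haar s k x) = (\<Sum>z\<in>I. a z * haar (fst z) (snd z) x)"
          unfolding sumI by simp
        also have "\<dots> = (\<Sum>z\<in>I. b z * \<phi> z x')"
          using t0 by (intro sum.cong refl) (simp add: b_def \<phi>_def h less_imp_neq[THEN not_sym])
        finally have 1: "(\<Sum>s\<in>A. \<Sum>k\<in>haar_index s. a (s, k) * haar s k x) = (\<Sum>z\<in>I. b z * \<phi> z x')" .
        have 2: "(\<Sum>z\<in>I. g r z * haar (fst z) (snd z) x) = (\<Sum>z\<in>I. u r z * \<phi> z x')" for r
          by (intro sum.cong refl) (simp add: g_def \<phi>_def h)
        show ?thesis unfolding 1 2 using y[OF x'(1)] E by linarith
      qed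
      then show ?thesis by blast
    qed
    obtain y1 where y1: "\<And>x. \<bar>(\<Sum>s\<in>A. \<Sum>k\<in>haar_index s. Re (cc s k) * haar s k x)
        - (\<Sum>r<m1. y1 r * (\<Sum>z\<in>I. g r z * haar (fst z) (snd z) x))\<bar> \<le> E"
      using approx[of "\<lambda>(s, k). Re (cc s k)"] by (auto simp: abs_Re_le_cmod)
    obtain y2 where y2: "\<And>x. \<bar>(\<Sum>s\<in>A. \<Sum>k\<in>haar_index s. Im (cc s k) * haar s k x)
        - (\<Sum>r<m1. y2 r * (\<Sum>z\<in>I. g r z * haar (fst z) (snd z) x))\<bar> \<le> E"
      using approx[of "\<lambda>(s, k). Im (cc s k)"] by (auto simp: abs_Im_le_cmod)
    show "\<exists>y :: nat \<Rightarrow> complex. \<forall>x. cmod ((\<Sum>s\<in>A. \<Sum>k\<in>haar_index s.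
        (if cmod (c s k) \<le> threshold C0 N (level s) then 0 else c s k) * of_real (haar s k x))
      - (\<Sum>r<m1. y r * of_real (\<Sum>z\<in>Sigma A haar_index. g r z * haar (fst z) (snd z) x)))
      \<le> 2 * (C0 * W * sqrt (7000 * (3 + real n2 * real CARD('d)) / real m1))"
    proof (intro exI[of _ "\<lambda>r. Complex (y1 r) (y2 r)"] allI)
      fix x :: "real ^ 'd"
      define e where "e = (\<Sum>s\<in>A. \<Sum>k\<in>haar_index s. cc s k * of_real (haar s k x))
        - (\<Sum>r<m1. Complex (y1 r) (y2 r) * of_real (\<Sum>z\<in>I. g r z * haar (fst z) (snd z) x))"
      have "\<bar>Re e\<bar> \<le> E" "\<bar>Im e\<bar> \<le> E" using y1[of x] y2[of x] by (simp_all add: e_def)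
      then have "cmod e \<le> 2 * E" using cmod_le[of e] by linarith
      then show "cmod ((\<Sum>s\<in>A. \<Sum>k\<in>haar_index s.
        (if cmod (c s k) \<le> threshold C0 N (level s) then 0 else c s k) * of_real (haar s k x))
      - (\<Sum>r<m1. Complex (y1 r) (y2 r) * of_real (\<Sum>z\<in>Sigma A haar_index. g r z * haar (fst z) (snd z) x)))
      \<le> 2 * (C0 * W * sqrt (7000 * (3 + real n2 * real CARD('d)) / real m1))"
        by (simp only: e_def cc_def I_def E_def)
    qed
  qed
qed

section \<open>From approximants to Kolmogorov widths\<close>

text \<open>Allows any finite index set: it is enumerated, and a system of fewer than
  \<open>m\<close> functions is padded with zeros.\<close>

lemma kolmogorov_width_le:
  fixes v :: "'i \<Rightarrow> 'a \<Rightarrow> complex"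
  assumes I: "finite I" "card I \<le> m" and v: "\<And>i. i \<in> I \<Longrightarrow> v i \<in> X" and zero: "(\<lambda>_. 0) \<in> X"
    and approx: "\<And>f. f \<in> F \<Longrightarrow> \<exists>c. N (\<lambda>x. f x - (\<Sum>i\<in>I. c i * v i x)) \<le> B"
  shows "kolmogorov_width m F X N \<le> B"
proof -
  obtain h where h: "bij_betw h {1..card I} I"
    using ex_bij_betw_nat_finite_1[OF I(1)] by blast
  define u where "u = (\<lambda>i. if i \<le> card I then v (h i) else (\<lambda>_. 0))"
  have u: "u \<in> {1..m} \<rightarrow> X"
    using v zero bij_betwE[OF h] by (auto simp: u_def)
  have "(INF c :: nat \<Rightarrow> complex. N (\<lambda>x. f x - (\<Sum>i = 1..m. c i * u i x))) \<le> B" if f: "f \<in> F" for f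
  proof -
    obtain c where c: "N (\<lambda>x. f x - (\<Sum>i\<in>I. c i * v i x)) \<le> B" using approx[OF f] by blast
    have "(\<Sum>i = 1..m. c (h i) * u i x) = (\<Sum>i\<in>I. c i * v i x)" for x
    proof -
      have "(\<Sum>i = 1..m. c (h i) * u i x) = (\<Sum>i\<in>{1..card I}. c (h i) * v (h i) x)"
        using I(2) by (intro sum.mono_neutral_cong_right) (auto simp: u_def)
      also have "\<dots> = (\<Sum>i\<in>I. c i * v i x)" by (rule sum.reindex_bij_betw[OF h])
      finally show ?thesis .
    qed
    then show ?thesis using c by (intro INF_lower2[of "\<lambda>i. c (h i)"]) auto
  qed
  then have "(SUP f\<in>F. INF c :: nat \<Rightarrow> complex. N (\<lambda>x. f x - (\<Sum>i = 1..m. c i * u i x))) \<le> B"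
    by (intro SUP_least)
  then show ?thesis unfolding kolmogorov_width_def by (intro INF_lower2[OF u])
qed

lemma borel_measurable_torus_measure:
  "g \<in> borel_measurable lebesgue \<Longrightarrow> g \<in> borel_measurable torus_measure"
  unfolding torus_measure_def uniform_measure_def by simp

lemma Lp_norm_infinity_le:
  assumes "g \<in> borel_measurable lebesgue" "AE x in torus_measure. cmod (g x) \<le> B"
  shows "Lp_norm \<infinity> g \<le> ennreal B"
proof -
  have "(\<lambda>x. ennreal (cmod (g x))) \<in> borel_measurable torus_measure"
    using borel_measurable_torus_measure[OF assms(1)] by simp
  moreover have "AE x in torus_measure. ennreal (cmod (g x)) \<le> ennreal B"
    using assms(2) by (elim eventually_mono) (rule ennreal_leI)
  ultimately have "esssup torus_measure (\<lambda>x. ennreal (cmod (g x))) \<le> ennreal B" by (rule esssup_I)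
  then show ?thesis by (simp add: Lp_norm_def)
qed

lemma Lp_space_infinityI:
  assumes "g \<in> borel_measurable lebesgue" "\<And>x j. g (x + axis j (2 * pi)) = g x" "\<And>x. cmod (g x) \<le> B"
  shows "g \<in> Lp_space \<infinity>"
proof -
  have "Lp_norm \<infinity> g \<le> ennreal B" using assms by (intro Lp_norm_infinity_le) auto
  then show ?thesis using assms by (auto simp: Lp_space_def torus_periodic_def intro: le_less_trans)
qed

lemma kolmogorov_width_mixed_Hoelder_le:
  fixes p :: ennreal and n0 N n2 m m1 :: nat
  defines "q \<equiv> (if p = \<infinity> then 3 else enn2real p)"
    and "C0 \<equiv> 2 * (2 * pi) powr (real CARD('d) / 2)"
    and "D \<equiv> CARD('d::finite) - 1"
  assumes p: "2 < p" and m1: "0 < m1" and n: "n0 \<le> N" "N \<le> n2"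
    and card: "card (Sigma {s :: 'd \<Rightarrow> nat. level s < n0} haar_index) + m1 \<le> m"
    and W0: "0 < W" and W: "(\<Sum>l\<in>{n0..<n2}. (real l + 1) ^ D * tail_weight q N l) \<le> W"
    and C1: "\<And>a b. (\<Sum>l\<in>{a..<b}. (real l + 1) ^ D * 2 powr (- (1/4) * (real l - real a))) \<le> C1 * (real a + 1) ^ D"
    and C3: "\<And>a b. (\<Sum>l\<in>{a..<b}. (real l + 1) ^ D * 2 powr (- (1/2 - 1/q) * (real l - real a))) \<le> C3 * (real a + 1) ^ D"
  shows "kolmogorov_width m (mixed_Hoelder_class (1/2) p :: (real ^ 'd \<Rightarrow> complex) set) (Lp_space \<infinity>) (Lp_norm \<infinity>)
    \<le> ennreal (C0 * C1 * 2 powr (- real N / 2) * (real N + 1) ^ D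
      + 2 * (C0 * W * sqrt (7000 * (3 + real n2 * real CARD('d)) / real m1))
      + C0 * C3 * 2 powr (- (1/2 - 1/q) * real n2) * (real n2 + 1) ^ D)"
    (is "_ \<le> ennreal ?E")
proof -
  have q: "2 < q" using exponent_gt_2[OF p, of q] by (simp add: q_def)
  have C0: "0 < C0" unfolding C0_def by simp
  define B where "B = {s :: 'd \<Rightarrow> nat. level s < n0}"
  define A where "A = {s :: 'd \<Rightarrow> nat. n0 \<le> level s \<and> level s < n2}"
  have fB: "finite B" unfolding B_def by (rule finite_level)
  have fA: "finite A" unfolding A_def by (rule finite_subset[OF _ finite_level[of n2]]) auto
  from large_coeff_approx[OF q C0 m1 A_def W0 W[unfolded D_def]]
  obtain g :: "nat \<Rightarrow> ('d \<Rightarrow> nat) \<times> ('d \<Rightarrow> nat) \<Rightarrow> real" where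
    g: "\<And>c. in_coeff_class q C0 c \<Longrightarrow> \<exists>y :: nat \<Rightarrow> complex. \<forall>x. cmod ((\<Sum>s\<in>A. \<Sum>k\<in>haar_index s.
        (if cmod (c s k) \<le> threshold C0 N (level s) then 0 else c s k) * of_real (haar s k x))
      - (\<Sum>r<m1. y r * of_real (\<Sum>z\<in>Sigma A haar_index. g r z * haar (fst z) (snd z) x)))
      \<le> 2 * (C0 * W * sqrt (7000 * (3 + real n2 * real CARD('d)) / real m1))"
    by blast
  define P where "P = Sigma B haar_index"
  define v :: "('d \<Rightarrow> nat) \<times> ('d \<Rightarrow> nat) + nat \<Rightarrow> real ^ 'd \<Rightarrow> complex" where
    "v = case_sum (\<lambda>z x. of_real (haar (fst z) (snd z) x))
      (\<lambda>r x. of_real (\<Sum>z\<in>Sigma A haar_index. g r z * haar (fst z) (snd z) x))"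
  have fP: "finite P" unfolding P_def using fB by simp
  have v_meas: "v i \<in> borel_measurable lebesgue" for i
  proof (cases i)
    case (Inl z)
    have [measurable]: "haar (fst z) (snd z) \<in> borel_measurable (lebesgue :: (real ^ 'd) measure)" by (rule haar_measurable)
    show ?thesis unfolding Inl v_def by simp
  next
    case (Inr r)
    have [measurable]: "haar (fst z) (snd z) \<in> borel_measurable (lebesgue :: (real ^ 'd) measure)" for z :: "('d \<Rightarrow> nat) \<times> ('d \<Rightarrow> nat)"
      by (rule haar_measurable)
    show ?thesis unfolding Inr v_def by simp
  qed
  have v_in: "v i \<in> Lp_space \<infinity>" for i
  proof (cases i)
    case (Inl z)
    show ?thesis
    proof (rule Lp_space_infinityI[OF v_meas, of _ 1])
      show "v i (x + axis j (2 * pi)) = v i x" for x j by (simp add: v_def Inl haar_periodic)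
      show "cmod (v i x) \<le> 1" for x by (simp add: v_def Inl haar_abs_le)
    qed
  next
    case (Inr r)
    show ?thesis
    proof (rule Lp_space_infinityI[OF v_meas, of _ "\<Sum>z\<in>Sigma A haar_index. \<bar>g r z\<bar>"])
      show "v i (x + axis j (2 * pi)) = v i x" for x j by (simp add: v_def Inr haar_periodic)
      fix x :: "real ^ 'd"
      have "\<bar>\<Sum>z\<in>Sigma A haar_index. g r z * haar (fst z) (snd z) x\<bar>
          \<le> (\<Sum>z\<in>Sigma A haar_index. \<bar>g r z * haar (fst z) (snd z) x\<bar>)" by (rule sum_abs)
      also have "\<dots> \<le> (\<Sum>z\<in>Sigma A haar_index. \<bar>g r z\<bar> * 1)"
        unfolding abs_mult by (intro sum_mono mult_left_mono haar_abs_le) simp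
      finally show "cmod (v i x) \<le> (\<Sum>z\<in>Sigma A haar_index. \<bar>g r z\<bar>)"
        by (simp add: v_def Inr del: of_real_sum of_real_mult)
    qed
  qed
  show ?thesis
  proof (rule kolmogorov_width_le[where I = "P <+> {..<m1}" and v = v])
    show "finite (P <+> {..<m1})" using fP by simp
    show "card (P <+> {..<m1}) \<le> m" using card fP by (simp add: card_Plus P_def B_def)
    show "v i \<in> Lp_space \<infinity>" for i by (rule v_in)
    show "(\<lambda>_. 0 :: complex) \<in> Lp_space \<infinity>" by (rule Lp_space_infinityI[of _ 0]) auto
    fix f :: "real ^ 'd \<Rightarrow> complex" assume f: "f \<in> mixed_Hoelder_class (1/2) p"
    define c where "c = haar_coeff f"
    have c: "in_coeff_class q C0 c"
      unfolding in_coeff_class_def c_def C0_def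
      using mixed_Hoelder_class_haar_coeff[OF p q_def[THEN meta_eq_to_obj_eq] f] by blast
    obtain y :: "nat \<Rightarrow> complex" where
      y: "\<And>x. cmod ((\<Sum>s\<in>A. \<Sum>k\<in>haar_index s.
        (if cmod (c s k) \<le> threshold C0 N (level s) then 0 else c s k) * of_real (haar s k x))
      - (\<Sum>r<m1. y r * of_real (\<Sum>z\<in>Sigma A haar_index. g r z * haar (fst z) (snd z) x)))
      \<le> 2 * (C0 * W * sqrt (7000 * (3 + real n2 * real CARD('d)) / real m1))"
      using g[OF c] by blast
    define cy where "cy = case_sum (\<lambda>z. c (fst z) (snd z)) y"
    define S where "S = (\<lambda>x. \<Sum>i\<in>P <+> {..<m1}. cy i * v i x)"
    have S_eq: "S x = (\<Sum>s\<in>B. \<Sum>k\<in>haar_index s. c s k * of_real (haar s k x))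
        + (\<Sum>r<m1. y r * of_real (\<Sum>z\<in>Sigma A haar_index. g r z * haar (fst z) (snd z) x))" for x
      unfolding S_def using fP fB by (simp add: sum.Plus cy_def v_def P_def sum.Sigma split_def)
    have S_meas: "S \<in> borel_measurable lebesgue"
      unfolding S_def using v_meas by measurable
    have "AE x in torus_measure. cmod (f x - S x) \<le> ?E"
    proof (rule mixed_Hoelder_class_AE_le[OF p q_def[THEN meta_eq_to_obj_eq] f S_meas, of n2])
      fix n and x :: "real ^ 'd" assume n2n: "n2 \<le> n"
      define U where "U = (PiE UNIV (\<lambda>_. {..n}) :: ('d \<Rightarrow> nat) set)"
      define T where "T = {s\<in>U. n2 \<le> level s}"
      have fU: "finite U" unfolding U_def by (intro finite_PiE) auto
      have lev: "s j \<le> level s" for s :: "'d \<Rightarrow> nat" and j by (rule member_le_sum) auto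
      \<comment> \<open>No component exceeds the level, so every cube of order
        \<open>n \<ge> n2\<close> contains all levels below \<open>n2\<close>; the rest of the cube
        is tail. Hence the error bound does not depend on \<open>n\<close>.\<close>
      have "s \<in> U" if "level s < n2" for s :: "'d \<Rightarrow> nat"
      proof -
        have "s j \<le> n" for j using lev[of s j] that n2n by linarith
        then show ?thesis by (simp add: U_def PiE_UNIV_domain)
      qed
      then have U_eq: "U = B \<union> (A \<union> T)" using n unfolding A_def B_def T_def by fastforce
      have disj: "B \<inter> (A \<union> T) = {}" "A \<inter> T = {}" using n by (auto simp: A_def B_def T_def)
      have fT: "finite T" unfolding T_def using fU by simp
      define H where "H = (\<lambda>s. \<Sum>k\<in>haar_index s. c s k * of_real (haar s k x))"
      define S1 where "S1 = (\<Sum>s\<in>A. \<Sum>k\<in>haar_index s. (if cmod (c s k) \<le> threshold C0 N (level s) then c s k else 0) * of_real (haar s k x))"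
      define S2 where "S2 = (\<Sum>s\<in>A. \<Sum>k\<in>haar_index s. (if cmod (c s k) \<le> threshold C0 N (level s) then 0 else c s k) * of_real (haar s k x))"
      have "(\<Sum>s\<in>U. H s) = (\<Sum>s\<in>B. H s) + ((\<Sum>s\<in>A. H s) + (\<Sum>s\<in>T. H s))"
        unfolding U_eq using disj fA fB fT by (simp add: sum.union_disjoint)
      moreover have "(\<Sum>s\<in>A. H s) = S1 + S2"
        unfolding H_def S1_def S2_def sum.distrib[symmetric] by (intro sum.cong refl) simp
      ultimately have "(\<Sum>s\<in>U. H s) - S x = S1 + (S2 - (\<Sum>r<m1. y r * of_real (\<Sum>z\<in>Sigma A haar_index. g r z * haar (fst z) (snd z) x))) + (\<Sum>s\<in>T. H s)"
        unfolding S_eq H_def by simp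
      moreover have "cmod S1 \<le> C0 * C1 * 2 powr (- real N / 2) * (real N + 1) ^ D"
        unfolding S1_def D_def by (rule small_coeff_sum_le[OF C0 A_def n C1[unfolded D_def]])
      moreover have "cmod (\<Sum>s\<in>T. H s) \<le> C0 * C3 * 2 powr (- (1/2 - 1/q) * real n2) * (real n2 + 1) ^ D"
        unfolding H_def D_def by (rule tail_sum_le[OF c q C0 fT _ C3[unfolded D_def]]) (simp add: T_def)
      ultimately have "cmod ((\<Sum>s\<in>U. H s) - S x) \<le> ?E"
        using y[of x] unfolding S2_def[symmetric]
        by (smt (verit) norm_triangle_ineq)
      then show "cmod ((\<Sum>s\<in>PiE UNIV (\<lambda>_. {..n}). \<Sum>k\<in>haar_index s. haar_coeff f s k * of_real (haar s k x)) - S x) \<le> ?E"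
        unfolding U_def H_def c_def .
    qed
    moreover have "(\<lambda>x. f x - S x) \<in> borel_measurable lebesgue"
      using f S_meas by (auto simp: mixed_Hoelder_class_def Lp_space_def)
    ultimately have "Lp_norm \<infinity> (\<lambda>x. f x - S x) \<le> ennreal ?E" by (intro Lp_norm_infinity_le)
    then show "\<exists>c. Lp_norm \<infinity> (\<lambda>x. f x - (\<Sum>i\<in>P <+> {..<m1}. c i * v i x)) \<le> ennreal ?E"
      unfolding S_def by blast
  qed
qed

section \<open>Upper bounds for the widths\<close>

text \<open>There are at most \<open>(N + 1) ^ d * 2 ^ n0\<close> Haar functions of level below
  \<open>n0\<close>. Lowering \<open>n0\<close> by \<open>d * a\<close>, where \<open>2 ^ a\<close>
  is at least \<open>N + 1\<close>, pays for the polynomial, and two more levels leave a quarter of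
  \<open>m\<close>. This gap is the origin of log log m.\<close>

lemma card_low_levels_le:
  assumes "2 ^ N \<le> m" "N + 1 \<le> 2 ^ a"
  shows "4 * card (Sigma {s :: 'd::finite \<Rightarrow> nat. level s < N - (2 + CARD('d) * a)} haar_index) \<le> m"
proof (cases "N \<le> 2 + CARD('d) * a")
  case True
  then have "{s :: 'd \<Rightarrow> nat. level s < N - (2 + CARD('d) * a)} = {}" by simp
  then show ?thesis by simp
next
  case False
  define n0 where "n0 = N - (2 + CARD('d) * a)"
  have n0: "n0 + (2 + CARD('d) * a) = N" using False by (simp add: n0_def)
  let ?B = "{s :: 'd \<Rightarrow> nat. level s < n0}"
  have fB: "finite ?B" by (rule finite_level)
  have "real (card (Sigma ?B haar_index)) = (\<Sum>s\<in>?B. real (card (haar_index s)))"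
    using fB by (subst card_SigmaI) auto
  also have "\<dots> \<le> (\<Sum>s\<in>?B. 2 ^ level s)"
  proof (intro sum_mono)
    fix s :: "'d \<Rightarrow> nat"
    have "real (card (haar_index s)) \<le> real (2 ^ level s)" by (intro of_nat_mono card_haar_index_le)
    then show "real (card (haar_index s)) \<le> 2 ^ level s" by simp
  qed
  also have "\<dots> \<le> (\<Sum>l\<in>{0..<n0}. (real l + 1) ^ (CARD('d) - 1) * 2 ^ l)"
    by (rule sum_level_le[OF fB]) auto
  also have "\<dots> \<le> (\<Sum>l\<in>{0..<n0}. (2 ^ a) ^ CARD('d) * 2 ^ l)"
  proof (intro sum_mono mult_right_mono)
    fix l assume "l \<in> {0..<n0}"
    then have "real (l + 1) \<le> real (2 ^ a)" using n0 assms(2) by (intro of_nat_mono) simp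
    then have "(real l + 1) ^ (CARD('d) - 1) \<le> (2 ^ a) ^ (CARD('d) - 1)" by (intro power_mono) auto
    also have "\<dots> \<le> (2 ^ a :: real) ^ CARD('d)" by (intro power_increasing) auto
    finally show "(real l + 1) ^ (CARD('d) - 1) \<le> (2 ^ a) ^ CARD('d)" .
  qed simp
  also have "\<dots> = (2 ^ a) ^ CARD('d) * (2 ^ n0 - 1)"
    unfolding sum_distrib_left[symmetric] by (simp add: atLeast0LessThan sum_power2[unfolded atLeast0LessThan] geometric_sum)
  also have "\<dots> \<le> (2 ^ a) ^ CARD('d) * 2 ^ n0" by (intro mult_left_mono) auto
  also have "4 * \<dots> = 2 ^ N"
    unfolding n0[symmetric] by (simp add: power_add power_mult[symmetric] mult.commute)
  finally have "4 * real (card (Sigma ?B haar_index)) \<le> 2 ^ N" by simp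
  also have "\<dots> \<le> real m" using assms(1) by (metis of_nat_le_iff of_nat_numeral of_nat_power)
  finally show ?thesis unfolding n0_def by simp
qed

lemma two_powr_le_powr_minus_half:
  assumes "m < 2 ^ (N + 1)" "0 < m"
  shows "2 powr (- (real N + 1) / 2) \<le> real m powr (- 1/2)"
proof -
  have "real m \<le> real (2 ^ (N + 1))" using assms by (intro of_nat_mono) simp
  then have "real m \<le> 2 powr (real N + 1)" by (simp add: powr_add powr_realpow)
  then have "(2 powr (real N + 1)) powr (- 1/2) \<le> real m powr (- 1/2)"
    using assms by (intro powr_mono2') auto
  moreover have "(2 powr (real N + 1)) powr (- 1/2) = 2 powr (- (real N + 1) / 2)"
    unfolding powr_powr by (rule arg_cong[where f = "\<lambda>t. 2 powr t"]) (simp add: field_simps)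
  ultimately show ?thesis by simp
qed

text \<open>The at most \<open>J\<close> levels below \<open>N\<close> have weight 2 each, and those
  from \<open>N\<close> on sum to a multiple of the first: this is how the gap enters the bound as a
  factor.\<close>

lemma sum_tail_weight_le:
  assumes q: "2 < q" and n: "n0 \<le> N" "N \<le> n2" "N \<le> n0 + J" "1 \<le> J" and "0 < C2"
    and C2: "\<And>a b. (\<Sum>l\<in>{a..<b}. (real l + 1) ^ D * 2 powr (- ((q - 2) / 8) * (real l - real a))) \<le> C2 * (real a + 1) ^ D"
  shows "(\<Sum>l\<in>{n0..<n2}. (real l + 1) ^ D * tail_weight q N l) \<le> (2 + C2) * real J * (real N + 1) ^ D"
proof -
  have "(\<Sum>l\<in>{n0..<n2}. (real l + 1) ^ D * tail_weight q N l)
      = (\<Sum>l\<in>{n0..<N}. (real l + 1) ^ D * tail_weight q N l) + (\<Sum>l\<in>{N..<n2}. (real l + 1) ^ D * tail_weight q N l)"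
    using n by (intro sum.atLeastLessThan_concat[symmetric])
  also have "\<dots> \<le> (\<Sum>l\<in>{n0..<N}. (real N + 1) ^ D * 2) + C2 * (real N + 1) ^ D"
  proof (intro add_mono sum_mono mult_mono power_mono)
    have "(\<Sum>l\<in>{N..<n2}. (real l + 1) ^ D * tail_weight q N l)
        = (\<Sum>l\<in>{N..<n2}. (real l + 1) ^ D * 2 powr (- ((q - 2) / 8) * (real l - real N)))"
      by (intro sum.cong) (auto simp: tail_weight_def)
    then show "(\<Sum>l\<in>{N..<n2}. (real l + 1) ^ D * tail_weight q N l) \<le> C2 * (real N + 1) ^ D"
      using C2[of N n2] by simp
  qed (auto simp: tail_weight_def)
  also have "\<dots> = (2 * real (N - n0) + C2) * (real N + 1) ^ D" by (simp add: algebra_simps)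
  also have "\<dots> \<le> ((2 + C2) * real J) * (real N + 1) ^ D"
  proof (intro mult_right_mono)
    have "real (N - n0) \<le> real J" using n by (intro of_nat_mono) simp
    moreover have "C2 * 1 \<le> C2 * real J" using n(4) \<open>0 < C2\<close> by (intro mult_left_mono) auto
    ultimately show "2 * real (N - n0) + C2 \<le> (2 + C2) * real J" by (simp add: distrib_right)
  qed simp
  finally show ?thesis .
qed

lemma kolmogorov_width_mixed_Hoelder_dyadic:
  fixes p :: ennreal
  assumes p: "2 < p"
  shows "\<exists>K>0. \<forall>m N a. 2 \<le> m \<longrightarrow> 2 ^ N \<le> m \<longrightarrow> m < 2 ^ (N + 1) \<longrightarrow> N + 1 \<le> 2 ^ a \<longrightarrow>
    kolmogorov_width m (mixed_Hoelder_class (1/2) p :: (real ^ 'd \<Rightarrow> complex) set) (Lp_space \<infinity>) (Lp_norm \<infinity>)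
      \<le> ennreal (K * (real (2 + CARD('d) * a) * ((real N + 1) powr (real CARD('d) - 1/2) * real m powr (- 1/2))))"
proof -
  define q where "q = (if p = \<infinity> then 3 else enn2real p)"
  have q: "2 < q" using exponent_gt_2[OF p, of q] by (simp add: q_def)
  define C0 where "C0 = 2 * (2 * pi) powr (real CARD('d) / 2)"
  have C0: "0 < C0" unfolding C0_def by simp
  define D where "D = CARD('d) - 1"
  define \<theta> where "\<theta> = 1/2 - 1/q"
  have \<theta>: "0 < \<theta>" unfolding \<theta>_def using q by (simp add: field_simps)
  obtain C1 where C1: "0 < C1" "\<And>a b. (\<Sum>l\<in>{a..<b}. (real l + 1) ^ D * 2 powr (- (1/4) * (real l - real a))) \<le> C1 * (real a + 1) ^ D"
    using sum_power_geometric_le[of "1/4" D] by auto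
  obtain C2 where C2: "0 < C2" "\<And>a b. (\<Sum>l\<in>{a..<b}. (real l + 1) ^ D * 2 powr (- ((q - 2) / 8) * (real l - real a))) \<le> C2 * (real a + 1) ^ D"
    using sum_power_geometric_le[of "(q - 2) / 8" D] q by auto
  obtain C3 where C3: "0 < C3" "\<And>a b. (\<Sum>l\<in>{a..<b}. (real l + 1) ^ D * 2 powr (- \<theta> * (real l - real a))) \<le> C3 * (real a + 1) ^ D"
    using sum_power_geometric_le[OF \<theta>, of D] by auto
  \<comment> \<open>\<open>R\<close> makes the dropped tail at most
    \<open>2 powr (- (N + 1) / 2)\<close>, hence at most \<open>m powr (- 1/2)\<close>, while
    \<open>n2 = R * (N + 1)\<close> stays linear in \<open>N\<close>.\<close>
  obtain R0 where R0: "1 / (2 * \<theta>) \<le> real R0" using real_arch_simple by blast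
  define R where "R = Suc R0"
  have R1: "1 \<le> R" unfolding R_def by simp
  have R: "1/2 \<le> \<theta> * real R"
  proof -
    have "1 / (2 * \<theta>) \<le> real R" using R0 unfolding R_def by simp
    then show ?thesis using \<theta> by (simp add: field_simps)
  qed
  \<comment> \<open>\<open>21000 = 3 * 7000\<close>, because \<open>m \<le> 3 * (m div 2)\<close>
    for \<open>m \<ge> 2\<close>, with equality at \<open>m = 3\<close>.\<close>
  define Q where "Q = sqrt (21000 * (3 + real R * real CARD('d)))"
  define K where "K = 2 * (C0 * C1) + 2 * (C0 * (2 + C2)) * Q + C0 * C3 * (2 * real R) ^ D"
  have Q0: "0 \<le> Q" unfolding Q_def by simp
  have K0: "0 < K" unfolding K_def using C0 C1 C2 C3 Q0 by (intro add_pos_nonneg) auto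
  show ?thesis
  proof (intro exI[of _ K] conjI K0 allI impI)
    fix m N a :: nat
    assume m2: "2 \<le> m" and Nm: "2 ^ N \<le> m" "m < 2 ^ (N + 1)" and a: "N + 1 \<le> 2 ^ a"
    define J where "J = 2 + CARD('d) * a"
    define n0 where "n0 = N - J"
    define n2 where "n2 = R * (N + 1)"
    define m1 where "m1 = m div 2"
    define W where "W = (2 + C2) * real J * (real N + 1) ^ D"
    define M where "M = real m powr (- 1/2)"
    define X where "X = (real N + 1) powr (real CARD('d) - 1/2)"
    have m1: "0 < m1" unfolding m1_def using m2 by simp
    have J1: "1 \<le> real J" unfolding J_def by simp
    have N_n2: "N \<le> n2" unfolding n2_def R_def by simp
    have W0: "0 < W" unfolding W_def using C2 J1 by simp
    have W: "(\<Sum>l\<in>{n0..<n2}. (real l + 1) ^ D * tail_weight q N l) \<le> W"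
      unfolding W_def by (rule sum_tail_weight_le[OF q _ N_n2 _ _ C2]) (auto simp: n0_def J_def)
    have card: "card (Sigma {s :: 'd \<Rightarrow> nat. level s < n0} haar_index) + m1 \<le> m"
      using card_low_levels_le[where 'd = 'd, OF Nm(1) a] unfolding n0_def J_def m1_def by linarith
    note bound = kolmogorov_width_mixed_Hoelder_le[where 'd = 'd, OF p m1 _ N_n2 card W0, folded q_def C0_def D_def \<theta>_def, OF _ W C1(2) C3(2)]
    have "kolmogorov_width m (mixed_Hoelder_class (1/2) p :: (real ^ 'd \<Rightarrow> complex) set) (Lp_space \<infinity>) (Lp_norm \<infinity>)
        \<le> ennreal (C0 * C1 * 2 powr (- real N / 2) * (real N + 1) ^ D
          + 2 * (C0 * W * sqrt (7000 * (3 + real n2 * real CARD('d)) / real m1))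
          + C0 * C3 * 2 powr (- \<theta> * real n2) * (real n2 + 1) ^ D)"
      by (rule bound) (simp add: n0_def)
    also have "\<dots> \<le> ennreal (K * (real J * (X * M)))"
    proof (rule ennreal_leI)
      have M0: "0 \<le> M" unfolding M_def by simp
      have half: "2 powr (- (real N + 1) / 2) \<le> M"
        unfolding M_def using Nm m2 by (intro two_powr_le_powr_minus_half) auto
      have XD: "(real N + 1) ^ D * (real N + 1) powr (1/2) = X"
      proof -
        have "real D + 1/2 = real CARD('d) - 1/2" unfolding D_def by (simp add: of_nat_diff Suc_leI)
        moreover have "(real N + 1) ^ D * (real N + 1) powr (1/2) = (real N + 1) powr (real D + 1/2)"
          by (simp add: powr_add powr_realpow)
        ultimately show ?thesis unfolding X_def by (simp only:)
      qed
      have DX: "(real N + 1) ^ D \<le> X"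
      proof -
        have "1 \<le> (real N + 1) powr (1/2)" by (rule ge_one_powr_ge_zero) auto
        then have "(real N + 1) ^ D * 1 \<le> (real N + 1) ^ D * (real N + 1) powr (1/2)" by (intro mult_left_mono) auto
        then show ?thesis unfolding XD by simp
      qed
      have X0: "0 \<le> X" unfolding X_def by simp
      have XM: "X * M \<le> real J * (X * M)" using mult_right_mono[OF J1, of "X * M"] X0 M0 by simp
      have e1: "C0 * C1 * 2 powr (- real N / 2) * (real N + 1) ^ D \<le> 2 * (C0 * C1) * (real J * (X * M))"
      proof -
        have "2 powr (- real N / 2) = 2 powr (1/2) * 2 powr (- (real N + 1) / 2)"
          unfolding powr_add[symmetric] by (rule arg_cong[where f = "\<lambda>t. 2 powr t"]) (simp add: field_simps)
        also have "\<dots> \<le> 2 powr 1 * M" using half by (intro mult_mono powr_mono) auto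
        finally have "2 powr (- real N / 2) \<le> 2 * M" by simp
        then have "C0 * C1 * 2 powr (- real N / 2) * (real N + 1) ^ D \<le> C0 * C1 * (2 * M) * X"
          using DX C0 C1 M0 by (intro mult_mono mult_left_mono) auto
        also have "\<dots> = 2 * (C0 * C1) * (X * M)" by simp
        also have "\<dots> \<le> 2 * (C0 * C1) * (real J * (X * M))" using XM C0 C1 by (intro mult_left_mono) auto
        finally show ?thesis .
      qed
      have e2: "2 * (C0 * W * sqrt (7000 * (3 + real n2 * real CARD('d)) / real m1)) \<le> 2 * (C0 * (2 + C2)) * Q * (real J * (X * M))"
      proof -
        have "m \<le> 3 * m1" using m2 unfolding m1_def by presburger
        then have "real m \<le> real (3 * m1)" by (rule of_nat_mono)
        then have m3: "real m / 3 \<le> real m1" by simp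
        have "3 + real n2 * real CARD('d) \<le> (3 + real R * real CARD('d)) * (real N + 1)"
          unfolding n2_def by (simp add: algebra_simps)
        then have "7000 * (3 + real n2 * real CARD('d)) / real m1 \<le> 7000 * ((3 + real R * real CARD('d)) * (real N + 1)) / (real m / 3)"
          using m3 m1 m2 by (intro frac_le mult_left_mono) auto
        also have "\<dots> = 21000 * (3 + real R * real CARD('d)) * ((real N + 1) * (1 / real m))" by simp
        finally have "sqrt (7000 * (3 + real n2 * real CARD('d)) / real m1)
            \<le> sqrt (21000 * (3 + real R * real CARD('d)) * ((real N + 1) * (1 / real m)))" by (rule real_sqrt_le_mono)
        also have "\<dots> = Q * ((real N + 1) powr (1/2) * M)"
        proof -
          have "sqrt (1 / real m) = M"
            unfolding M_def using m2 by (simp add: real_sqrt_divide powr_minus powr_half_sqrt field_simps)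
          moreover have "sqrt (real N + 1) = (real N + 1) powr (1/2)" by (simp add: powr_half_sqrt)
          ultimately show ?thesis unfolding Q_def real_sqrt_mult by simp
        qed
        finally have "2 * (C0 * W * sqrt (7000 * (3 + real n2 * real CARD('d)) / real m1))
            \<le> 2 * (C0 * W * (Q * ((real N + 1) powr (1/2) * M)))"
          using C0 W0 by (intro mult_left_mono) auto
        also have "\<dots> = 2 * (C0 * (2 + C2)) * Q * (real J * (((real N + 1) ^ D * (real N + 1) powr (1/2)) * M))"
          unfolding W_def by simp
        finally show ?thesis unfolding XD .
      qed
      have e3: "C0 * C3 * 2 powr (- \<theta> * real n2) * (real n2 + 1) ^ D \<le> C0 * C3 * (2 * real R) ^ D * (real J * (X * M))"
      proof -
        have "1/2 * (real N + 1) \<le> \<theta> * real R * (real N + 1)" using R by (intro mult_right_mono) auto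
        then have "- \<theta> * real n2 \<le> - (real N + 1) / 2" unfolding n2_def by (simp add: algebra_simps)
        then have "2 powr (- \<theta> * real n2) \<le> 2 powr (- (real N + 1) / 2)" by (intro powr_mono) auto
        then have p1: "2 powr (- \<theta> * real n2) \<le> M" using half by linarith
        have "real n2 + 1 \<le> 2 * real R * (real N + 1)"
        proof -
          have "1 * 1 \<le> real R * (real N + 1)" using R1 by (intro mult_mono) auto
          then show ?thesis unfolding n2_def by (simp add: algebra_simps)
        qed
        then have "(real n2 + 1) ^ D \<le> (2 * real R * (real N + 1)) ^ D" by (intro power_mono) auto
        also have "\<dots> = (2 * real R) ^ D * (real N + 1) ^ D" by (rule power_mult_distrib)
        also have "\<dots> \<le> (2 * real R) ^ D * X" using DX by (intro mult_left_mono) auto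
        finally have p2: "(real n2 + 1) ^ D \<le> (2 * real R) ^ D * X" .
        have "C0 * C3 * 2 powr (- \<theta> * real n2) * (real n2 + 1) ^ D \<le> C0 * C3 * M * ((2 * real R) ^ D * X)"
          using p1 p2 C0 C3 M0 by (intro mult_mono mult_left_mono) auto
        also have "\<dots> = C0 * C3 * (2 * real R) ^ D * (X * M)" by simp
        also have "\<dots> \<le> C0 * C3 * (2 * real R) ^ D * (real J * (X * M))" using XM C0 C3 by (intro mult_left_mono) auto
        finally show ?thesis .
      qed
      show "C0 * C1 * 2 powr (- real N / 2) * (real N + 1) ^ D
          + 2 * (C0 * W * sqrt (7000 * (3 + real n2 * real CARD('d)) / real m1))
          + C0 * C3 * 2 powr (- \<theta> * real n2) * (real n2 + 1) ^ D \<le> K * (real J * (X * M))"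
        using e1 e2 e3 unfolding K_def by (simp only: distrib_right)
    qed
    finally show "kolmogorov_width m (mixed_Hoelder_class (1/2) p :: (real ^ 'd \<Rightarrow> complex) set) (Lp_space \<infinity>) (Lp_norm \<infinity>)
      \<le> ennreal (K * (real (2 + CARD('d) * a) * ((real N + 1) powr (real CARD('d) - 1/2) * real m powr (- 1/2))))"
      unfolding J_def X_def M_def .
  qed
qed

theorem theorem3p6:
  fixes p :: ennreal
  assumes "2 \<le> CARD('d::finite)" and "2 < p"
  shows "\<exists>C::real. C > 0 \<and> (\<forall>m::nat. 3 \<le> m \<longrightarrow>
    kolmogorov_width m (mixed_Hoelder_class (1/2) p :: (real ^ 'd \<Rightarrow> complex) set) (Lp_space \<infinity>) (Lp_norm \<infinity>)
      \<le> ennreal (C * real m powr (-1/2) * ln (real m) powr (real CARD('d) - 1/2)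
                   * ln (ln (real m)) powr (3/2)))"
proof -
  from kolmogorov_width_mixed_Hoelder_dyadic[where 'd = 'd, OF assms(2)]
  obtain K where K0: "0 < K" and K: "\<And>m N a. \<lbrakk>2 \<le> m; 2 ^ N \<le> m; m < 2 ^ (N + 1); N + 1 \<le> 2 ^ a\<rbrakk> \<Longrightarrow>
    kolmogorov_width m (mixed_Hoelder_class (1/2) p :: (real ^ 'd \<Rightarrow> complex) set) (Lp_space \<infinity>) (Lp_norm \<infinity>)
      \<le> ennreal (K * (real (2 + CARD('d) * a) * ((real N + 1) powr (real CARD('d) - 1/2) * real m powr (- 1/2))))"
    by blast
  define d where "d = real CARD('d)"
  have d: "2 \<le> d" unfolding d_def using assms(1) by simp
  \<comment> \<open>The least value of ln (ln m) for \<open>m \<ge> 3\<close>. It is positive but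
    smaller than 1, so constants and low powers have to be absorbed into the power 3/2 with negative
    powers of \<open>\<kappa>\<close>.\<close>
  define \<kappa> :: real where "\<kappa> = ln (ln 3)"
  have \<kappa>: "0 < \<kappa>" unfolding \<kappa>_def using ln3_gt_1 by simp
  \<comment> \<open>With \<open>x = ln (ln m)\<close>, the gap \<open>2 + d * (e + 1)\<close> is at
    most \<open>(2 + 5 * d) + 2 * d * x\<close>. From \<open>x \<ge> \<kappa>\<close> follow
    \<open>1 \<le> \<kappa> powr (- 3/2) * x powr (3/2)\<close> and
    \<open>x \<le> \<kappa> powr (- 1/2) * x powr (3/2)\<close>.\<close>
  define K2 where "K2 = (2 + 5 * d) * \<kappa> powr (- 3/2) + 2 * d * \<kappa> powr (- 1/2)"
  have K2: "0 < K2" unfolding K2_def using d \<kappa> by (intro add_pos_nonneg) auto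
  define C where "C = K * K2 * 3 powr (d - 1/2)"
  have C: "0 < C" unfolding C_def using K0 K2 by simp
  show ?thesis
  proof (intro exI[of _ C] conjI C allI impI)
    fix m :: nat assume m: "3 \<le> m"
    obtain N where N: "2 ^ N \<le> m" "m < 2 ^ (N + 1)" using ex_power_ivl1[of 2 m] m by auto
    \<comment> \<open>\<open>a = e + 1\<close> is the least exponent with
      \<open>N + 1 < 2 ^ a\<close>; it is of order log log m.\<close>
    obtain e where e: "2 ^ e \<le> N + 1" "N + 1 < 2 ^ (e + 1)" using ex_power_ivl1[of 2 "N + 1"] by auto
    define y where "y = ln (real m)"
    define x where "x = ln y"
    have "ln 3 \<le> y" unfolding y_def using m by (intro ln_mono) auto
    then have y1: "1 < y" using ln3_gt_1 by linarith
    have x: "\<kappa> \<le> x" unfolding x_def \<kappa>_def using \<open>ln 3 \<le> y\<close> ln3_gt_1 by (intro ln_mono) auto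
    have N3: "real N + 1 \<le> 3 * y"
    proof -
      have "real (2 ^ N) \<le> real m" using N(1) by (rule of_nat_mono)
      then have "ln (2 ^ N) \<le> y" unfolding y_def using m by (intro ln_mono) auto
      then have "real N * ln 2 \<le> y" by (simp add: ln_realpow)
      moreover have "real N * (1/2) \<le> real N * ln 2" using ln2_ge_two_thirds by (intro mult_left_mono) auto
      ultimately show ?thesis using y1 by linarith
    qed
    have e_le: "real e \<le> 4 + 2 * x"
    proof -
      have "real (2 ^ e) \<le> real (N + 1)" using e(1) by (rule of_nat_mono)
      then have "2 ^ e \<le> 3 * y" using N3 by simp
      then have "ln (2 ^ e) \<le> ln (3 * y)" using y1 by (intro ln_mono) auto
      then have "real e * ln 2 \<le> ln 3 + x" using y1 by (simp add: ln_realpow ln_mult x_def)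
      moreover have "real e * (1/2) \<le> real e * ln 2" using ln2_ge_two_thirds by (intro mult_left_mono) auto
      moreover have "ln 3 \<le> (2 :: real)" using ln_le_minus_one[of "3 :: real"] by simp
      ultimately show ?thesis by linarith
    qed
    have J: "real (2 + CARD('d) * (e + 1)) \<le> K2 * x powr (3/2)"
    proof -
      have x0: "0 < x" using x \<kappa> by linarith
      have "1 \<le> (x / \<kappa>) powr (3/2)" using x \<kappa> by (intro ge_one_powr_ge_zero) auto
      then have i1: "1 \<le> \<kappa> powr (- 3/2) * x powr (3/2)" using x0 \<kappa> by (simp add: powr_divide powr_minus field_simps)
      have "1 \<le> (x / \<kappa>) powr (1/2)" using x \<kappa> by (intro ge_one_powr_ge_zero) auto
      then have "1 \<le> \<kappa> powr (- 1/2) * x powr (1/2)" using x0 \<kappa> by (simp add: powr_divide powr_minus field_simps)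
      then have "x * 1 \<le> x * (\<kappa> powr (- 1/2) * x powr (1/2))" using x0 by (intro mult_left_mono) auto
      also have "\<dots> = \<kappa> powr (- 1/2) * (x powr 1 * x powr (1/2))" using x0 by simp
      also have "x powr 1 * x powr (1/2) = x powr (3/2)" unfolding powr_add[symmetric] by simp
      finally have i2: "x \<le> \<kappa> powr (- 1/2) * x powr (3/2)" by simp
      have "real (2 + CARD('d) * (e + 1)) = 2 + d * (real e + 1)"
        unfolding d_def by (simp add: distrib_left)
      also have "\<dots> \<le> 2 + d * (5 + 2 * x)" using e_le d by (intro add_left_mono mult_left_mono) auto
      also have "\<dots> = (2 + 5 * d) * 1 + 2 * d * x" by (simp add: algebra_simps)
      also have "\<dots> \<le> (2 + 5 * d) * (\<kappa> powr (- 3/2) * x powr (3/2)) + 2 * d * (\<kappa> powr (- 1/2) * x powr (3/2))"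
        using i1 i2 d by (intro add_mono mult_left_mono) auto
      finally show ?thesis unfolding K2_def by (simp add: algebra_simps)
    qed
    have "kolmogorov_width m (mixed_Hoelder_class (1/2) p :: (real ^ 'd \<Rightarrow> complex) set) (Lp_space \<infinity>) (Lp_norm \<infinity>)
        \<le> ennreal (K * (real (2 + CARD('d) * (e + 1)) * ((real N + 1) powr (real CARD('d) - 1/2) * real m powr (- 1/2))))"
      using m N e by (intro K) auto
    also have "\<dots> \<le> ennreal (K * ((K2 * x powr (3/2)) * ((3 * y) powr (d - 1/2) * real m powr (- 1/2))))"
    proof -
      have "(real N + 1) powr (d - 1/2) \<le> (3 * y) powr (d - 1/2)" using N3 d by (intro powr_mono2) auto
      then have "(real N + 1) powr (d - 1/2) * real m powr (- 1/2) \<le> (3 * y) powr (d - 1/2) * real m powr (- 1/2)"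
        by (rule mult_right_mono) simp
      from mult_mono[OF J this] show ?thesis
        using K0 K2 unfolding d_def[symmetric] by (intro ennreal_leI mult_left_mono) auto
    qed
    also have "\<dots> = ennreal (C * real m powr (-1/2) * ln (real m) powr (real CARD('d) - 1/2) * ln (ln (real m)) powr (3/2))"
      unfolding C_def y_def[symmetric] d_def[symmetric] x_def[symmetric]
      using y1 by (simp add: powr_mult mult_ac)
    finally show "kolmogorov_width m (mixed_Hoelder_class (1/2) p :: (real ^ 'd \<Rightarrow> complex) set) (Lp_space \<infinity>) (Lp_norm \<infinity>)
      \<le> ennreal (C * real m powr (-1/2) * ln (real m) powr (real CARD('d) - 1/2) * ln (ln (real m)) powr (3/2))" .
  qed
qed

end
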